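(* Let $T$ be a tree rooted at infinity with vertex set $V$, endowed with a locally doubling flow measure $m$. Suppose that $\theta\in(0,1)$, $1<q_1<q<\infty$, $1<p<p_1<\infty$, $\frac1q=\frac{1-\theta}{q_1}$ and $\frac1p=1-\theta+\frac{\theta}{p_1}$. Then the following hold for the complex interpolation spaces: (i) $(L^{q_1}(m),BMO(m))_{[\theta]}=L^q(m)$; (ii) $(H^1(m),L^{p_1}(m))_{[\theta]}=L^p(m)$.
   Context: Tree with root at infinity: $T=(V,E)$ is an (undirected) tree with geodesic distance $d$, $o\in V$ is a fixed origin, and a half-infinite geodesic starting at $o$ is fixed, identified with a boundary point, the root. For $x\in V$ let $\Pi(x)$ be the vertex of this geodesic closest to $x$; the level of $x$ is $\ell(x)=d(o,\Pi(x))-d(\Pi(x),x)$. Write $x\ge y$ iff $\ell(x)-\ell(y)=d(x,y)$. The set of sons of $x$ is $s(x)=\{y\sim x:\ \ell(y)=\ell(x)-1\}$. Flow measure: a function $m:V\to(0,\infty)$ with $m(x)=\sum_{y\in s(x)}m(y)$ for all $x\in V$; also regarded as the measure $m(A)=\sum_{x\in A}m(x)$, with $\int_A f\,dm=\sum_{y\in A}f(y)m(y)$. It is locally doubling if for every $r>0$ there is $C_r>1$ with $m(B_{2r}(x))\le C_r m(B_r(x))$ for all $x\in V$, where $B_r(x)$ is the closed ball of radius $r$ for $d$. Admissible trapezoids: for integers $h''>h'\ge1$ and $x_0\in V$, $R_{h'}^{h''}(x_0)=\{x\in V:\ x\le x_0,\ \ell(x_0)-h''<\ell(x)\le \ell(x_0)-h'\}$.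 Fix $\beta\ge12$. $\mathcal R$ is the family of all singletons $\{x_0\}$ and all $R_{h'}^{h''}(x_0)$ with $2\le h''/h'\le\beta$, $x_0\in V$. $BMO(m)$: $f_R=\frac1{m(R)}\int_R f\,dm$; $BMO(m)$ is the space of functions $f:V\to\mathbb C$ with $\|f\|_{BMO}=\sup_{R\in\mathcal R}\frac1{m(R)}\int_R|f-f_R|\,dm<\infty$, modulo constants. $H^1(m)$: a $(1,\infty)$-atom is a function $a$ supported in some $R\in\mathcal R$ with $\|a\|_\infty\le m(R)^{-1}$ and $\int_R a\,dm=0$. $H^1(m)$ is the space of all $g\in L^1(m)$ of the form $g=\sum_j\lambda_ja_j$ with $a_j$ $(1,\infty)$-atoms and $\lambda_j\in\mathbb C$, $\sum_j|\lambda_j|<\infty$; $\|g\|_{H^1}$ is the infimum of $\sum_j|\lambda_j|$ over all such decompositions. Complex interpolation: for compatible normed spaces $A_0,A_1$ let $\Sigma=\{z\in\mathbb C:\Re z\in(0,1)\}$ and let $\mathcal F(A_0,A_1)$ be the class of functions $F:\overline\Sigma\to A_0+A_1$ such that for every $\ell$ in the dual of $A_0+A_1$ the map $z\mapsto\langle F(z),\ell\rangle$ is continuous and bounded in $\overline\Sigma$ and analytic in $\Sigma$, and such that $t\mapsto F(it)$ is bounded with values in $A_0$ and $t\mapsto F(1+it)$ is bounded with values in $A_1$, $t\in\mathbb R$. Put $\|F\|_{\mathcal F}=\sup_{t\in\mathbb R}\max(\|F(it)\|_{A_0},\|F(1+it)\|_{A_1})$. Then $(A_0,A_1)_{[\theta]}$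 consists of all $f=F(\theta)$ with $F\in\mathcal F(A_0,A_1)$, with norm $\|f\|_{[\theta]}=\inf\{\|F\|_{\mathcal F}:F(\theta)=f\}$ (Calderón's complex method). Equalities of spaces mean equality with equivalent norms; in couples involving $BMO(m)$, functions are considered modulo constants. *)

theory Defs
  imports "HOL-Analysis.Analysis" "HOL-Library.Function_Algebras"
begin

section \<open>Trees with root at infinity\<close>

text \<open>The vertex set is the universe of the type \<open>'v\<close>; \<open>adj\<close> is the adjacency relation.\<close>

definition is_tree :: "('v \<Rightarrow> 'v \<Rightarrow> bool) \<Rightarrow> bool" where
  "is_tree adj \<longleftrightarrow>
     (\<forall>x. \<not> adj x x) \<and> (\<forall>x y. adj x y \<longrightarrow> adj y x) \<and>
     (\<forall>x y. adj\<^sup>*\<^sup>* x y) \<and>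
     (\<nexists>xs. 3 \<le> length xs \<and> distinct xs \<and> successively adj xs \<and> adj (last xs) (hd xs))"

definition gdist :: "('v \<Rightarrow> 'v \<Rightarrow> bool) \<Rightarrow> 'v \<Rightarrow> 'v \<Rightarrow> nat" where
  "gdist adj x y = (LEAST n. (adj ^^ n) x y)"

definition gball :: "('v \<Rightarrow> 'v \<Rightarrow> bool) \<Rightarrow> 'v \<Rightarrow> real \<Rightarrow> 'v set" where
  "gball adj x r = {y. real (gdist adj x y) \<le> r}"

text \<open>The half-infinite geodesic is given by its vertices \<open>\<omega> 0, \<omega> 1, \<dots>\<close>;
  the origin of the tree is \<open>\<omega> 0\<close>. In a tree the point of the geodesic closest to a given
  vertex exists and is unique, so the choice made in \<open>ray_proj\<close> is harmless.\<close>

definition geodesic_ray :: "('v \<Rightarrow> 'v \<Rightarrow> bool) \<Rightarrow> (nat \<Rightarrow> 'v) \<Rightarrow> bool" where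
  "geodesic_ray adj \<omega> \<longleftrightarrow> (\<forall>i j. i \<le> j \<longrightarrow> gdist adj (\<omega> i) (\<omega> j) = j - i)"

definition ray_proj :: "('v \<Rightarrow> 'v \<Rightarrow> bool) \<Rightarrow> (nat \<Rightarrow> 'v) \<Rightarrow> 'v \<Rightarrow> 'v" where
  "ray_proj adj \<omega> x = arg_min_on (gdist adj x) (range \<omega>)"

definition level :: "('v \<Rightarrow> 'v \<Rightarrow> bool) \<Rightarrow> (nat \<Rightarrow> 'v) \<Rightarrow> 'v \<Rightarrow> int" where
  "level adj \<omega> x =
     int (gdist adj (\<omega> 0) (ray_proj adj \<omega> x)) - int (gdist adj (ray_proj adj \<omega> x) x)"

definition below :: "('v \<Rightarrow> 'v \<Rightarrow> bool) \<Rightarrow> (nat \<Rightarrow> 'v) \<Rightarrow> 'v \<Rightarrow> 'v \<Rightarrow> bool" where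
  "below adj \<omega> y x \<longleftrightarrow> level adj \<omega> x - level adj \<omega> y = int (gdist adj x y)"

definition sons :: "('v \<Rightarrow> 'v \<Rightarrow> bool) \<Rightarrow> (nat \<Rightarrow> 'v) \<Rightarrow> 'v \<Rightarrow> 'v set" where
  "sons adj \<omega> x = {y. adj x y \<and> level adj \<omega> y = level adj \<omega> x - 1}"


section \<open>Flow measures\<close>

text \<open>Local finiteness of the tree is not assumed, hence the unordered sum; it is a
  consequence of local doubling.\<close>

definition flow_measure :: "('v \<Rightarrow> 'v \<Rightarrow> bool) \<Rightarrow> (nat \<Rightarrow> 'v) \<Rightarrow> ('v \<Rightarrow> real) \<Rightarrow> bool" where
  "flow_measure adj \<omega> m \<longleftrightarrow> (\<forall>x. 0 < m x) \<and> (\<forall>x. (m has_sum m x) (sons adj \<omega> x))"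

definition vmeas :: "('v \<Rightarrow> real) \<Rightarrow> 'v measure" where
  "vmeas m = point_measure UNIV (\<lambda>x. ennreal (m x))"

definition locally_doubling :: "('v \<Rightarrow> 'v \<Rightarrow> bool) \<Rightarrow> ('v \<Rightarrow> real) \<Rightarrow> bool" where
  "locally_doubling adj m \<longleftrightarrow>
     (\<forall>r>0. \<exists>C>1. \<forall>x. emeasure (vmeas m) (gball adj x (2 * r))
                        \<le> ennreal C * emeasure (vmeas m) (gball adj x r))"


section \<open>Admissible trapezoids\<close>

definition trapezoid ::
    "('v \<Rightarrow> 'v \<Rightarrow> bool) \<Rightarrow> (nat \<Rightarrow> 'v) \<Rightarrow> int \<Rightarrow> int \<Rightarrow> 'v \<Rightarrow> 'v set" where
  "trapezoid adj \<omega> h' h'' x0 =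
     {x. below adj \<omega> x x0 \<and> level adj \<omega> x0 - h'' < level adj \<omega> x
         \<and> level adj \<omega> x \<le> level adj \<omega> x0 - h'}"

definition admissible ::
    "('v \<Rightarrow> 'v \<Rightarrow> bool) \<Rightarrow> (nat \<Rightarrow> 'v) \<Rightarrow> real \<Rightarrow> 'v set set" where
  "admissible adj \<omega> \<beta> =
     {{x0} |x0. True} \<union>
     {trapezoid adj \<omega> h' h'' x0 |h' h'' x0.
        1 \<le> h' \<and> h' < h'' \<and> 2 \<le> real_of_int h'' / real_of_int h'
        \<and> real_of_int h'' / real_of_int h' \<le> \<beta>}"


section \<open>The spaces\<close>

text \<open>A (semi)normed space is a subset of an ambient complex vector space together with a
  function whose values on that subset are the norms.\<close>

record 'x nspace =
  car :: "'x set"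
  nrm :: "'x \<Rightarrow> real"

definition same_space :: "'x nspace \<Rightarrow> 'x nspace \<Rightarrow> bool" where
  "same_space A B \<longleftrightarrow> car A = car B \<and>
     (\<exists>c>0. \<exists>C>0. \<forall>x\<in>car A. c * nrm B x \<le> nrm A x \<and> nrm A x \<le> C * nrm B x)"

text \<open>Every vertex has positive mass and every set is measurable, so an \<open>L\<^sup>p\<close> class is a single
  function and the essential supremum is the supremum.\<close>

definition Lp :: "('v \<Rightarrow> real) \<Rightarrow> real \<Rightarrow> ('v \<Rightarrow> complex) nspace" where
  "Lp m p =
     \<lparr> car = {f. integrable (vmeas m) (\<lambda>x. norm (f x) powr p)},
       nrm = (\<lambda>f. (LINT x|vmeas m. norm (f x) powr p) powr (1 / p)) \<rparr>"

definition avg :: "('v \<Rightarrow> real) \<Rightarrow> 'v set \<Rightarrow> ('v \<Rightarrow> complex) \<Rightarrow> complex" where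
  "avg m R f = (LINT x:R|vmeas m. f x) / of_real (measure (vmeas m) R)"

definition osc :: "('v \<Rightarrow> real) \<Rightarrow> ('v \<Rightarrow> complex) \<Rightarrow> 'v set \<Rightarrow> real" where
  "osc m f R = (LINT x:R|vmeas m. norm (f x - avg m R f)) / measure (vmeas m) R"

text \<open>BMO before passing to the quotient by constants; here \<open>nrm\<close> is only a seminorm.\<close>

definition BMO ::
    "('v \<Rightarrow> 'v \<Rightarrow> bool) \<Rightarrow> (nat \<Rightarrow> 'v) \<Rightarrow> real \<Rightarrow> ('v \<Rightarrow> real) \<Rightarrow> ('v \<Rightarrow> complex) nspace" where
  "BMO adj \<omega> \<beta> m =
     \<lparr> car = {f. bdd_above (osc m f ` admissible adj \<omega> \<beta>)},
       nrm = (\<lambda>f. SUP R\<in>admissible adj \<omega> \<beta>. osc m f R) \<rparr>"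

definition is_atom ::
    "('v \<Rightarrow> 'v \<Rightarrow> bool) \<Rightarrow> (nat \<Rightarrow> 'v) \<Rightarrow> real \<Rightarrow> ('v \<Rightarrow> real) \<Rightarrow> ('v \<Rightarrow> complex) \<Rightarrow> bool" where
  "is_atom adj \<omega> \<beta> m a \<longleftrightarrow>
     (\<exists>R\<in>admissible adj \<omega> \<beta>.
        (\<forall>x. x \<notin> R \<longrightarrow> a x = 0) \<and>
        (\<forall>x. norm (a x) \<le> inverse (measure (vmeas m) R)) \<and>
        (LINT x:R|vmeas m. a x) = 0)"

text \<open>The series converges in the norm of \<open>L\<^sup>1\<close>.\<close>

definition atomic_decomp ::
    "('v \<Rightarrow> 'v \<Rightarrow> bool) \<Rightarrow> (nat \<Rightarrow> 'v) \<Rightarrow> real \<Rightarrow> ('v \<Rightarrow> real) \<Rightarrow> ('v \<Rightarrow> complex)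
      \<Rightarrow> (nat \<Rightarrow> complex) \<Rightarrow> (nat \<Rightarrow> 'v \<Rightarrow> complex) \<Rightarrow> bool" where
  "atomic_decomp adj \<omega> \<beta> m g c a \<longleftrightarrow>
     (\<forall>j. is_atom adj \<omega> \<beta> m (a j)) \<and> summable (\<lambda>j. norm (c j)) \<and>
     (\<lambda>n. nrm (Lp m 1) (\<lambda>x. g x - (\<Sum>j<n. c j * a j x))) \<longlonglongrightarrow> 0"

definition H1 ::
    "('v \<Rightarrow> 'v \<Rightarrow> bool) \<Rightarrow> (nat \<Rightarrow> 'v) \<Rightarrow> real \<Rightarrow> ('v \<Rightarrow> real) \<Rightarrow> ('v \<Rightarrow> complex) nspace" where
  "H1 adj \<omega> \<beta> m =
     \<lparr> car = {g \<in> car (Lp m 1). \<exists>c a. atomic_decomp adj \<omega> \<beta> m g c a},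
       nrm = (\<lambda>g. Inf {(\<Sum>j. norm (c j)) |c a. atomic_decomp adj \<omega> \<beta> m g c a}) \<rparr>"


section \<open>Functions modulo constants\<close>

definition eq_mod_const :: "('v \<Rightarrow> complex) \<Rightarrow> ('v \<Rightarrow> complex) \<Rightarrow> bool" where
  "eq_mod_const f g \<longleftrightarrow> (\<exists>c. \<forall>x. f x = g x + c)"

lemma equivp_eq_mod_const: "equivp (eq_mod_const :: ('v \<Rightarrow> complex) \<Rightarrow> _)"
proof (rule equivpI)
  show "reflp (eq_mod_const :: ('v \<Rightarrow> complex) \<Rightarrow> _)"
    by (auto simp: reflp_def eq_mod_const_def intro: exI[of _ 0])
  show "symp (eq_mod_const :: ('v \<Rightarrow> complex) \<Rightarrow> _)"
  proof (rule sympI)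
    fix f g :: "'v \<Rightarrow> complex"
    assume "eq_mod_const f g"
    then obtain c where "\<forall>x. f x = g x + c" by (auto simp: eq_mod_const_def)
    then have "\<forall>x. g x = f x + (- c)" by simp
    then show "eq_mod_const g f" unfolding eq_mod_const_def by blast
  qed
  show "transp (eq_mod_const :: ('v \<Rightarrow> complex) \<Rightarrow> _)"
  proof (rule transpI)
    fix f g h :: "'v \<Rightarrow> complex"
    assume "eq_mod_const f g" "eq_mod_const g h"
    then obtain c d where "\<forall>x. f x = g x + c" "\<forall>x. g x = h x + d"
      by (auto simp: eq_mod_const_def)
    then have "\<forall>x. f x = h x + (d + c)" by simp
    then show "eq_mod_const f h" unfolding eq_mod_const_def by blast
  qed
qed

quotient_type 'v modc = "'v \<Rightarrow> complex" / eq_mod_const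
  morphisms rep_modc to_modc
  by (rule equivp_eq_mod_const)

instantiation modc :: (type) ab_group_add
begin

lift_definition zero_modc :: "'a modc" is "0 :: 'a \<Rightarrow> complex" .

lift_definition plus_modc :: "'a modc \<Rightarrow> 'a modc \<Rightarrow> 'a modc"
  is "(+) :: ('a \<Rightarrow> complex) \<Rightarrow> _"
proof -
  fix f f' g g' :: "'a \<Rightarrow> complex"
  assume "eq_mod_const f f'" "eq_mod_const g g'"
  then obtain c d where "\<forall>x. f x = f' x + c" "\<forall>x. g x = g' x + d"
    by (auto simp: eq_mod_const_def)
  then have "\<forall>x. (f + g) x = (f' + g') x + (c + d)" by simp
  then show "eq_mod_const (f + g) (f' + g')" unfolding eq_mod_const_def by blast
qed

lift_definition uminus_modc :: "'a modc \<Rightarrow> 'a modc"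
  is "uminus :: ('a \<Rightarrow> complex) \<Rightarrow> _"
proof -
  fix f f' :: "'a \<Rightarrow> complex"
  assume "eq_mod_const f f'"
  then obtain c where "\<forall>x. f x = f' x + c" by (auto simp: eq_mod_const_def)
  then have "\<forall>x. (- f) x = (- f') x + (- c)" by simp
  then show "eq_mod_const (- f) (- f')" unfolding eq_mod_const_def by blast
qed

definition minus_modc :: "'a modc \<Rightarrow> 'a modc \<Rightarrow> 'a modc" where
  "minus_modc f g = f + (- g)"

instance
proof
  fix f g h :: "'a modc"
  have refl: "eq_mod_const u u" for u :: "'a \<Rightarrow> complex"
    using equivp_eq_mod_const by (rule equivp_reflp)
  show "f + g + h = f + (g + h)" by transfer (simp add: add.assoc refl)
  show "f + g = g + f" by transfer (simp add: add.commute refl)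
  show "0 + f = f" by transfer (simp add: refl)
  show "- f + f = 0" by transfer (simp add: refl)
  show "f - g = f + (- g)" by (rule minus_modc_def)
qed

end

definition scale_fun :: "complex \<Rightarrow> ('v \<Rightarrow> complex) \<Rightarrow> ('v \<Rightarrow> complex)" where
  "scale_fun c f = (\<lambda>x. c * f x)"

lift_definition scale_modc :: "complex \<Rightarrow> 'v modc \<Rightarrow> 'v modc" is scale_fun
proof -
  fix c and f f' :: "'v \<Rightarrow> complex"
  assume "eq_mod_const f f'"
  then obtain d where "\<forall>x. f x = f' x + d" by (auto simp: eq_mod_const_def)
  then have "\<forall>x. scale_fun c f x = scale_fun c f' x + c * d"
    by (simp add: scale_fun_def distrib_left)
  then show "eq_mod_const (scale_fun c f) (scale_fun c f')"
    unfolding eq_mod_const_def by blast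
qed

lemma vector_space_scale_fun: "vector_space (scale_fun :: complex \<Rightarrow> ('v \<Rightarrow> complex) \<Rightarrow> _)"
  by unfold_locales (auto simp: scale_fun_def fun_eq_iff algebra_simps)

lemma vector_space_scale_modc: "vector_space (scale_modc :: complex \<Rightarrow> 'v modc \<Rightarrow> _)"
proof -
  interpret vector_space "scale_fun :: complex \<Rightarrow> ('v \<Rightarrow> complex) \<Rightarrow> _"
    by (rule vector_space_scale_fun)
  have refl: "eq_mod_const u u" for u :: "'v \<Rightarrow> complex"
    using equivp_eq_mod_const by (rule equivp_reflp)
  show ?thesis
    by unfold_locales
      (transfer, simp add: scale_right_distrib scale_left_distrib refl)+
qed

text \<open>The image of a space in the quotient, with the quotient norm. On \<open>BMO\<close> the infimum is over
  a single value; on \<open>L\<^sup>q\<close> it is over a single function, because a flow measure has infinite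
  total mass and so \<open>L\<^sup>q\<close> contains no nonzero constant.\<close>

definition mod_const :: "('v \<Rightarrow> complex) nspace \<Rightarrow> 'v modc nspace" where
  "mod_const A =
     \<lparr> car = to_modc ` car A,
       nrm = (\<lambda>u. Inf {nrm A f |f. f \<in> car A \<and> to_modc f = u}) \<rparr>"


section \<open>Complex interpolation\<close>

text \<open>In this section \<open>sc\<close> is the scalar multiplication of the ambient complex vector space.\<close>

definition sum_space :: "'x::ab_group_add nspace \<Rightarrow> 'x nspace \<Rightarrow> 'x nspace" where
  "sum_space A B =
     \<lparr> car = {a + b |a b. a \<in> car A \<and> b \<in> car B},
       nrm = (\<lambda>x. Inf {nrm A a + nrm B b |a b. a \<in> car A \<and> b \<in> car B \<and> x = a + b}) \<rparr>"

definition in_dual ::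
    "(complex \<Rightarrow> 'x \<Rightarrow> 'x::ab_group_add) \<Rightarrow> 'x nspace \<Rightarrow> ('x \<Rightarrow> complex) \<Rightarrow> bool" where
  "in_dual sc A l \<longleftrightarrow>
     (\<forall>x\<in>car A. \<forall>y\<in>car A. l (x + y) = l x + l y) \<and>
     (\<forall>c. \<forall>x\<in>car A. l (sc c x) = c * l x) \<and>
     (\<exists>K. \<forall>x\<in>car A. norm (l x) \<le> K * nrm A x)"

definition calderon_class ::
    "(complex \<Rightarrow> 'x \<Rightarrow> 'x::ab_group_add) \<Rightarrow> 'x nspace \<Rightarrow> 'x nspace \<Rightarrow> (complex \<Rightarrow> 'x) set" where
  "calderon_class sc A0 A1 =
     {F. (\<forall>z. 0 \<le> Re z \<and> Re z \<le> 1 \<longrightarrow> F z \<in> car (sum_space A0 A1)) \<and>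
         (\<forall>l. in_dual sc (sum_space A0 A1) l \<longrightarrow>
            continuous_on {z. 0 \<le> Re z \<and> Re z \<le> 1} (\<lambda>z. l (F z)) \<and>
            bounded ((\<lambda>z. l (F z)) ` {z. 0 \<le> Re z \<and> Re z \<le> 1}) \<and>
            (\<lambda>z. l (F z)) analytic_on {z. 0 < Re z \<and> Re z < 1}) \<and>
         (\<forall>t. F (Complex 0 t) \<in> car A0) \<and> (\<exists>K. \<forall>t. nrm A0 (F (Complex 0 t)) \<le> K) \<and>
         (\<forall>t. F (Complex 1 t) \<in> car A1) \<and> (\<exists>K. \<forall>t. nrm A1 (F (Complex 1 t)) \<le> K)}"

definition calderon_norm :: "'x nspace \<Rightarrow> 'x nspace \<Rightarrow> (complex \<Rightarrow> 'x) \<Rightarrow> real" where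
  "calderon_norm A0 A1 F =
     (SUP t. max (nrm A0 (F (Complex 0 t))) (nrm A1 (F (Complex 1 t))))"

definition interp ::
    "(complex \<Rightarrow> 'x \<Rightarrow> 'x::ab_group_add) \<Rightarrow> 'x nspace \<Rightarrow> 'x nspace \<Rightarrow> real \<Rightarrow> 'x nspace" where
  "interp sc A0 A1 \<theta> =
     \<lparr> car = {F (of_real \<theta>) |F. F \<in> calderon_class sc A0 A1},
       nrm = (\<lambda>f. Inf {calderon_norm A0 A1 F |F.
                        F \<in> calderon_class sc A0 A1 \<and> F (of_real \<theta>) = f}) \<rparr>"

end

theory Submission
  imports Defs "HOL-Complex_Analysis.Complex_Analysis"
begin

text \<open>
  Since a trapezoid can be cut vertically at twice its inner height, or horizontally into
  trapezoids below the sons of its vertex, every large trapezoid carries a finite laminar family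
  of admissible sets reaching down to singletons in which consecutive sets have comparable
  measure. Stopping this family at the heights \<open>2\<^sup>k\<close> writes a finitely supported function \<open>g\<close> of mean
  zero as a finite sum of layers \<open>b\<^sub>k\<close>; each layer is a combination of atoms of total
  weight \<open>O(2\<^sup>k m(\<Omega>\<^sub>k))\<close>, where \<open>\<Omega>\<^sub>k\<close> is a level set of the maximal function of \<open>g\<close>. Hence
  \<open>\<Sum>\<^sub>k 2 powr (k (p (1 - z) + (p / p\<^sub>1) z - 1)) b\<^sub>k\<close> is an explicit analytic family joining \<open>H\<^sup>1\<close> to
  \<open>L\<close> with exponent \<open>p\<^sub>1\<close>, equal to \<open>g\<close> at \<open>\<theta>\<close>.

  Summing such families over a series of functions of this kind gives
  the inclusion of \<open>L\<^sup>p\<close> in the interpolation space of (ii). Pairing an arbitrary Calderon function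
  of the couple in (i) with such a family and applying the three lines theorem gives, by duality,
  the inclusion of the interpolation space of (i) in \<open>L\<^sup>q\<close>. The
  remaining two inclusions only use the families \<open>\<bar>g\<bar>\<^sup>z sgn g\<close>.
\<close>

section \<open>Trees with a root at infinity\<close>

text \<open>The doubling constant may depend on the radius, so the Calderon-Zygmund theory of
  doubling spaces is not at hand. Stopping a family at averages above a threshold needs less: every
  set below the top lies in a larger one of comparable mass. The top has no larger set, but there
  the mean of \<open>g\<close> is zero; so the lowest stopped average vanishes and the layers
  telescope to \<open>g\<close> without a remainder.

  The exponent of the analytic family is the one for which both edges cost the same quantity, the
  sum over \<open>k\<close> of \<open>2 powr (k * p)\<close> times the mass of
  \<open>\<Omega>\<^sub>k\<close>. On the left edge this is the total atomic weight. On the right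
  edge the layers at one vertex form a geometric sum governed by the largest level, and the power
  \<open>p1\<close> brings the exponent back to \<open>p\<close>. The weak type inequality bounds
  the quantity by the \<open>p\<close>-th power of the norm of \<open>g\<close>.

  The Calderon class yields analyticity only after a functional is applied. Test families are
  therefore finite sums of scalar entire functions times fixed functionals, to which the scalar
  three lines theorem applies. The pairing of BMO with a layer is a finite sum, so no identification
  of BMO with a dual space enters.\<close>

locale tree_graph =
  fixes adj :: "'v \<Rightarrow> 'v \<Rightarrow> bool"
  assumes tree: "is_tree adj"
begin

lemma adj_irrefl: "\<not> adj x x" and adj_sym: "adj x y \<Longrightarrow> adj y x"
  and connected: "adj\<^sup>*\<^sup>* x y"
  and no_cycle: "\<lbrakk>3 \<le> length xs; distinct xs; successively adj xs\<rbrakk> \<Longrightarrow> \<not> adj (last xs) (hd xs)"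
  using tree unfolding is_tree_def by blast+

abbreviation d where "d \<equiv> gdist adj"

lemma relpowp_d: "(adj ^^ d x y) x y"
  unfolding gdist_def using connected[of x y] rtranclp_imp_relpowp by (metis LeastI_ex)

lemma d_le: "(adj ^^ n) x y \<Longrightarrow> d x y \<le> n"
  unfolding gdist_def by (rule Least_le)

lemma d_refl: "d x x = 0"
  using d_le[of 0 x x] by simp

lemma d_eq_0: "d x y = 0 \<longleftrightarrow> x = y"
  using relpowp_d[of x y] d_refl by auto

lemma relpowp_sym: "(adj ^^ n) x y \<Longrightarrow> (adj ^^ n) y x"
proof (induction n arbitrary: y)
  case (Suc n)
  then obtain z where "(adj ^^ n) x z" "adj z y" by auto
  then show ?case using Suc.IH adj_sym relpowp_Suc_I2 by metis
qed simp

lemma d_sym: "d x y = d y x"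
  by (meson antisym d_le relpowp_d relpowp_sym)

lemma d_triangle: "d x z \<le> d x y + d y z"
  using d_le relpowp_trans[OF relpowp_d[of x y] relpowp_d[of y z]] by blast

lemma d_adj: "adj x y \<Longrightarrow> d x y = 1"
  using d_le[of 1 x y] d_eq_0[of x y] adj_irrefl by (auto simp: le_Suc_eq)

lemma d_adj_le: "adj x y \<Longrightarrow> d o' y \<le> Suc (d o' x)"
  using d_triangle[of o' y x] d_adj by fastforce

lemma closer_neighbour:
  assumes "d o' x = Suc n" obtains y where "adj y x" "d o' y = n"
proof -
  obtain y where y: "(adj ^^ n) o' y" "adj y x"
    using relpowp_d[of o' x] assms by auto
  then have "d o' y = n" using d_le[OF y(1)] d_adj_le[OF y(2), of o'] assms by simp
  with y that show thesis by blast
qed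

text \<open>Follow the geodesics from \<open>y\<close> and \<open>z\<close> to \<open>o'\<close> until they meet.\<close>

lemma sphere_path:
  assumes "d o' y = n" "d o' z = n" "y \<noteq> z"
  shows "\<exists>xs. 3 \<le> length xs \<and> distinct xs \<and> successively adj xs \<and> hd xs = y \<and> last xs = z
              \<and> (\<forall>x\<in>set xs. d o' x \<le> n)"
  using assms
proof (induction n arbitrary: y z)
  case 0
  then show ?case using d_eq_0 by metis
next
  case (Suc n)
  obtain y' where y': "adj y' y" "d o' y' = n" using closer_neighbour Suc.prems(1) by metis
  obtain z' where z': "adj z' z" "d o' z' = n" using closer_neighbour Suc.prems(2) by metis
  show ?case
  proof (cases "y' = z'")
    case True
    have "y \<noteq> y'" using Suc.prems(1) y'(2) n_not_Suc_n by metis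
    moreover have "y' \<noteq> z" using Suc.prems(2) y'(2) n_not_Suc_n by metis
    moreover have "adj y y'" "adj y' z" using y'(1) z'(1) True adj_sym by simp_all
    ultimately have "distinct [y, y', z] \<and> successively adj [y, y', z]
        \<and> (\<forall>x\<in>set [y, y', z]. d o' x \<le> Suc n)" using Suc.prems y'(2) by simp
    then show ?thesis by (intro exI[of _ "[y, y', z]"]) simp
  next
    case False
    then obtain xs where xs: "3 \<le> length xs" "distinct xs" "successively adj xs" "hd xs = y'"
      "last xs = z'" "\<forall>x\<in>set xs. d o' x \<le> n" using Suc.IH[OF y'(2) z'(2)] by blast
    have "y \<notin> set xs" "z \<notin> set xs" using xs(6) Suc.prems(1,2) Suc_n_not_le_n by metis+
    moreover have "xs \<noteq> []" using xs(1) by auto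
    moreover have "successively adj (y # xs @ [z])"
      using xs(3-5) adj_sym[OF y'(1)] z'(1) \<open>xs \<noteq> []\<close>
      by (simp add: successively_append_iff successively_Cons)
    moreover have "\<forall>x\<in>set (y # xs @ [z]). d o' x \<le> Suc n"
      using xs(6) Suc.prems(1,2) by (simp add: le_SucI)
    ultimately show ?thesis using xs(1,2) Suc.prems(3)
      by (intro exI[of _ "y # xs @ [z]"]) simp
  qed
qed

text \<open>A tree is bipartite: neighbours on one sphere would close the path of
  \<open>sphere_path\<close> to a cycle.\<close>

lemma adj_d_neq: "adj x y \<Longrightarrow> d o' x \<noteq> d o' y"
proof
  assume a: "adj x y" "d o' x = d o' y"
  then have "y \<noteq> x" using adj_irrefl by auto
  from sphere_path[OF refl a(2) this] obtain xs where
    "3 \<le> length xs" "distinct xs" "successively adj xs" "hd xs = y" "last xs = x" by metis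
  then show False using no_cycle a(1) by blast
qed

text \<open>Two such neighbours are joined by a path inside a ball that does not reach
  \<open>x\<close>; adding \<open>x\<close> would close a cycle.\<close>

lemma closer_neighbour_unique:
  assumes "adj x y" "adj x z" "Suc (d o' y) = d o' x" "Suc (d o' z) = d o' x"
  shows "y = z"
proof (rule ccontr)
  assume "y \<noteq> z"
  then obtain xs where xs: "3 \<le> length xs" "distinct xs" "successively adj xs" "hd xs = y"
      "last xs = z" "\<forall>v\<in>set xs. d o' v \<le> d o' y"
    using sphere_path[OF refl _ \<open>y \<noteq> z\<close>, of o'] assms(3,4) by (metis Suc_inject)
  have "x \<notin> set xs" using xs(6) assms by auto
  moreover have "successively adj (x # xs)" using xs assms by (cases xs) auto
  ultimately have "\<not> adj (last (x # xs)) (hd (x # xs))" using xs by (intro no_cycle) auto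
  moreover have "xs \<noteq> []" using xs(1) by auto
  ultimately show False using assms adj_sym xs by auto
qed

end

section \<open>Levels, parents and ancestors\<close>

locale rooted_tree = tree_graph adj for adj :: "'v \<Rightarrow> 'v \<Rightarrow> bool" +
  fixes \<omega> :: "nat \<Rightarrow> 'v"
  assumes ray: "geodesic_ray adj \<omega>"
begin

abbreviation lev where "lev \<equiv> level adj \<omega>"

lemma d_ray: "i \<le> j \<Longrightarrow> d (\<omega> i) (\<omega> j) = j - i"
  using ray unfolding geodesic_ray_def by blast

lemma adj_ray: "adj (\<omega> i) (\<omega> (Suc i))"
  using relpowp_d[of "\<omega> i" "\<omega> (Suc i)"] d_ray[of i "Suc i"] relpowp_Suc_0[of adj]
  by (simp del: relpowp.simps)

text \<open>The distances from \<open>x\<close> to the vertices of the ray change by one at each step and have no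
  strict local maximum, so they increase from their minimum on.\<close>

lemma level_eventually:
  "\<exists>k. \<forall>N\<ge>k. lev x = int N - int (d x (\<omega> N))"
proof -
  obtain k where k: "ray_proj adj \<omega> x = \<omega> k" "\<And>i. d x (\<omega> k) \<le> d x (\<omega> i)"
  proof -
    have "ray_proj adj \<omega> x \<in> range \<omega>"
      unfolding ray_proj_def arg_min_on_def
      using arg_min_natI[of "\<lambda>y. y \<in> range \<omega>" "\<omega> 0" "d x"] by simp
    moreover have "d x (ray_proj adj \<omega> x) \<le> d x (\<omega> i)" for i
      unfolding ray_proj_def arg_min_on_def
      using arg_min_nat_le[of "\<lambda>y. y \<in> range \<omega>" "\<omega> i" "d x"] by simp
    ultimately show thesis using that by (metis imageE)
  qed
  have mono: "d x (\<omega> (Suc (k + n))) = Suc (d x (\<omega> (k + n)))" for n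
  proof (induction n)
    case 0
    show ?case using adj_d_neq[OF adj_ray, of x k] d_adj_le[OF adj_ray, of x k] k(2)[of "Suc k"]
      by simp
  next
    case (Suc n)
    let ?i = "k + n"
    show ?case
    proof (rule ccontr)
      assume *: "\<not> ?thesis"
      have "Suc (d x (\<omega> (Suc (Suc ?i)))) = d x (\<omega> (Suc ?i))"
        using * adj_d_neq[OF adj_ray, of x "Suc ?i"] d_adj_le[OF adj_ray, of x "Suc ?i"]
          d_adj_le[OF adj_sym[OF adj_ray], of x "Suc ?i"] by simp
      with Suc have "\<omega> (Suc (Suc ?i)) = \<omega> ?i"
        by (intro closer_neighbour_unique[where o' = x, OF adj_ray adj_sym[OF adj_ray]]) auto
      then show False using d_ray[of ?i "Suc (Suc ?i)"] d_refl by simp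
    qed
  qed
  have "d x (\<omega> (k + n)) = d x (\<omega> k) + n" for n
    by (induction n) (use mono in auto)
  moreover have "lev x = int k - int (d x (\<omega> k))"
    unfolding level_def k(1) using d_ray[of 0 k] d_sym by simp
  ultimately have "\<forall>N\<ge>k. lev x = int N - int (d x (\<omega> N))"
    by (auto simp: le_iff_add)
  then show ?thesis by blast
qed

text \<open>The level is a Busemann function. Seen from one far point of the ray it is minus a
  distance up to a constant, so facts about distances from a single vertex carry over to
  levels.\<close>

lemma level_eventually3:
  "\<exists>k. \<forall>N\<ge>k. lev x = int N - int (d (\<omega> N) x) \<and> lev y = int N - int (d (\<omega> N) y)
     \<and> lev z = int N - int (d (\<omega> N) z)"
proof -
  obtain a b c where "\<forall>N\<ge>a. lev x = int N - int (d x (\<omega> N))"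
    "\<forall>N\<ge>b. lev y = int N - int (d y (\<omega> N))" "\<forall>N\<ge>c. lev z = int N - int (d z (\<omega> N))"
    using level_eventually by metis
  then show ?thesis by (intro exI[of _ "max a (max b c)"]) (auto simp: d_sym)
qed

lemma level_adj: "adj x y \<Longrightarrow> lev y = lev x + 1 \<or> lev x = lev y + 1"
proof -
  assume a: "adj x y"
  obtain k where "\<forall>N\<ge>k. lev x = int N - int (d (\<omega> N) x) \<and> lev y = int N - int (d (\<omega> N) y)"
    using level_eventually3[of x y y] by blast
  then have "lev x = int k - int (d (\<omega> k) x)" "lev y = int k - int (d (\<omega> k) y)" by auto
  moreover have "d (\<omega> k) x \<noteq> d (\<omega> k) y" "d (\<omega> k) y \<le> Suc (d (\<omega> k) x)" "d (\<omega> k) x \<le> Suc (d (\<omega> k) y)"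
    using adj_d_neq[OF a] d_adj_le[OF a] d_adj_le[OF adj_sym[OF a]] by blast+
  ultimately show ?thesis by arith
qed

lemma father_unique:
  assumes "adj x y" "adj x z" "lev y = lev x + 1" "lev z = lev x + 1" shows "y = z"
proof -
  obtain k where "\<forall>N\<ge>k. lev x = int N - int (d (\<omega> N) x) \<and> lev y = int N - int (d (\<omega> N) y)
      \<and> lev z = int N - int (d (\<omega> N) z)"
    using level_eventually3[of x y z] by blast
  then have "lev x = int k - int (d (\<omega> k) x) \<and> lev y = int k - int (d (\<omega> k) y)
      \<and> lev z = int k - int (d (\<omega> k) z)" by auto
  then show ?thesis using assms by (intro closer_neighbour_unique[where o' = "\<omega> k"]) auto
qed

lemma father_exists: "\<exists>y. adj x y \<and> lev y = lev x + 1"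
proof -
  obtain k where k: "\<And>N. N \<ge> k \<Longrightarrow> lev x = int N - int (d (\<omega> N) x)"
    using level_eventually3[of x x x] by blast
  define n where "n = d (\<omega> k) x"
  \<comment> \<open>Moving to \<open>Suc k\<close> makes the distance positive even when
    \<open>x\<close> is on the ray, so a neighbour nearer to the ray point exists.\<close>
  have "d (\<omega> (Suc k)) x = Suc n" using k[of k] k[of "Suc k"] by (simp add: n_def)
  then obtain y where y: "adj y x" "d (\<omega> (Suc k)) y = n" using closer_neighbour by metis
  obtain l where l: "\<And>N. N \<ge> l \<Longrightarrow> lev y = int N - int (d (\<omega> N) y)"
    using level_eventually3[of y y y] by blast
  define N where "N = max l (Suc k)"
  \<comment> \<open>The level of \<open>y\<close> can only be read off at a later point of the ray.
    The triangle inequality gives a lower bound for it, and adjacency to \<open>x\<close> leaves no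
    other value than \<open>lev x + 1\<close>.\<close>
  have "d (\<omega> N) y \<le> d (\<omega> (Suc k)) y + (N - Suc k)"
    using d_triangle[of "\<omega> N" y "\<omega> (Suc k)"] d_ray[of "Suc k" N] d_sym[of "\<omega> N"]
    by (simp add: N_def)
  then have "lev y \<ge> lev x + 1" using l[of N] k[of "Suc k"] \<open>d (\<omega> (Suc k)) x = Suc n\<close> y(2)
    by (simp add: N_def)
  then show ?thesis using level_adj[OF y(1)] adj_sym[OF y(1)] by (intro exI[of _ y]) auto
qed

definition par where "par x = (THE y. adj x y \<and> lev y = lev x + 1)"

lemma par: "adj x (par x)" "lev (par x) = lev x + 1"
proof -
  have "\<exists>!y. adj x y \<and> lev y = lev x + 1" using father_exists father_unique by blast
  from theI'[OF this] show "adj x (par x)" "lev (par x) = lev x + 1"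
    unfolding par_def by auto
qed

lemma adj_iff: "adj x y \<longleftrightarrow> y = par x \<or> x = par y"
  using par adj_sym level_adj father_unique by metis

lemma sons_eq: "sons adj \<omega> x = {y. par y = x}"
  using par adj_iff unfolding sons_def by (auto simp: adj_sym)

lemma lev_funpow: "lev ((par ^^ n) x) = lev x + int n"
  by (induction n) (auto simp: par)

lemma relpowp_funpow: "(adj ^^ n) x ((par ^^ n) x)"
  by (induction n) (auto intro: relcomppI par)

lemma relpowp_level_le: "(adj ^^ n) x y \<Longrightarrow> lev y \<le> lev x + int n"
proof (induction n arbitrary: y)
  case (Suc n)
  then obtain z where "(adj ^^ n) x z" "adj z y" by auto
  then show ?case using Suc.IH[of z] level_adj[of z y] by auto
qed simp

text \<open>A walk that gains as many levels as it has steps must go to the unique upper neighbour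
  each time. This turns the metric definition of the order into iterated parents.\<close>

lemma relpowp_level_eq: "(adj ^^ n) x y \<Longrightarrow> lev y = lev x + int n \<Longrightarrow> y = (par ^^ n) x"
proof (induction n arbitrary: y)
  case (Suc n)
  then obtain z where z: "(adj ^^ n) x z" "adj z y" by auto
  then have "lev z = lev x + int n" "lev y = lev z + 1"
    using relpowp_level_le[OF z(1)] level_adj[OF z(2)] Suc.prems by auto
  then have "z = (par ^^ n) x" "y = par z" using Suc.IH z father_unique par by blast+
  then show ?case by simp
qed simp

lemma below_iff: "below adj \<omega> y x \<longleftrightarrow> (\<exists>n. (par ^^ n) y = x)"
proof
  assume "below adj \<omega> y x"
  then have "lev x = lev y + int (d y x)" unfolding below_def using d_sym by simp
  then show "\<exists>n. (par ^^ n) y = x" using relpowp_level_eq[OF relpowp_d] by metis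
next
  assume "\<exists>n. (par ^^ n) y = x"
  then obtain n where n: "(par ^^ n) y = x" by blast
  have "d y x \<le> n" using relpowp_funpow[of n y] n d_le by blast
  moreover have "int n \<le> int (d y x)"
    using relpowp_level_le[OF relpowp_d[of y x]] lev_funpow[of n y] n by simp
  ultimately show "below adj \<omega> y x" unfolding below_def using lev_funpow[of n y] n d_sym by simp
qed

lemma ancestors_meet: "\<exists>i j. (par ^^ i) x = (par ^^ j) y"
  using connected[of x y]
proof induction
  case base then show ?case by blast
next
  case (step y z)
  then obtain i j where ij: "(par ^^ i) x = (par ^^ j) y" by blast
  from step(2) consider "z = par y" | "y = par z" using adj_iff by blast
  then show ?case
  proof cases
    case 1
    have "(par ^^ Suc i) x = (par ^^ j) z" using ij 1 by (simp add: funpow_swap1)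
    then show ?thesis by blast
  next
    case 2
    have "(par ^^ i) x = (par ^^ Suc j) z" using ij 2 by (simp add: funpow_swap1)
    then show ?thesis by blast
  qed
qed

lemma trapezoid_eq:
  "trapezoid adj \<omega> (int h) (int k) x0 = {x. \<exists>n. h \<le> n \<and> n < k \<and> (par ^^ n) x = x0}"
  unfolding trapezoid_def below_iff using lev_funpow by fastforce

end

section \<open>Laminar refinements of trapezoids\<close>

text \<open>A substitute for a dyadic grid between \<open>R\<close> and its points. The last clause
  does not require the comparable larger set to be the smallest one: the stopping argument only
  needs some larger set that did not stop.\<close>

definition laminar_refinement ::
  "real \<Rightarrow> ('v \<Rightarrow> real) \<Rightarrow> 'v set set \<Rightarrow> 'v set \<Rightarrow> 'v set set \<Rightarrow> bool" where
  "laminar_refinement A m cells R \<D> \<longleftrightarrow>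
     finite \<D> \<and> \<D> \<subseteq> cells \<and> R \<in> \<D> \<and> (\<forall>Q\<in>\<D>. Q \<subseteq> R) \<and> (\<forall>x\<in>R. {x} \<in> \<D>) \<and>
     (\<forall>P\<in>\<D>. \<forall>Q\<in>\<D>. P \<inter> Q = {} \<or> P \<subseteq> Q \<or> Q \<subseteq> P) \<and>
     (\<forall>Q\<in>\<D>. Q \<noteq> R \<longrightarrow> (\<exists>P\<in>\<D>. Q \<subset> P \<and> sum m P \<le> A * sum m Q))"

lemma laminar_refinementD:
  assumes "laminar_refinement A m cells R \<D>"
  shows "finite \<D>" "\<D> \<subseteq> cells" "R \<in> \<D>" "Q \<in> \<D> \<Longrightarrow> Q \<subseteq> R" "x \<in> R \<Longrightarrow> {x} \<in> \<D>"
    "P \<in> \<D> \<Longrightarrow> Q \<in> \<D> \<Longrightarrow> P \<inter> Q = {} \<or> P \<subseteq> Q \<or> Q \<subseteq> P"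
    "Q \<in> \<D> \<Longrightarrow> Q \<noteq> R \<Longrightarrow> \<exists>P\<in>\<D>. Q \<subset> P \<and> sum m P \<le> A * sum m Q"
  using assms unfolding laminar_refinement_def by simp_all

lemma laminar_refinement_singleton:
  "{x} \<in> cells \<Longrightarrow> laminar_refinement A m cells {x} {{x}}"
  unfolding laminar_refinement_def by auto

text \<open>Refinements of disjoint parts are glued under \<open>R\<close>. Sets from different
  parts are disjoint, and the larger set that a whole part still lacks is \<open>R\<close> itself,
  at the price \<open>ratio\<close>.\<close>

lemma laminar_refinement_partition:
  assumes R: "R \<in> cells" "R = \<Union>\<P>" and fin: "finite \<P>" and disj: "disjoint \<P>"
    and parts: "\<And>P. P \<in> \<P> \<Longrightarrow> \<exists>\<D>. laminar_refinement A m cells P \<D>"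
    and ratio: "\<And>P. P \<in> \<P> \<Longrightarrow> sum m R \<le> A * sum m P"
  shows "\<exists>\<D>. laminar_refinement A m cells R \<D>"
proof -
  obtain \<D> where D: "\<And>P. P \<in> \<P> \<Longrightarrow> laminar_refinement A m cells P (\<D> P)"
    using parts by metis
  let ?D = "insert R (\<Union>P\<in>\<P>. \<D> P)"
  have sub: "Q \<subseteq> P" if "P \<in> \<P>" "Q \<in> \<D> P" for P Q
    using laminar_refinementD(4)[OF D[OF that(1)] that(2)] .
  have subR: "Q \<subseteq> R" if "Q \<in> ?D" for Q using sub that R(2) by auto
  have "X \<inter> Y = {} \<or> X \<subseteq> Y \<or> Y \<subseteq> X" if "P \<in> \<P>" "P' \<in> \<P>" "X \<in> \<D> P" "Y \<in> \<D> P'" for P P' X Y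
  proof (cases "P = P'")
    case True
    then show ?thesis using laminar_refinementD(6)[OF D[OF that(1)]] that by simp
  next
    case False
    then have "P \<inter> P' = {}" using disj that by (auto simp: disjoint_def)
    then show ?thesis using sub[OF that(1,3)] sub[OF that(2,4)] by blast
  qed
  then have lam: "P \<inter> Q = {} \<or> P \<subseteq> Q \<or> Q \<subseteq> P" if "P \<in> ?D" "Q \<in> ?D" for P Q
    using that subR[OF that(1)] subR[OF that(2)] by (elim insertE UN_E) simp_all
  have up: "\<exists>S\<in>?D. Q \<subset> S \<and> sum m S \<le> A * sum m Q" if Q: "Q \<in> ?D" "Q \<noteq> R" for Q
  proof -
    obtain P where P: "P \<in> \<P>" "Q \<in> \<D> P" using Q by auto
    show ?thesis
    proof (cases "Q = P")
      case True
      then have "Q \<subset> R" using subR[OF Q(1)] Q(2) by simp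
      then show ?thesis using ratio[OF P(1)] True by blast
    next
      case False
      then show ?thesis using laminar_refinementD(7)[OF D[OF P(1)] P(2)] P(1) by blast
    qed
  qed
  have "{x} \<in> ?D" if "x \<in> R" for x
    using that R(2) laminar_refinementD(5)[OF D] by auto
  moreover have "finite ?D" using fin laminar_refinementD(1)[OF D] by simp
  moreover have "?D \<subseteq> cells" using R(1) laminar_refinementD(2)[OF D] by auto
  ultimately have "laminar_refinement A m cells R ?D"
    unfolding laminar_refinement_def using lam up subR
    by (intro conjI ballI impI) (assumption | blast)+
  then show ?thesis by blast
qed

text \<open>What remains of the graph: the parent map, the level as a grading, and conservation of
  mass. \<open>D\<close> controls the loss of mass from a parent to a single son.\<close>

locale flow_tree =
  fixes par :: "'v \<Rightarrow> 'v" and lev :: "'v \<Rightarrow> int" and m :: "'v \<Rightarrow> real" and D :: real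
  assumes lev_par: "lev (par x) = lev x + 1"
    and m_pos: "0 < m x"
    and finite_sons: "finite {y. par y = x}"
    and sum_sons: "(\<Sum>y | par y = x. m y) = m x"
    and m_par_le: "m (par x) \<le> D * m x"
    and ancestors_meet: "\<exists>i j. (par ^^ i) x = (par ^^ j) y"
begin

lemma lev_funpow: "lev ((par ^^ n) x) = lev x + int n"
  by (induction n) (auto simp: lev_par)

lemma m_le_par: "m x \<le> m (par x)"
proof -
  have "m x \<le> (\<Sum>y | par y = par x. m y)"
    by (rule member_le_sum) (auto simp: finite_sons less_imp_le[OF m_pos])
  then show ?thesis by (simp add: sum_sons)
qed

lemma D_ge_1: "1 \<le> D"
proof -
  fix x
  have "1 * m x \<le> D * m x" using m_le_par[of x] m_par_le[of x] by simp
  then show ?thesis using m_pos[of x] by (simp only: mult_le_cancel_right)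
qed

definition gen where "gen n x0 = {x. (par ^^ n) x = x0}"

lemma gen_0: "gen 0 x0 = {x0}"
  by (simp add: gen_def)

lemma gen_Suc: "gen (Suc n) x0 = (\<Union>y\<in>{y. par y = x0}. gen n y)"
  by (auto simp: gen_def)

lemma finite_gen: "finite (gen n x0)"
  by (induction n arbitrary: x0) (simp_all add: gen_0 gen_Suc finite_sons)

lemma sum_gen: "sum m (gen n x0) = m x0"
proof (induction n arbitrary: x0)
  case (Suc n)
  have "sum m (gen (Suc n) x0) = (\<Sum>y | par y = x0. sum m (gen n y))"
    unfolding gen_Suc
    by (rule sum.UNION_disjoint) (simp_all add: finite_sons finite_gen, auto simp: gen_def)
  then show ?case by (simp add: Suc sum_sons)
qed (simp add: gen_0)

lemma disjoint_gen:
  assumes "i \<noteq> j" shows "gen i x \<inter> gen j x = {}"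
proof -
  have "i = j" if "(par ^^ i) y = x" "(par ^^ j) y = x" for y
    using lev_funpow[of i y] lev_funpow[of j y] that by simp
  then show ?thesis using assms unfolding gen_def by blast
qed

definition trap where "trap h k x0 = {x. \<exists>n. h \<le> n \<and> n < k \<and> (par ^^ n) x = x0}"

lemma trap_eq: "trap h k x0 = (\<Union>n\<in>{h..<k}. gen n x0)"
  by (auto simp: trap_def gen_def)

lemma finite_trap: "finite (trap h k x0)"
  by (auto simp: trap_eq finite_gen)

text \<open>By conservation each generation below \<open>x0\<close> carries the whole mass of
  \<open>x0\<close>. Hence trapezoids with a common vertex compare like their heights.\<close>

lemma sum_trap: "sum m (trap h k x0) = real (k - h) * m x0"
proof -
  have "sum m (trap h k x0) = (\<Sum>n\<in>{h..<k}. sum m (gen n x0))"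
    unfolding trap_eq by (rule sum.UNION_disjoint) (auto simp: finite_gen disjoint_gen)
  then show ?thesis by (simp add: sum_gen)
qed

lemma trap_nonempty: "h < k \<Longrightarrow> trap h k x0 \<noteq> {}"
  using sum_trap[of h k x0] m_pos[of x0] by auto

lemma trap_vertical: "h \<le> l \<Longrightarrow> l \<le> k \<Longrightarrow> trap h k x0 = trap h l x0 \<union> trap l k x0"
proof -
  assume "h \<le> l" "l \<le> k"
  then have "{h..<k} = {h..<l} \<union> {l..<k}" by auto
  then show "trap h k x0 = trap h l x0 \<union> trap l k x0" unfolding trap_eq by simp
qed

lemma trap_vertical_disjoint: "trap h l x0 \<inter> trap l k x0 = {}"
proof -
  have "gen i x0 \<inter> gen j x0 = {}" if "i \<in> {h..<l}" "j \<in> {l..<k}" for i j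
    using that by (intro disjoint_gen) auto
  then show ?thesis unfolding trap_eq by blast
qed

lemma trap_horizontal: "trap (Suc h) (Suc k) x0 = (\<Union>y\<in>{y. par y = x0}. trap h k y)"
proof -
  have "trap (Suc h) (Suc k) x0 = (\<Union>n\<in>{h..<k}. gen (Suc n) x0)"
    unfolding trap_eq image_Suc_atLeastLessThan[symmetric] image_image ..
  then show ?thesis unfolding gen_Suc trap_eq by auto
qed

text \<open>Brothers have equal level, so a common descendant would reach both after the same number
  of steps.\<close>

lemma trap_horizontal_disjoint:
  assumes "y \<noteq> z" "par y = par z" shows "trap h k y \<inter> trap h k z = {}"
proof (rule ccontr)
  assume "trap h k y \<inter> trap h k z \<noteq> {}"
  then obtain x i j where x: "(par ^^ i) x = y" "(par ^^ j) x = z" by (auto simp: trap_def)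
  then have "lev y = lev x + int i" "lev z = lev x + int j" using lev_funpow by blast+
  moreover have "lev y = lev z" using lev_par assms(2) by (metis add_right_cancel)
  ultimately have "i = j" by simp
  then show False using x assms(1) by simp
qed

text \<open>The admissible sets with natural heights and the ratio conditions multiplied out;
  \<open>h < k\<close> follows from \<open>1 \<le> h\<close> and
  \<open>2 * h \<le> k\<close>.\<close>

definition cells where
  "cells \<beta> = {{x0} |x0. True} \<union>
     {trap h k x0 |h k x0. 1 \<le> h \<and> 2 * h \<le> k \<and> real k \<le> \<beta> * real h}"

lemma cells_finite: "R \<in> cells \<beta> \<Longrightarrow> finite R \<and> R \<noteq> {}"
  unfolding cells_def using finite_trap trap_nonempty by fastforce

lemma m_funpow_le: "m ((par ^^ n) x) \<le> D ^ n * m x"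
proof (induction n)
  case (Suc n)
  have "m ((par ^^ Suc n) x) \<le> D * m ((par ^^ n) x)" using m_par_le by simp
  also have "\<dots> \<le> D * (D ^ n * m x)" using Suc D_ge_1 by (intro mult_left_mono) auto
  finally show ?case by (simp add: ac_simps)
qed simp

text \<open>The measure \<open>2 * k - h\<close> drops under both cuts: to \<open>(h, 2h)\<close>
  and \<open>(2h, k)\<close> vertically, to \<open>(h - 1, k - 1)\<close> horizontally. The constant
  collects the losses: at most \<open>\<beta>\<close> or 2 for the vertical cut, \<open>D\<close>
  for the horizontal one, \<open>2 * D ^ 2\<close> for the last step to singletons.\<close>

lemma trap_laminar_refinement:
  assumes "12 \<le> \<beta>" "1 \<le> h" "2 * h \<le> k" "real k \<le> \<beta> * real h"
  shows "\<exists>\<D>. laminar_refinement (\<beta> + 2 * D ^ 2) m (cells \<beta>) (trap h k x0) \<D>"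
  using assms(2-4)
proof (induction "2 * k - h" arbitrary: h k x0 rule: less_induct)
  case less
  let ?A = "\<beta> + 2 * D ^ 2"
  have A: "\<beta> \<le> ?A" "2 * D ^ 2 \<le> ?A" "D \<le> ?A"
    using assms(1) D_ge_1 self_le_power[of D 2] by (auto intro: add_increasing)
  have cell: "trap h k x0 \<in> cells \<beta>" using less.prems unfolding cells_def by blast
  consider "4 * h \<le> k" | "k < 4 * h" "2 \<le> h" | "k < 4" "h = 1" using less.prems(1) by linarith
  then show ?case
  proof cases
    case 1
    \<comment> \<open>From \<open>4 * h \<le> k\<close> on, the upper part of a cut at
      \<open>2 * h\<close> has ratio 2 and the lower part has ratio \<open>k / (2 * h)\<close>,
      which is at least 2 and at most \<open>\<beta>\<close>.\<close>
    have "real (2 * h) \<le> \<beta> * real h" using assms(1) by (auto intro!: mult_right_mono)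
    then have "\<exists>\<D>. laminar_refinement ?A m (cells \<beta>) (trap h (2 * h) x0) \<D>"
      using less.prems 1 by (intro less.hyps) auto
    moreover have "\<beta> * real h \<le> \<beta> * real (2 * h)" using assms(1) by (intro mult_left_mono) auto
    then have "\<exists>\<D>. laminar_refinement ?A m (cells \<beta>) (trap (2 * h) k x0) \<D>"
      using less.prems 1 by (intro less.hyps) auto
    moreover have "real (k - h) * m x0 \<le> ?A * (real h * m x0)"
    proof -
      have "real (k - h) \<le> \<beta> * real h" using less.prems by linarith
      also have "\<dots> \<le> ?A * real h" using A by (intro mult_right_mono) auto
      finally show ?thesis using m_pos[of x0] by simp
    qed
    moreover have "real (k - h) * m x0 \<le> ?A * (real (k - 2 * h) * m x0)"
    proof -
      have "real (k - h) \<le> 2 * real (k - 2 * h)" using 1 less.prems by linarith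
      also have "\<dots> \<le> ?A * real (k - 2 * h)" using A(1) assms(1) by (intro mult_right_mono) linarith+
      finally show ?thesis using m_pos[of x0] by simp
    qed
    moreover have "trap h k x0 = \<Union> {trap h (2 * h) x0, trap (2 * h) k x0}"
      using trap_vertical[of h "2 * h" k x0] less.prems by simp
    moreover have "disjoint {trap h (2 * h) x0, trap (2 * h) k x0}"
      using trap_vertical_disjoint[of h "2 * h" x0 k] unfolding disjoint_def by blast
    moreover have "sum m (trap h k x0) \<le> ?A * sum m P"
      if "P \<in> {trap h (2 * h) x0, trap (2 * h) k x0}" for P
      using that calculation(3,4) unfolding sum_trap by (auto simp: sum_trap)
    ultimately show ?thesis
      by (intro laminar_refinement_partition[OF cell,
            where \<P> = "{trap h (2 * h) x0, trap (2 * h) k x0}"])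
         (assumption | blast)+
  next
    case 2
    define h' k' where "h' = h - 1" and "k' = k - 1"
    have hk: "h = Suc h'" "k = Suc k'" using 2 less.prems by (auto simp: h'_def k'_def)
    \<comment> \<open>Lowering both heights by one increases the ratio. Since
      \<open>k < 4 * h\<close> and \<open>h \<ge> 2\<close>, it remains below the admissible
      bound.\<close>
    have "real k' \<le> 12 * real h'" using 2 hk by linarith
    also have "\<dots> \<le> \<beta> * real h'" using assms(1) by (intro mult_right_mono) auto
    finally have IH: "\<exists>\<D>. laminar_refinement ?A m (cells \<beta>) (trap h' k' y) \<D>" for y
      using less.prems 2 hk by (intro less.hyps) auto
    have "real (k' - h') * m x0 \<le> ?A * (real (k' - h') * m y)" if "par y = x0" for y
    proof -
      have "m x0 \<le> D * m y" using m_par_le[of y] that by simp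
      also have "\<dots> \<le> ?A * m y" using A m_pos[of y] by (intro mult_right_mono) auto
      finally have "real (k' - h') * m x0 \<le> real (k' - h') * (?A * m y)" by (intro mult_left_mono) auto
      then show ?thesis by (simp add: ac_simps)
    qed
    then have "sum m (trap h k x0) \<le> ?A * sum m (trap h' k' y)" if "par y = x0" for y
      unfolding sum_trap using that by (simp add: hk)
    moreover have "disjoint (trap h' k' ` {y. par y = x0})"
    proof -
      have "trap h' k' y \<inter> trap h' k' z = {}"
        if "trap h' k' y \<noteq> trap h' k' z" "par y = x0" "par z = x0" for y z
        using trap_horizontal_disjoint[of y z h' k'] that by force
      then show ?thesis unfolding disjoint_def by force
    qed
    moreover have "trap h k x0 = \<Union> (trap h' k' ` {y. par y = x0})"
      unfolding hk by (rule trap_horizontal)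
    ultimately show ?thesis using IH finite_sons
      by (intro laminar_refinement_partition[OF cell, where \<P> = "trap h' k' ` {y. par y = x0}"])
         (assumption | blast)+
  next
    case 3
    have "\<exists>\<D>. laminar_refinement ?A m (cells \<beta>) {x} \<D>" for x
      using laminar_refinement_singleton[of x "cells \<beta>"] unfolding cells_def by blast
    moreover have "real (k - 1) * m x0 \<le> ?A * m x" if x: "x \<in> trap 1 k x0" for x
    proof -
      obtain n where n: "n < k" "(par ^^ n) x = x0" using x unfolding trap_def by blast
      \<comment> \<open>Here \<open>k\<close> is 2 or 3: there are at most two generations, of depth
        at most 2. Hence the factor \<open>2 * D ^ 2\<close> when the trapezoid is broken into
        points.\<close>
      have "m x0 \<le> D ^ n * m x" using m_funpow_le[of n x] n by simp
      also have "\<dots> \<le> D ^ 2 * m x"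
        using n 3 D_ge_1 m_pos[of x] by (intro mult_right_mono power_increasing) auto
      finally have *: "m x0 \<le> D ^ 2 * m x" .
      have "real (k - 1) * m x0 \<le> 2 * (D ^ 2 * m x)"
        using 3 * m_pos[of x0] by (intro mult_mono) auto
      also have "\<dots> = (2 * D ^ 2) * m x" by simp
      also have "\<dots> \<le> ?A * m x" using A m_pos[of x] by (intro mult_right_mono) auto
      finally show ?thesis .
    qed
    ultimately show ?thesis using 3 finite_trap
      by (intro laminar_refinement_partition[OF cell, where \<P> = "(\<lambda>x. {x}) ` trap h k x0"])
         (auto simp: sum_trap disjoint_def)
  qed
qed

lemma m_le_funpow: "m x \<le> m ((par ^^ n) x)"
  by (induction n) (auto intro: order_trans[OF _ m_le_par])

text \<open>Seen from a very high ancestor, all vertices of a finite set lie at nearly the same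
  depth, hence well inside one trapezoid. The mass can be made as large as desired because masses do
  not decrease upwards; \<open>Lp_density\<close> relies on that.\<close>

lemma exhaustion:
  assumes "12 \<le> \<beta>" "finite K"
  shows "\<exists>R\<in>cells \<beta>. K \<subseteq> R \<and> t \<le> sum m R
            \<and> (\<exists>\<D>. laminar_refinement (\<beta> + 2 * D ^ 2) m (cells \<beta>) R \<D>)"
proof -
  fix o' :: 'v
  obtain i j where ij: "\<And>x. (par ^^ (i x)) x = (par ^^ (j x)) o'"
    using ancestors_meet[of _ o'] by metis
  define N where "N = Suc (\<Sum>x\<in>K. i x + j x)"
  have N: "i x + j x < N" if "x \<in> K" for x
    using member_le_sum[of x K "\<lambda>x. i x + j x"] that assms(2) by (simp add: N_def)
  define M where "M = N + nat \<lceil>t / m o'\<rceil>"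
  \<comment> \<open>A vertex \<open>x\<close> of \<open>K\<close> lies at depth
    \<open>3 * M - j x + i x\<close> below the vertex of \<open>R\<close>. As
    \<open>i x + j x < M\<close>, this is between \<open>2 * M\<close> and
    \<open>4 * M\<close>.\<close>
  define R where "R = trap (2 * M) (4 * M) ((par ^^ (3 * M)) o')"
  have M1: "1 \<le> M" by (simp add: M_def N_def)
  have R: "R \<in> cells \<beta>" "\<exists>\<D>. laminar_refinement (\<beta> + 2 * D ^ 2) m (cells \<beta>) R \<D>"
  proof -
    have "real (4 * M) \<le> \<beta> * real (2 * M)" using assms(1) M1 by simp
    then show "\<exists>\<D>. laminar_refinement (\<beta> + 2 * D ^ 2) m (cells \<beta>) R \<D>"
      unfolding R_def using M1 assms(1) by (intro trap_laminar_refinement) auto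
    then show "R \<in> cells \<beta>" unfolding laminar_refinement_def by auto
  qed
  moreover have "K \<subseteq> R"
  proof
    fix x assume x: "x \<in> K"
    have "(par ^^ (3 * M - j x + i x)) x = (par ^^ (3 * M - j x)) ((par ^^ j x) o')"
      by (simp add: funpow_add ij)
    also have "\<dots> = (par ^^ (3 * M - j x + j x)) o'" by (simp only: funpow_add comp_apply)
    also have "3 * M - j x + j x = 3 * M" using N[OF x] by (simp add: M_def)
    finally show "x \<in> R" unfolding R_def trap_def using N[OF x]
      by (intro CollectI exI[of _ "3 * M - j x + i x"]) (auto simp: M_def)
  qed
  moreover have "t \<le> sum m R"
  proof -
    have "t / m o' \<le> real M" unfolding M_def by linarith
    then have "t \<le> real M * m o'" using m_pos[of o'] by (simp add: divide_simps)
    also have "\<dots> \<le> real (4 * M - 2 * M) * m ((par ^^ (3 * M)) o')"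
      using m_le_funpow m_pos[of o'] by (intro mult_mono) auto
    finally show ?thesis unfolding R_def sum_trap .
  qed
  ultimately show ?thesis by blast
qed

end

section \<open>Lebesgue spaces on a weighted vertex set\<close>

locale vertex_weight =
  fixes m :: "'v \<Rightarrow> real"
  assumes m_pos: "0 < m x"
begin

lemma m_nonneg: "0 \<le> m x" and m_neq_0: "m x \<noteq> 0"
  using m_pos[of x] by auto

lemma measure_vmeas: "finite R \<Longrightarrow> measure (vmeas m) R = sum m R"
  unfolding vmeas_def measure_def
  by (subst emeasure_point_measure_finite2) (auto simp: m_nonneg sum_nonneg)

lemma integrable_vmeas:
  fixes f :: "'v \<Rightarrow> 'b::{banach, second_countable_topology}"
  shows "integrable (vmeas m) f \<longleftrightarrow> Infinite_Set_Sum.abs_summable_on (\<lambda>x. m x *\<^sub>R f x) UNIV"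
  unfolding vmeas_def point_measure_def Infinite_Set_Sum.abs_summable_on_def
  by (rule integrable_density) (simp_all add: m_nonneg)

lemma integral_vmeas:
  fixes f :: "'v \<Rightarrow> 'b::{banach, second_countable_topology}"
  shows "integral\<^sup>L (vmeas m) f = infsetsum (\<lambda>x. m x *\<^sub>R f x) UNIV"
  unfolding vmeas_def point_measure_def infsetsum_def
  by (rule integral_density) (simp_all add: m_nonneg)

lemma set_integral_vmeas:
  fixes f :: "'v \<Rightarrow> 'b::{banach, second_countable_topology}"
  assumes "finite R"
  shows "(LINT x:R|vmeas m. f x) = (\<Sum>x\<in>R. m x *\<^sub>R f x)"
proof -
  have "(LINT x:R|vmeas m. f x) = infsetsum (\<lambda>x. m x *\<^sub>R (indicator R x *\<^sub>R f x)) UNIV"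
    unfolding set_lebesgue_integral_def integral_vmeas ..
  also have "\<dots> = infsetsum (\<lambda>x. m x *\<^sub>R f x) R"
    by (rule infsetsum_cong_neutral) (auto simp: indicator_def)
  finally show ?thesis using assms by simp
qed

text \<open>Finite partial sums express membership and norm bound in one inequality, so that
  integrals can be left behind after \<open>Lp_iff\<close>. Note that \<open>B\<close> bounds the
  \<open>p\<close>-th power of the norm.\<close>

definition Lp_sums_le :: "real \<Rightarrow> ('v \<Rightarrow> complex) \<Rightarrow> real \<Rightarrow> bool" where
  "Lp_sums_le p f B \<longleftrightarrow> (\<forall>K. finite K \<longrightarrow> (\<Sum>x\<in>K. norm (f x) powr p * m x) \<le> B)"

lemma Lp_sums_leD: "Lp_sums_le p f B \<Longrightarrow> finite K \<Longrightarrow> (\<Sum>x\<in>K. norm (f x) powr p * m x) \<le> B"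
  by (simp add: Lp_sums_le_def)

lemma Lp_sums_le_mono: "Lp_sums_le p f B \<Longrightarrow> B \<le> B' \<Longrightarrow> Lp_sums_le p f B'"
  by (force simp: Lp_sums_le_def)

lemma Lp_I:
  assumes "Lp_sums_le p f (M powr p)" "0 < p" "0 \<le> M"
  shows "f \<in> car (Lp m p)" "nrm (Lp m p) f \<le> M"
proof -
  let ?g = "\<lambda>x. m x *\<^sub>R norm (f x) powr p"
  have sums: "sum ?g K \<le> M powr p" if "finite K" for K
    using Lp_sums_leD[OF assms(1) that] by (simp add: mult.commute)
  then have "Infinite_Sum.abs_summable_on ?g UNIV"
    unfolding abs_summable_iff_bdd_above by (auto simp: abs_mult m_nonneg bdd_above_def)
  have abs: "Infinite_Set_Sum.abs_summable_on ?g UNIV" using \<open>Infinite_Sum.abs_summable_on ?g UNIV\<close>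
      abs_summable_equivalent by blast
  then show "f \<in> car (Lp m p)" by (simp add: Lp_def integrable_vmeas)
  have "?g summable_on UNIV"
    using \<open>Infinite_Sum.abs_summable_on ?g UNIV\<close> by (rule abs_summable_summable)
  then have "infsum ?g UNIV \<le> M powr p" by (rule infsum_le_finite_sums) (rule sums)
  then have "infsetsum ?g UNIV \<le> M powr p" using infsetsum_infsum[OF abs] by simp
  moreover have "0 \<le> infsetsum ?g UNIV" by (rule infsetsum_nonneg) (simp add: m_nonneg)
  ultimately have "nrm (Lp m p) f \<le> (M powr p) powr (1 / p)"
    unfolding Lp_def integral_vmeas using assms(2) by (auto intro: powr_mono2)
  then show "nrm (Lp m p) f \<le> M" using assms(2,3) by (simp add: powr_powr)
qed

lemma Lp_D:
  assumes "f \<in> car (Lp m p)" "0 < p"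
  shows "Lp_sums_le p f (nrm (Lp m p) f powr p)"
  unfolding Lp_sums_le_def
proof (intro allI impI)
  fix K :: "'v set" assume K: "finite K"
  let ?g = "\<lambda>x. m x *\<^sub>R norm (f x) powr p"
  have abs: "Infinite_Set_Sum.abs_summable_on ?g UNIV"
    using assms(1) by (simp add: Lp_def integrable_vmeas)
  have "Infinite_Sum.abs_summable_on ?g UNIV"
    by (rule abs_summable_equivalent[THEN iffD2, OF abs])
  then have "?g summable_on UNIV" by (rule abs_summable_summable)
  then have "sum ?g K \<le> infsum ?g UNIV"
    by (rule finite_sum_le_infsum) (auto simp: K m_nonneg)
  also have "\<dots> = infsetsum ?g UNIV" using infsetsum_infsum[OF abs] by simp
  also have "\<dots> = nrm (Lp m p) f powr p"
    unfolding Lp_def integral_vmeas using assms(2)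
    by (simp add: powr_powr infsetsum_nonneg m_nonneg)
  finally show "(\<Sum>x\<in>K. norm (f x) powr p * m x) \<le> nrm (Lp m p) f powr p"
    by (simp add: mult.commute)
qed

lemma nrm_Lp_nonneg: "0 \<le> nrm (Lp m p) f"
  by (simp add: Lp_def)

lemma Lp_iff:
  "0 < p \<Longrightarrow> 0 \<le> M \<Longrightarrow> f \<in> car (Lp m p) \<and> nrm (Lp m p) f \<le> M \<longleftrightarrow> Lp_sums_le p f (M powr p)"
  using Lp_I Lp_D Lp_sums_le_mono[of p f _ "M powr p"] powr_mono2[of p "nrm (Lp m p) f" M]
    nrm_Lp_nonneg[of p f] by (metis less_imp_le)

lemma Lp_sums_le_finite_support:
  assumes "finite K" "\<And>x. x \<notin> K \<Longrightarrow> f x = 0" "(\<Sum>x\<in>K. norm (f x) powr p * m x) \<le> B" "0 < p"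
  shows "Lp_sums_le p f B"
  unfolding Lp_sums_le_def
proof (intro allI impI)
  fix L :: "'v set" assume L: "finite L"
  have "(\<Sum>x\<in>L. norm (f x) powr p * m x) = (\<Sum>x\<in>L \<inter> K. norm (f x) powr p * m x)"
    using L assms by (intro sum.mono_neutral_right) auto
  also have "\<dots> \<le> (\<Sum>x\<in>K. norm (f x) powr p * m x)"
    using assms(1) by (intro sum_mono2) (auto simp: m_nonneg)
  finally show "(\<Sum>x\<in>L. norm (f x) powr p * m x) \<le> B" using assms(3) by simp
qed

lemma Lp_sums_le_scale:
  "Lp_sums_le p f B \<Longrightarrow> 0 \<le> c \<Longrightarrow> (\<And>x. norm (g x) \<le> c * norm (f x)) \<Longrightarrow> 0 < p \<Longrightarrow>
    Lp_sums_le p g (c powr p * B)"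
  unfolding Lp_sums_le_def
proof (intro allI impI)
  fix K :: "'v set"
  assume a: "\<forall>K. finite K \<longrightarrow> (\<Sum>x\<in>K. norm (f x) powr p * m x) \<le> B" "0 \<le> c"
    "\<And>x. norm (g x) \<le> c * norm (f x)" "0 < p" "finite K"
  have "norm (g x) powr p \<le> c powr p * norm (f x) powr p" for x
    using powr_mono2[OF less_imp_le[OF a(4)] norm_ge_zero a(3)[of x]] a(2) by (simp add: powr_mult)
  then have "(\<Sum>x\<in>K. norm (g x) powr p * m x) \<le> (\<Sum>x\<in>K. c powr p * (norm (f x) powr p * m x))"
    by (intro sum_mono) (simp add: mult.assoc[symmetric] mult_right_mono m_nonneg)
  also have "\<dots> \<le> c powr p * B"
    using a(1,5) unfolding sum_distrib_left[symmetric] by (intro mult_left_mono) auto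
  finally show "(\<Sum>x\<in>K. norm (g x) powr p * m x) \<le> c powr p * B" .
qed

text \<open>Every vertex has positive mass, so point evaluations are bounded. This turns norm
  estimates into pointwise convergence of series.\<close>

lemma Lp_point_bound:
  assumes "0 < p" "0 \<le> M" "Lp_sums_le p f (M powr p)"
  shows "norm (f x) \<le> M * m x powr (- (1 / p))"
proof (rule ccontr)
  let ?y = "M * m x powr (- (1 / p))"
  assume "\<not> norm (f x) \<le> ?y"
  then have lt: "?y powr p < norm (f x) powr p" using assms by (intro powr_less_mono2) auto
  have "- (1 / p) * p = - 1" using assms(1) by simp
  then have "(m x powr (- (1 / p))) powr p = m x powr - 1" unfolding powr_powr by (simp only:)
  then have eq: "?y powr p = M powr p * inverse (m x)"
    using m_pos[of x] by (simp add: powr_mult powr_minus)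
  have "norm (f x) powr p * m x \<le> M powr p" using Lp_sums_leD[OF assms(3), of "{x}"] by simp
  moreover have "M powr p * inverse (m x) * m x < norm (f x) powr p * m x"
    using mult_strict_right_mono[OF lt m_pos[of x]] unfolding eq .
  moreover have "M powr p * inverse (m x) * m x = M powr p" using m_neq_0[of x] by (simp add: mult.assoc)
  ultimately show False by (metis not_le)
qed

lemma powr_add_le:
  fixes a b :: real assumes "0 \<le> a" "0 \<le> b" "0 < p"
  shows "(a + b) powr p \<le> 2 powr p * (a powr p + b powr p)"
proof -
  have "(a + b) powr p \<le> (2 * max a b) powr p" using assms by (intro powr_mono2) auto
  also have "\<dots> = 2 powr p * max a b powr p" using assms by (simp add: powr_mult)
  also have "\<dots> \<le> 2 powr p * (a powr p + b powr p)"
    by (intro mult_left_mono) (auto simp: max_def)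
  finally show ?thesis .
qed

text \<open>A crude constant takes the place of the Minkowski inequality; equivalence of norms
  tolerates it.\<close>

lemma Lp_sums_le_add:
  assumes "Lp_sums_le p f A" "Lp_sums_le p g B" "0 < p" "\<And>x. norm (h x) \<le> norm (f x) + norm (g x)"
  shows "Lp_sums_le p h (2 powr p * (A + B))"
  unfolding Lp_sums_le_def
proof (intro allI impI)
  fix K :: "'v set" assume K: "finite K"
  have "norm (h x) powr p \<le> 2 powr p * (norm (f x) powr p + norm (g x) powr p)" for x
    using powr_mono2[OF less_imp_le[OF assms(3)] norm_ge_zero assms(4)[of x]]
      powr_add_le[of "norm (f x)" "norm (g x)" p] assms(3) by simp
  then have "(\<Sum>x\<in>K. norm (h x) powr p * m x)
      \<le> (\<Sum>x\<in>K. 2 powr p * (norm (f x) powr p + norm (g x) powr p) * m x)"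
    by (intro sum_mono mult_right_mono) (auto simp: m_nonneg)
  also have "\<dots> = 2 powr p * ((\<Sum>x\<in>K. norm (f x) powr p * m x) + (\<Sum>x\<in>K. norm (g x) powr p * m x))"
    by (simp add: algebra_simps sum.distrib sum_distrib_left)
  also have "\<dots> \<le> 2 powr p * (A + B)"
    using assms(1,2) K by (intro mult_left_mono add_mono Lp_sums_leD) auto
  finally show "(\<Sum>x\<in>K. norm (h x) powr p * m x) \<le> 2 powr p * (A + B)" .
qed

lemma Holder_sum:
  fixes f g :: "'v \<Rightarrow> complex"
  assumes "1 < p" "1 < q" "1 / p + 1 / q = 1" "finite K"
    and f: "(\<Sum>x\<in>K. norm (f x) powr p * m x) \<le> A powr p" and A: "0 < A"
    and g: "(\<Sum>x\<in>K. norm (g x) powr q * m x) \<le> B powr q" and B: "0 < B"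
  shows "(\<Sum>x\<in>K. norm (f x) * norm (g x) * m x) \<le> A * B"
proof -
  have young: "norm (f x) * norm (g x) * m x
      \<le> A * B * (norm (f x) powr p * m x / A powr p / p + norm (g x) powr q * m x / B powr q / q)" for x
  proof -
    have "(norm (f x) / A) * (norm (g x) / B)
        \<le> (norm (f x) / A) powr p / p + (norm (g x) / B) powr q / q"
      using assms A B by (intro Youngs_inequality) auto
    also have "\<dots> = norm (f x) powr p / A powr p / p + norm (g x) powr q / B powr q / q"
      using A B by (simp add: powr_divide)
    finally have "(A * B) * m x * ((norm (f x) / A) * (norm (g x) / B))
        \<le> (A * B) * m x * (norm (f x) powr p / A powr p / p + norm (g x) powr q / B powr q / q)"
      using A B m_nonneg by (intro mult_left_mono) auto
    then show ?thesis using A B by (simp add: field_simps)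
  qed
  have "(\<Sum>x\<in>K. norm (f x) * norm (g x) * m x)
      \<le> (\<Sum>x\<in>K. A * B * (norm (f x) powr p * m x / A powr p / p + norm (g x) powr q * m x / B powr q
          / q))"
    by (intro sum_mono young)
  also have "\<dots> = A * B * ((\<Sum>x\<in>K. norm (f x) powr p * m x) / A powr p / p
      + (\<Sum>x\<in>K. norm (g x) powr q * m x) / B powr q / q)"
    by (simp add: sum_distrib_left[symmetric] sum.distrib sum_divide_distrib[symmetric])
  also have "\<dots> \<le> A * B * (1 / p + 1 / q)"
    using assms A B by (intro mult_left_mono add_mono divide_right_mono) (auto simp: divide_simps)
  finally show ?thesis using assms by simp
qed

lemma Holder_sum_nonneg:
  fixes f g :: "'v \<Rightarrow> complex"
  assumes "1 < p" "1 < q" "1 / p + 1 / q = 1" "finite K"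
    and f: "(\<Sum>x\<in>K. norm (f x) powr p * m x) \<le> A powr p" and A: "0 \<le> A"
    and g: "(\<Sum>x\<in>K. norm (g x) powr q * m x) \<le> B powr q" and B: "0 < B"
  shows "(\<Sum>x\<in>K. norm (f x) * norm (g x) * m x) \<le> A * B"
proof (rule field_le_epsilon)
  fix e :: real assume e: "0 < e"
  \<comment> \<open>\<open>A\<close> may vanish; enlarging it by \<open>e / B\<close> makes it
    positive and adds exactly \<open>e\<close> to the product with \<open>B\<close>.\<close>
  have "A powr p \<le> (A + e / B) powr p" using A B e assms(1) by (intro powr_mono2) auto
  then have "(\<Sum>x\<in>K. norm (f x) powr p * m x) \<le> (A + e / B) powr p" using f by simp
  then have "(\<Sum>x\<in>K. norm (f x) * norm (g x) * m x) \<le> (A + e / B) * B"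
    using A B e by (intro Holder_sum[OF assms(1-4) _ _ g B]) (auto simp: add_nonneg_pos)
  then show "(\<Sum>x\<in>K. norm (f x) * norm (g x) * m x) \<le> A * B + e" using B by (simp add: distrib_right)
qed

lemma conjugate_exponent:
  assumes "1 < p" obtains q :: real where "1 < q" "1 / p + 1 / q = 1"
proof -
  have "1 / p + 1 / (p / (p - 1)) = 1" using assms by (simp add: field_simps)
  then show thesis using that[of "p / (p - 1)"] assms by simp
qed

text \<open>Converse of Hoelder's inequality on a finite set, with the sharp constant. It transfers
  bounds for scalar pairings back to norms.\<close>

lemma Lp_sums_le_dual:
  fixes f :: "'v \<Rightarrow> complex"
  assumes "1 < p" "1 < q" "1 / p + 1 / q = 1" "0 \<le> C" "finite K"
    and dual: "\<And>g. (\<And>x. x \<notin> K \<Longrightarrow> g x = 0) \<Longrightarrow> (\<Sum>x\<in>K. norm (g x) powr q * m x) \<le> 1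
              \<Longrightarrow> norm (\<Sum>x\<in>K. f x * g x * of_real (m x)) \<le> C"
  shows "(\<Sum>x\<in>K. norm (f x) powr p * m x) \<le> C powr p"
proof -
  define S where "S = (\<Sum>x\<in>K. norm (f x) powr p * m x)"
  have S0: "0 \<le> S" unfolding S_def by (intro sum_nonneg) (auto simp: m_nonneg)
  show ?thesis
  proof (cases "S = 0")
    case False
    then have S: "0 < S" using S0 by simp
    have pq: "(p - 1) * q = p" "1 / q = 1 - 1 / p" using assms(1-3) by (auto simp: field_simps)
    \<comment> \<open>The extremal function of Hoelder's inequality, normalised in the dual norm;
      its pairing with \<open>f\<close> is \<open>S powr (1 / p)\<close>.\<close>
    define g where "g x = (if x \<in> K then cnj (sgn (f x)) * of_real (norm (f x) powr (p - 1) * S powr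
        (- 1 / q)) else 0)" for x
    have ng: "norm (g x) = norm (f x) powr (p - 1) * S powr (- 1 / q)" if "x \<in> K" for x
      using that by (auto simp: g_def norm_mult norm_sgn)
    have "norm (g x) powr q = norm (f x) powr p * S powr - 1" if "x \<in> K" for x
      unfolding ng[OF that] using pq(1) assms(2) by (simp add: powr_mult powr_powr)
    then have "(\<Sum>x\<in>K. norm (g x) powr q * m x) = S powr - 1 * S"
      unfolding S_def sum_distrib_left by (intro sum.cong) auto
    also have "\<dots> = 1" using S by (simp add: powr_minus)
    finally have "norm (\<Sum>x\<in>K. f x * g x * of_real (m x)) \<le> C"
      by (intro dual) (auto simp: g_def)
    moreover have "f x * g x * of_real (m x) = of_real (norm (f x) powr p * m x * S powr (- 1 / q))"
      if "x \<in> K" for x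
    proof -
      have "f x * cnj (sgn (f x)) = of_real (norm (f x))"
      proof (cases "f x = 0")
        case False
        have "f x * cnj (sgn (f x)) = (f x * cnj (f x)) / of_real (norm (f x))"
          by (simp add: sgn_eq)
        also have "\<dots> = of_real ((norm (f x))\<^sup>2) / of_real (norm (f x))"
          by (simp only: complex_norm_square)
        finally show ?thesis using False by (simp add: power2_eq_square)
      qed simp
      then have "f x * g x = of_real (norm (f x)) * of_real (norm (f x) powr (p - 1) * S powr (- 1 / q))"
        using that by (simp add: g_def mult.assoc[symmetric])
      also have "\<dots> = of_real (norm (f x) powr p * S powr (- 1 / q))"
        using assms(1) by (cases "f x = 0") (simp_all add: powr_diff)
      finally show ?thesis by (simp add: mult_ac)
    qed
    then have "(\<Sum>x\<in>K. f x * g x * of_real (m x)) = of_real (S * S powr (- 1 / q))"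
      unfolding S_def sum_distrib_right of_real_sum by (intro sum.cong) auto
    moreover have "S * S powr (- 1 / q) = S powr (1 / p)"
      using S pq(2) by (simp add: powr_mult_base)
    ultimately have "S powr (1 / p) \<le> C" using S0 by (simp add: norm_mult)
    then have "(S powr (1 / p)) powr p \<le> C powr p" using assms(1) by (intro powr_mono2) auto
    then show ?thesis using S assms(1) by (simp add: powr_powr S_def)
  qed (auto simp: S_def)
qed

end

section \<open>The Calderon--Zygmund decomposition of a function of mean zero\<close>

locale cz_decomposition = vertex_weight m for m :: "'v \<Rightarrow> real" +
  fixes A :: real and cells :: "'v set set" and R :: "'v set" and \<D> :: "'v set set"
    and g :: "'v \<Rightarrow> complex"
  assumes lam: "laminar_refinement A m cells R \<D>" and A_ge_1: "1 \<le> A"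
    and finite_R: "finite R"
    and g_support: "x \<notin> R \<Longrightarrow> g x = 0"
    and g_mean: "(\<Sum>x\<in>R. g x * of_real (m x)) = 0"
begin

definition average where "average Q = (\<Sum>x\<in>Q. g x * of_real (m x)) / of_real (sum m Q)"
definition abs_average where "abs_average Q = (\<Sum>x\<in>Q. norm (g x) * m x) / sum m Q"
text \<open>By laminarity the stopping sets through \<open>x\<close> form a chain, so this union is
  the largest of them, and it is empty when none exists.\<close>

definition stop_cell where "stop_cell l x = \<Union> {Q \<in> \<D>. x \<in> Q \<and> l < abs_average Q}"
text \<open>A vertex contained in no stopping set is its own cell, so that \<open>good l\<close> is the conditional
  expectation of \<open>g\<close> with respect to a single partition of \<open>R\<close>.\<close>

definition cell where "cell l x = (if stop_cell l x = {} then {x} else stop_cell l x)"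
definition good where "good l x = (if x \<in> R then average (cell l x) else 0)"
definition level_set where "level_set l = {x \<in> R. stop_cell l x \<noteq> {}}"

lemmas lamD = laminar_refinementD[OF lam]

lemma D_finite: "Q \<in> \<D> \<Longrightarrow> finite Q"
  using lamD(4) finite_R finite_subset by blast

lemma sum_m_pos: "finite Q \<Longrightarrow> Q \<noteq> {} \<Longrightarrow> 0 < sum m Q"
  by (rule sum_pos) (auto simp: m_pos)

lemma average_singleton: "average {x} = g x"
  by (simp add: average_def m_neq_0)

lemma abs_average_singleton: "abs_average {x} = norm (g x)"
  by (simp add: abs_average_def m_neq_0)

lemma norm_average_le: "norm (average Q) \<le> abs_average Q"
proof -
  have "0 \<le> sum m Q" by (intro sum_nonneg m_nonneg)
  then show ?thesis unfolding average_def abs_average_def norm_divide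
    by (auto intro!: divide_right_mono order_trans[OF norm_sum] sum_mono
        simp: norm_mult m_nonneg simp del: of_real_sum)
qed

lemma stop_cell_mem:
  assumes "stop_cell l x \<noteq> {}"
  shows "stop_cell l x \<in> \<D> \<and> x \<in> stop_cell l x \<and> l < abs_average (stop_cell l x)"
proof -
  let ?B = "{Q \<in> \<D>. x \<in> Q \<and> l < abs_average Q}"
  have "\<Union> ?B \<in> ?B"
  proof (rule Union_in_chain)
    show "finite ?B" using lamD(1) by simp
    show "?B \<noteq> {}" using assms unfolding stop_cell_def by blast
    show "subset.chain \<D> ?B"
      unfolding subset_chain_def using lamD(6) by blast
  qed
  then show ?thesis unfolding stop_cell_def by blast
qed

lemma subset_stop_cell: "Q \<in> \<D> \<Longrightarrow> x \<in> Q \<Longrightarrow> l < abs_average Q \<Longrightarrow> Q \<subseteq> stop_cell l x"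
  unfolding stop_cell_def by blast

lemma cell_mem: "x \<in> R \<Longrightarrow> cell l x \<in> \<D>" "x \<in> cell l x"
  using lamD(5) stop_cell_mem unfolding cell_def by auto

lemma cell_subset: "x \<in> R \<Longrightarrow> cell l x \<subseteq> R"
  using cell_mem(1) lamD(4) by blast

lemma stop_cell_eq: "y \<in> stop_cell l x \<Longrightarrow> stop_cell l y = stop_cell l x"
proof -
  assume y: "y \<in> stop_cell l x"
  then have x: "stop_cell l x \<in> \<D>" "x \<in> stop_cell l x" "l < abs_average (stop_cell l x)"
    using stop_cell_mem by blast+
  then have sub: "stop_cell l x \<subseteq> stop_cell l y" using y by (intro subset_stop_cell)
  then have "stop_cell l y \<noteq> {}" using y by blast
  then have "stop_cell l y \<subseteq> stop_cell l x"
    using stop_cell_mem[of l y] sub x(2) by (intro subset_stop_cell) auto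
  with sub show ?thesis by blast
qed

lemma cell_eq: "y \<in> cell l x \<Longrightarrow> cell l y = cell l x"
  using stop_cell_eq unfolding cell_def by (metis empty_iff singletonD)

lemma stop_cell_mono: "l \<le> l' \<Longrightarrow> stop_cell l' x \<subseteq> stop_cell l x"
  unfolding stop_cell_def by fastforce

text \<open>A higher threshold gives a finer partition, so the functions \<open>good l\<close> form
  a martingale in \<open>l\<close>.\<close>

lemma cell_mono: "l \<le> l' \<Longrightarrow> cell l' x \<subseteq> cell l x"
  using stop_cell_mono[of l l' x] cell_mem(2)[of x l] unfolding cell_def by (auto split: if_splits)

lemma average_R: "average R = 0"
  unfolding average_def g_mean by simp

text \<open>The set above a maximal stopping set did not stop, so its average of
  \<open>norm (g x)\<close> is at most \<open>l\<close>, and comparable mass costs \<open>A\<close>.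
  If the stopping set is \<open>R\<close>, the average of \<open>g\<close> is zero. A vertex in no
  stopping set has \<open>norm (g x) \<le> l\<close>, as its singleton did not stop.\<close>

lemma good_bound:
  assumes "0 \<le> l" shows "norm (good l x) \<le> A * l"
proof (cases "x \<in> R")
  case x: True
  show ?thesis
  proof (cases "stop_cell l x = {}")
    case True
    then have "\<not> l < abs_average {x}" using subset_stop_cell[OF lamD(5)[OF x], of x l] by auto
    then have "norm (good l x) \<le> 1 * l"
      using True x by (simp add: good_def cell_def average_singleton abs_average_singleton)
    also have "\<dots> \<le> A * l" using A_ge_1 assms by (intro mult_right_mono) auto
    finally show ?thesis .
  next
    case False
    let ?S = "stop_cell l x"
    have S: "?S \<in> \<D>" "x \<in> ?S" using stop_cell_mem[OF False] by auto
    have good: "good l x = average ?S" using False x by (simp add: good_def cell_def)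
    show ?thesis
    proof (cases "?S = R")
      case True
      then show ?thesis using good average_R A_ge_1 assms by simp
    next
      case neq: False
      obtain P where P: "P \<in> \<D>" "?S \<subset> P" "sum m P \<le> A * sum m ?S" using lamD(7)[OF S(1) neq] by blast
      have "\<not> l < abs_average P" using subset_stop_cell[OF P(1), of x l] P(2) S(2) by auto
      moreover have mP: "0 < sum m P" using P(2) D_finite[OF P(1)] by (intro sum_m_pos) auto
      ultimately have *: "(\<Sum>x\<in>P. norm (g x) * m x) \<le> l * sum m P"
        unfolding abs_average_def by (simp add: divide_simps)
      have mS: "0 < sum m ?S" using S D_finite by (intro sum_m_pos) auto
      have "norm (good l x) \<le> abs_average ?S" unfolding good by (rule norm_average_le)
      also have "\<dots> \<le> (\<Sum>x\<in>P. norm (g x) * m x) / sum m ?S"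
        unfolding abs_average_def using mS P(2) D_finite[OF P(1)]
        by (intro divide_right_mono sum_mono2) (auto simp: m_nonneg)
      also have "\<dots> \<le> (l * (A * sum m ?S)) / sum m ?S"
        using mS assms by (intro divide_right_mono order_trans[OF *] mult_left_mono P(3)) auto
      finally show ?thesis using mS by (simp add: mult.commute)
    qed
  qed
qed (use A_ge_1 assms in \<open>simp add: good_def\<close>)

text \<open>The tower property of conditional expectations for the partition of \<open>l'\<close>,
  which refines that of \<open>l\<close>.\<close>

lemma sum_good:
  assumes "x \<in> R" "l \<le> l'"
  shows "(\<Sum>y\<in>cell l x. good l' y * of_real (m y)) = (\<Sum>y\<in>cell l x. g y * of_real (m y))"
proof -
  let ?Q = "cell l x"
  have finQ: "finite ?Q" using cell_mem(1)[OF assms(1)] D_finite by blast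
  have sub: "cell l' y \<subseteq> ?Q" if "y \<in> ?Q" for y
    using cell_mono[OF assms(2), of y] cell_eq[OF that] by simp
  have QR: "?Q \<subseteq> R" using cell_subset assms(1) by blast
  have sym: "z \<in> cell l' y \<longleftrightarrow> y \<in> cell l' z" for y z
    using cell_eq cell_mem(2) by metis
  \<comment> \<open>\<open>?w z y\<close> spreads the mass of \<open>g\<close> at \<open>z\<close>
    over the \<open>l'\<close>-cell of \<open>z\<close> in proportion to \<open>m\<close>. Summing
    over \<open>z\<close> gives \<open>good l'\<close>, summing over \<open>y\<close> gives back
    \<open>g\<close>; the condition is symmetric because cells form a partition.\<close>
  let ?w = "\<lambda>z y. if y \<in> cell l' z
        then g z * of_real (m z) * (of_real (m y) / of_real (sum m (cell l' z))) else 0"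
  have "good l' y * of_real (m y) = (\<Sum>z\<in>?Q. ?w z y)" if y: "y \<in> ?Q" for y
  proof -
    have "(\<Sum>z\<in>?Q. ?w z y) = (\<Sum>z\<in>cell l' y. ?w z y)"
    proof (rule sum.mono_neutral_right[OF finQ sub[OF y]])
      show "\<forall>z\<in>?Q - cell l' y. ?w z y = 0" using sym by (metis DiffD2)
    qed
    also have "\<dots> = (\<Sum>z\<in>cell l' y. g z * of_real (m z)) * (of_real (m y) / of_real (sum m (cell l' y)))"
      unfolding sum_distrib_right
    proof (rule sum.cong[OF refl])
      fix z assume z: "z \<in> cell l' y"
      show "?w z y = g z * of_real (m z) * (of_real (m y) / of_real (sum m (cell l' y)))"
        using cell_eq[OF z] cell_mem(2)[of y l'] by simp
    qed
    finally show ?thesis using y QR by (auto simp: good_def average_def)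
  qed
  then have "(\<Sum>y\<in>?Q. good l' y * of_real (m y)) = (\<Sum>y\<in>?Q. \<Sum>z\<in>?Q. ?w z y)"
    by (intro sum.cong) auto
  also have "\<dots> = (\<Sum>z\<in>?Q. \<Sum>y\<in>?Q. ?w z y)" by (rule sum.swap)
  also have "\<dots> = (\<Sum>z\<in>?Q. g z * of_real (m z))"
  proof (rule sum.cong[OF refl])
    fix z assume z: "z \<in> ?Q"
    have "(\<Sum>y\<in>?Q. ?w z y) = (\<Sum>y\<in>cell l' z. ?w z y)"
      using sub[OF z] finQ by (intro sum.mono_neutral_right) auto
    also have "\<dots> = (\<Sum>y\<in>cell l' z. g z * of_real (m z) * (of_real (m y) / of_real (sum m (cell l' z))))"
      by (intro sum.cong) auto
    also have "\<dots> = g z * of_real (m z) * (of_real (sum m (cell l' z)) / of_real (sum m (cell l' z)))"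
      unfolding sum_distrib_left[symmetric] sum_divide_distrib[symmetric] of_real_sum[symmetric] ..
    also have "sum m (cell l' z) > 0"
      using sub[OF z] finQ finite_subset cell_mem(2)[of z l'] by (intro sum_m_pos) auto
    then have "complex_of_real (sum m (cell l' z)) \<noteq> 0" by (simp del: of_real_sum)
    then have "complex_of_real (sum m (cell l' z)) / of_real (sum m (cell l' z)) = 1" by (rule
        divide_self)
    finally show "(\<Sum>y\<in>?Q. ?w z y) = g z * of_real (m z)" by simp
  qed
  finally show ?thesis .
qed

definition layer where "layer l l' x = good l' x - good l x"

lemma sum_layer:
  assumes "x \<in> R" "l \<le> l'"
  shows "(\<Sum>y\<in>cell l x. layer l l' y * of_real (m y)) = 0"
  unfolding layer_def left_diff_distrib sum_subtractf sum_good[OF assms] sum_good[OF assms(1) order_refl]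
  by simp

text \<open>Where nothing stops at \<open>l\<close>, nothing stops at a higher threshold; both cells
  are the point itself and the two terms cancel.\<close>

lemma layer_support: "l \<le> l' \<Longrightarrow> x \<notin> level_set l \<Longrightarrow> layer l l' x = 0"
  using stop_cell_mono[of l l' x] unfolding layer_def level_set_def good_def cell_def by auto

lemma layer_bound:
  assumes "0 \<le> l" "0 \<le> l'" shows "norm (layer l l' x) \<le> A * (l + l')"
  using norm_triangle_ineq4[of "good l' x" "good l x"] good_bound[OF assms(1), of x]
    good_bound[OF assms(2), of x] unfolding layer_def by (simp add: distrib_left)

definition stops where "stops l = stop_cell l ` level_set l"

lemma finite_level_set: "finite (level_set l)"
  using finite_R by (simp add: level_set_def)

lemma stops:
  shows "finite (stops l)" "stops l \<subseteq> \<D>" "disjoint (stops l)" "\<Union> (stops l) = level_set l"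
proof -
  show "finite (stops l)" unfolding stops_def using finite_level_set by simp
  show D: "stops l \<subseteq> \<D>" unfolding stops_def level_set_def using stop_cell_mem by blast
  show "disjoint (stops l)" unfolding stops_def disjoint_def using stop_cell_eq by blast
  have "stop_cell l x \<subseteq> level_set l" if "x \<in> level_set l" for x
  proof
    fix y assume y: "y \<in> stop_cell l x"
    have "stop_cell l x \<subseteq> R" using D lamD(4) that unfolding stops_def by blast
    then show "y \<in> level_set l" using y stop_cell_eq[OF y] unfolding level_set_def by blast
  qed
  moreover have "x \<in> stop_cell l x" if "x \<in> level_set l" for x
    using that stop_cell_mem unfolding level_set_def by blast
  ultimately show "\<Union> (stops l) = level_set l" unfolding stops_def by blast
qed

lemma sum_over_stops:
  fixes f :: "'v \<Rightarrow> real" shows "sum f (level_set l) = (\<Sum>Q\<in>stops l. sum f Q)"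
proof -
  have "sum f (\<Union> (stops l)) = (\<Sum>Q\<in>stops l. sum f Q)"
    using stops[of l] D_finite by (subst sum.Union_disjoint) (auto simp: disjoint_def)
  then show ?thesis using stops(4) by simp
qed

lemma sum_layer_stop:
  assumes "Q \<in> stops l" "l \<le> l'"
  shows "(\<Sum>y\<in>Q. layer l l' y * of_real (m y)) = 0"
proof -
  obtain x where "x \<in> R" "stop_cell l x \<noteq> {}" "Q = stop_cell l x"
    using assms(1) unfolding stops_def level_set_def by blast
  then show ?thesis using sum_layer[OF _ assms(2), of x] by (simp add: cell_def)
qed

text \<open>On a stopping set the values below \<open>l / 2\<close> account for at most half of
  \<open>l * sum m Q\<close>, so the large values must carry the rest. Keeping only the large values
  of \<open>g\<close> on the right is what allows the later summation over all levels.\<close>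

lemma weak_type:
  assumes "0 < l"
  shows "l / 2 * sum m (level_set l) \<le> (\<Sum>x | x \<in> R \<and> l / 2 < norm (g x). norm (g x) * m x)"
proof -
  let ?f = "\<lambda>x. (if l / 2 < norm (g x) then norm (g x) * m x else 0)"
  have "l / 2 * sum m Q \<le> sum ?f Q" if Q: "Q \<in> stops l" for Q
  proof -
    obtain x where x: "x \<in> R" "stop_cell l x \<noteq> {}" "Q = stop_cell l x"
      using Q unfolding stops_def level_set_def by blast
    then have QD: "Q \<in> \<D>" "Q \<noteq> {}" "l < abs_average Q" using stop_cell_mem[of l x] by auto
    have "0 < sum m Q" using QD D_finite by (intro sum_m_pos) auto
    then have "l * sum m Q \<le> (\<Sum>x\<in>Q. norm (g x) * m x)"
      using QD(3) unfolding abs_average_def by (simp add: divide_simps)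
    also have "\<dots> \<le> (\<Sum>x\<in>Q. ?f x + l / 2 * m x)"
    proof (rule sum_mono)
      fix x
      have "norm (g x) * m x \<le> l / 2 * m x" if "\<not> l / 2 < norm (g x)"
        using that m_nonneg by (intro mult_right_mono) auto
      then show "norm (g x) * m x \<le> ?f x + l / 2 * m x" using assms m_nonneg by simp
    qed
    also have "\<dots> = sum ?f Q + l / 2 * sum m Q" by (simp add: sum.distrib sum_distrib_left)
    finally show ?thesis by simp
  qed
  then have "(\<Sum>Q\<in>stops l. l / 2 * sum m Q) \<le> (\<Sum>Q\<in>stops l. sum ?f Q)" by (rule sum_mono)
  then have "l / 2 * sum m (level_set l) \<le> sum ?f (level_set l)"
    unfolding sum_over_stops by (simp only: sum_distrib_left[symmetric])
  also have "\<dots> \<le> sum ?f R"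
    using finite_R m_nonneg by (intro sum_mono2) (auto simp: level_set_def)
  also have "\<dots> = (\<Sum>x | x \<in> R \<and> l / 2 < norm (g x). norm (g x) * m x)"
    using finite_R by (simp add: sum.inter_filter)
  finally show ?thesis .
qed

lemma good_large:
  assumes "\<And>x. norm (g x) \<le> l" shows "good l = g"
proof
  fix x
  have "abs_average Q \<le> l" if "Q \<in> \<D>" "Q \<noteq> {}" for Q
  proof -
    have "(\<Sum>x\<in>Q. norm (g x) * m x) \<le> l * sum m Q"
      unfolding sum_distrib_left using assms m_nonneg by (intro sum_mono mult_right_mono) auto
    moreover have "0 < sum m Q" using that D_finite by (intro sum_m_pos) auto
    ultimately show ?thesis unfolding abs_average_def by (simp add: divide_simps)
  qed
  then have "stop_cell l x = {}" using stop_cell_mem[of l x] by force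
  then show "good l x = g x" using g_support by (simp add: good_def cell_def average_singleton)
qed

text \<open>Below the average over \<open>R\<close> the whole of \<open>R\<close> stops, and the
  mean of \<open>g\<close> over it is zero. With \<open>good_large\<close> this makes the
  decomposition into layers finite and exact.\<close>

lemma good_small:
  assumes "l < abs_average R" shows "good l x = 0"
proof (cases "x \<in> R")
  case True
  have "R \<subseteq> stop_cell l x" using subset_stop_cell[OF lamD(3) True assms] .
  moreover have "stop_cell l x \<subseteq> R" using lamD(4) unfolding stop_cell_def by blast
  ultimately have "cell l x = R" using True by (auto simp: cell_def)
  then show ?thesis using average_R by (simp add: good_def)
qed (simp add: good_def)

end

section \<open>The atomic Hardy space\<close>

text \<open>Serves to merge a sequence of atomic series into a single one, enumerated along the
  pairing function.\<close>

lemma double_sums: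
  fixes f :: "nat \<Rightarrow> nat \<Rightarrow> 'b::banach"
  assumes f: "\<And>n. summable (\<lambda>j. norm (f n j))" "\<And>n. (\<Sum>j. norm (f n j)) \<le> M n" and M: "summable M"
  defines "h \<equiv> \<lambda>k. f (fst (prod_decode k)) (snd (prod_decode k))"
  shows "summable (\<lambda>k. norm (h k))" "(\<Sum>k. norm (h k)) \<le> suminf M" "h sums (\<Sum>n. \<Sum>j. f n j)"
proof -
  define F where "F = (\<lambda>z. f (fst z) (snd z))"
  have hF: "h k = F (prod_decode k)" for k by (simp add: h_def F_def)
  have norm_infsum: "infsum (\<lambda>j. norm (F (n, j))) UNIV = (\<Sum>j. norm (f n j))" for n
    using sums_nonneg_imp_has_sum[OF summable_sums[OF f(1)]] by (simp add: F_def infsumI)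
  have inner0: "0 \<le> (\<Sum>j. norm (f n j))" for n by (rule suminf_nonneg[OF f(1)]) simp
  have sumN: "summable (\<lambda>n. \<Sum>j. norm (f n j))"
    by (rule summable_comparison_test'[OF M, of 0]) (use f(2) inner0 in simp)
  have "Infinite_Sum.abs_summable_on F (Sigma UNIV (\<lambda>_. UNIV))"
    unfolding Infinite_Sum.abs_summable_on_Sigma_iff norm_infsum
    using f(1) sumN inner0 by (auto simp: F_def intro!: summable_nonneg_imp_summable_on)
  then have abs: "(\<lambda>z. norm (F z)) summable_on UNIV" by simp
  then have F: "F summable_on UNIV" by (rule abs_summable_summable)
  have bij: "bij_betw prod_decode UNIV UNIV" by (rule bij_prod_decode)
  have "(\<lambda>k. norm (h k)) summable_on UNIV"
    unfolding hF using abs summable_on_reindex_bij_betw[OF bij, of "\<lambda>z. norm (F z)"] by simp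
  then show sumh: "summable (\<lambda>k. norm (h k))" by (rule summable_on_imp_summable)
  have "(\<Sum>k. norm (h k)) = infsum (\<lambda>k. norm (h k)) UNIV"
    using sums_nonneg_imp_has_sum[OF summable_sums[OF sumh]] by (simp add: infsumI)
  also have "\<dots> = infsum (\<lambda>z. norm (F z)) (Sigma UNIV (\<lambda>_. UNIV))"
    unfolding hF using infsum_reindex_bij_betw[OF bij, of "\<lambda>z. norm (F z)"] by simp
  also have "\<dots> = infsum (\<lambda>n. infsum (\<lambda>j. norm (F (n, j))) UNIV) UNIV"
    using abs by (intro infsum_Sigma_banach[symmetric]) simp
  also have "\<dots> = (\<Sum>n. \<Sum>j. norm (f n j))" unfolding norm_infsum
    using sums_nonneg_imp_has_sum[OF summable_sums[OF sumN]] inner0 by (simp add: infsumI)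
  also have "\<dots> \<le> suminf M" by (rule suminf_le[OF f(2) sumN M])
  finally show "(\<Sum>k. norm (h k)) \<le> suminf M" .
  have "(h has_sum infsum F UNIV) UNIV"
    unfolding hF using has_sum_infsum[OF F] has_sum_reindex_bij_betw[OF bij, of F] by simp
  then have "h sums infsum F UNIV" by (rule has_sum_imp_sums)
  moreover have "infsum F UNIV = (\<Sum>n. \<Sum>j. f n j)"
  proof -
    have inner: "infsum (\<lambda>j. F (n, j)) UNIV = (\<Sum>j. f n j)" for n
      using norm_summable_imp_has_sum[OF f(1) summable_sums[OF summable_norm_cancel[OF f(1)]]]
      by (simp add: F_def infsumI)
    have "summable (\<lambda>n. norm (\<Sum>j. f n j))"
      by (rule summable_comparison_test'[OF sumN, of 0]) (use summable_norm[OF f(1)] in simp)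
    then have "infsum (\<lambda>n. \<Sum>j. f n j) UNIV = (\<Sum>n. \<Sum>j. f n j)"
      using norm_summable_imp_has_sum summable_sums summable_norm_cancel by (metis infsumI)
    moreover have "infsum F UNIV = infsum (\<lambda>n. infsum (\<lambda>j. F (n, j)) UNIV) UNIV"
      using F infsum_Sigma_banach[of F UNIV "\<lambda>_. UNIV"] by simp
    ultimately show ?thesis by (simp add: inner)
  qed
  ultimately show "h sums (\<Sum>n. \<Sum>j. f n j)" by simp
qed

text \<open>The sum is governed by its largest term. As \<open>I\<close> is an arbitrary finite set,
  it is reindexed by the distances to its maximum, which are distinct naturals.\<close>

lemma sum_powr_geometric_le:
  fixes s t :: real
  assumes "0 < s" "finite I" "0 < t" "\<And>k. k \<in> I \<Longrightarrow> 2 powr (real_of_int k) \<le> t"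
  shows "(\<Sum>k\<in>I. 2 powr (real_of_int k * s)) \<le> t powr s / (1 - 2 powr - s)"
proof (cases "I = {}")
  case False
  define K where "K = Max I"
  have K: "K \<in> I" "\<And>k. k \<in> I \<Longrightarrow> k \<le> K" using assms(2) False by (auto simp: K_def)
  have r: "0 < 2 powr - s" "2 powr - s < (1::real)" using assms(1) by (auto simp: powr_less_one)
  have inj: "inj_on (\<lambda>k. nat (K - k)) I"
  proof (rule inj_onI)
    fix x y assume "x \<in> I" "y \<in> I" "nat (K - x) = nat (K - y)"
    then show "x = y" using K(2)[of x] K(2)[of y] by arith
  qed
  have "(\<Sum>k\<in>I. 2 powr (real_of_int k * s)) = (\<Sum>k\<in>I. 2 powr (real_of_int K * s) * (2 powr - s) ^ nat
      (K - k))"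
  proof (rule sum.cong[OF refl])
    fix k assume "k \<in> I"
    then have "(2 powr - s) ^ nat (K - k) = 2 powr (- s * real_of_int (K - k))"
      using K by (simp add: powr_realpow[symmetric] powr_powr)
    then show "2 powr (real_of_int k * s) = 2 powr (real_of_int K * s) * (2 powr - s) ^ nat (K - k)"
      by (simp add: powr_add[symmetric] algebra_simps)
  qed
  also have "\<dots> = 2 powr (real_of_int K * s) * (\<Sum>j\<in>(\<lambda>k. nat (K - k)) ` I. (2 powr - s) ^ j)"
    unfolding sum_distrib_left[symmetric] sum.reindex[OF inj] by simp
  also have "\<dots> \<le> 2 powr (real_of_int K * s) * (\<Sum>j. (2 powr - s) ^ j)"
    using r assms(2) by (intro mult_left_mono sum_le_suminf summable_geometric) auto
  also have "\<dots> = (2 powr real_of_int K) powr s / (1 - 2 powr - s)"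
    using r by (simp add: suminf_geometric powr_powr)
  also have "\<dots> \<le> t powr s / (1 - 2 powr - s)"
    using r assms K by (intro divide_right_mono powr_mono2) auto
  finally show ?thesis .
qed (use assms powr_less_one[of 2 "- s"] in simp)

text \<open>The tree is used from here on only through finite admissible sets and large ones among
  them that have a laminar refinement with a uniform constant.\<close>

locale flow_space = vertex_weight m for m :: "'v \<Rightarrow> real" +
  fixes adj :: "'v \<Rightarrow> 'v \<Rightarrow> bool" and \<omega> :: "nat \<Rightarrow> 'v" and \<beta> A :: real
  assumes A_ge_1: "1 \<le> A"
    and cells_finite: "R \<in> admissible adj \<omega> \<beta> \<Longrightarrow> finite R \<and> R \<noteq> {}"
    and exhaustion: "finite K \<Longrightarrow> \<exists>R\<in>admissible adj \<omega> \<beta>. K \<subseteq> R \<and> t \<le> sum m R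
            \<and> (\<exists>\<D>. laminar_refinement A m (admissible adj \<omega> \<beta>) R \<D>)"
begin

abbreviation "cells \<equiv> admissible adj \<omega> \<beta>"
abbreviation "atom \<equiv> is_atom adj \<omega> \<beta> m"
abbreviation "Hardy \<equiv> H1 adj \<omega> \<beta> m"

lemma sum_m_cell_pos: "R \<in> cells \<Longrightarrow> 0 < sum m R"
  using cells_finite by (intro sum_pos) (auto simp: m_pos)

lemma atom_iff:
  "atom a \<longleftrightarrow> (\<exists>R\<in>cells. (\<forall>x. x \<notin> R \<longrightarrow> a x = 0) \<and> (\<forall>x. norm (a x) \<le> inverse (sum m R))
       \<and> (\<Sum>x\<in>R. a x * of_real (m x)) = 0)"
  unfolding is_atom_def using cells_finite
  by (intro bex_cong refl) (simp add: measure_vmeas set_integral_vmeas scaleR_conv_of_real mult.commute)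

lemma atom_zero: "atom (\<lambda>_. 0)"
proof -
  obtain R where "R \<in> cells" using exhaustion[of "{}"] by blast
  then show ?thesis unfolding atom_iff using sum_m_cell_pos by (force intro: bexI[of _ R])
qed

lemma atom_L1: "atom a \<Longrightarrow> finite K \<Longrightarrow> (\<Sum>x\<in>K. norm (a x) * m x) \<le> 1"
proof -
  assume "atom a" and K: "finite K"
  then obtain R where R: "R \<in> cells" "\<And>x. x \<notin> R \<Longrightarrow> a x = 0" "\<And>x. norm (a x) \<le> inverse (sum m R)"
    unfolding atom_iff by blast
  have "(\<Sum>x\<in>K. norm (a x) * m x) = (\<Sum>x\<in>K \<inter> R. norm (a x) * m x)"
    using K R(2) by (intro sum.mono_neutral_right) auto
  also have "\<dots> \<le> (\<Sum>x\<in>K \<inter> R. inverse (sum m R) * m x)"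
    using R(3) m_nonneg by (intro sum_mono mult_right_mono) auto
  also have "\<dots> \<le> (\<Sum>x\<in>R. inverse (sum m R) * m x)"
    using cells_finite[OF R(1)] sum_m_cell_pos[OF R(1)] m_nonneg by (intro sum_mono2) auto
  also have "\<dots> = 1" using sum_m_cell_pos[OF R(1)] by (simp add: sum_distrib_left[symmetric])
  finally show ?thesis .
qed

text \<open>The case of general \<open>n\<close> gives convergence in norm of an atomic series, and
  \<open>n = 0\<close> the embedding of the Hardy space into integrable functions.\<close>

lemma atomic_tail_L1:
  assumes a: "\<And>j. atom (a j)" and c: "summable (\<lambda>j. norm (c j))"
    and g: "\<And>x. (\<lambda>j. c j * a j x) sums g x" and K: "finite K"
  shows "(\<Sum>x\<in>K. norm (g x - (\<Sum>j<n. c j * a j x)) * m x) \<le> (\<Sum>j. norm (c (j + n)))"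
proof -
  have c': "summable (\<lambda>j. norm (c (j + n)))" using c by (rule summable_ignore_initial_segment)
  have point: "norm (c j) * (norm (a j x) * m x) \<le> norm (c j)" for j x
    using atom_L1[OF a[of j], of "{x}"] by (simp add: mult_left_le)
  have s: "summable (\<lambda>j. norm (c (j + n)) * (norm (a (j + n) x) * m x))" for x
    by (rule summable_comparison_test'[OF c', of 0]) (use point m_nonneg in \<open>simp add: abs_mult\<close>)
  have "norm (g x - (\<Sum>j<n. c j * a j x)) * m x
      \<le> (\<Sum>j. norm (c (j + n)) * (norm (a (j + n) x) * m x))" for x
  proof -
    have s': "summable (\<lambda>j. norm (c (j + n) * a (j + n) x))"
      using summable_mult2[OF s[of x], of "inverse (m x)"] m_neq_0[of x]
      by (simp add: norm_mult mult.assoc)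
    have "g x - (\<Sum>j<n. c j * a j x) = (\<Sum>j. c (j + n) * a (j + n) x)"
      using sums_split_initial_segment[OF g[of x], of n] by (simp add: sums_iff)
    then have "norm (g x - (\<Sum>j<n. c j * a j x)) \<le> (\<Sum>j. norm (c (j + n) * a (j + n) x))"
      using summable_norm[OF s'] by simp
    then have "norm (g x - (\<Sum>j<n. c j * a j x)) * m x \<le> (\<Sum>j. norm (c (j + n) * a (j + n) x)) * m x"
      using m_nonneg by (rule mult_right_mono)
    also have "\<dots> = (\<Sum>j. norm (c (j + n)) * (norm (a (j + n) x) * m x))"
      unfolding suminf_mult2[OF s'] by (simp add: norm_mult mult.assoc)
    finally show ?thesis .
  qed
  then have "(\<Sum>x\<in>K. norm (g x - (\<Sum>j<n. c j * a j x)) * m x)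
      \<le> (\<Sum>x\<in>K. \<Sum>j. norm (c (j + n)) * (norm (a (j + n) x) * m x))" by (rule sum_mono)
  also have "\<dots> = (\<Sum>j. \<Sum>x\<in>K. norm (c (j + n)) * (norm (a (j + n) x) * m x))"
    using s by (intro suminf_sum[symmetric])
  also have "\<dots> \<le> (\<Sum>j. norm (c (j + n)))"
  proof (rule suminf_le)
    show "summable (\<lambda>j. \<Sum>x\<in>K. norm (c (j + n)) * (norm (a (j + n) x) * m x))"
      using s by (intro summable_sum)
    show "(\<Sum>x\<in>K. norm (c (j + n)) * (norm (a (j + n) x) * m x)) \<le> norm (c (j + n))" for j
      using mult_left_mono[OF atom_L1[OF a[of "j + n"] K] norm_ge_zero[of "c (j + n)"]]
      by (simp add: sum_distrib_left)
  qed (rule c')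
  finally show ?thesis .
qed

lemma Lp_1_I: "(\<And>K. finite K \<Longrightarrow> (\<Sum>x\<in>K. norm (f x) * m x) \<le> B) \<Longrightarrow> f \<in> car (Lp m 1) \<and> nrm (Lp m 1) f \<le> B"
proof -
  assume a: "\<And>K. finite K \<Longrightarrow> (\<Sum>x\<in>K. norm (f x) * m x) \<le> B"
  then have "0 \<le> B" using a[of "{}"] by simp
  then have "Lp_sums_le 1 f (B powr 1)" using a by (simp add: Lp_sums_le_def)
  then show ?thesis using \<open>0 \<le> B\<close> Lp_I[of 1 f B] by simp
qed

lemma Lp_1_D: "f \<in> car (Lp m 1) \<Longrightarrow> finite K \<Longrightarrow> (\<Sum>x\<in>K. norm (f x) * m x) \<le> nrm (Lp m 1) f"
  using Lp_sums_leD[OF Lp_D[of f 1], of K] nrm_Lp_nonneg[of 1 f] by simp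

lemma H1_bdd_below:
  "bdd_below {(\<Sum>j. norm (c j)) |c a. atomic_decomp adj \<omega> \<beta> m g c a}"
  unfolding bdd_below_def atomic_decomp_def by (force intro: suminf_nonneg exI[of _ 0])

text \<open>Atomic series can be handled pointwise: the coefficients are absolutely summable, so
  \<open>atomic_tail_L1\<close> upgrades pointwise convergence to convergence in norm.\<close>

lemma H1_I:
  assumes a: "\<And>j. atom (a j)" and c: "summable (\<lambda>j. norm (c j))"
    and g: "\<And>x. (\<lambda>j. c j * a j x) sums g x"
  shows "g \<in> car Hardy" "nrm Hardy g \<le> (\<Sum>j. norm (c j))"
proof -
  let ?r = "\<lambda>n x. g x - (\<Sum>j<n. c j * a j x)"
  have r: "?r n \<in> car (Lp m 1) \<and> nrm (Lp m 1) (?r n) \<le> (\<Sum>j. norm (c (j + n)))" for n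
    by (intro Lp_1_I atomic_tail_L1[OF a c g])
  have "(\<lambda>n. \<Sum>j. norm (c (j + n))) \<longlonglongrightarrow> 0" by (rule suminf_exist_split2[OF c])
  then have "(\<lambda>n. nrm (Lp m 1) (?r n)) \<longlonglongrightarrow> 0"
    by (rule tendsto_sandwich[OF _ _ tendsto_const, rotated 2])
       (use r nrm_Lp_nonneg in \<open>auto intro: always_eventually\<close>)
  then have dec: "atomic_decomp adj \<omega> \<beta> m g c a" unfolding atomic_decomp_def using a c by blast
  moreover have "g \<in> car (Lp m 1)" using r[of 0] by simp
  ultimately show "g \<in> car Hardy" unfolding H1_def by auto
  show "nrm Hardy g \<le> (\<Sum>j. norm (c j))"
  proof -
    have "(\<Sum>j. norm (c j)) \<in> {(\<Sum>j. norm (c j)) |c a. atomic_decomp adj \<omega> \<beta> m g c a}"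
      using dec by blast
    from cInf_lower[OF this H1_bdd_below] show ?thesis by (simp add: H1_def)
  qed
qed

text \<open>As vertices have positive mass, convergence in norm forces convergence at each
  vertex.\<close>

lemma atomic_decomp_sums:
  assumes g: "g \<in> car (Lp m 1)" and dec: "atomic_decomp adj \<omega> \<beta> m g c a"
  shows "(\<lambda>j. c j * a j x) sums g x"
proof -
  let ?r = "\<lambda>n x. g x - (\<Sum>j<n. c j * a j x)"
  have a: "\<And>j. atom (a j)" and lim: "(\<lambda>n. nrm (Lp m 1) (?r n)) \<longlonglongrightarrow> 0"
    using dec unfolding atomic_decomp_def by auto
  have r: "?r n \<in> car (Lp m 1)" for n
  proof -
    have "(\<Sum>x\<in>K. norm (?r n x) * m x) \<le> nrm (Lp m 1) g + (\<Sum>j<n. norm (c j))" if K: "finite K" for K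
    proof -
      have "norm (?r n x) \<le> norm (g x) + (\<Sum>j<n. norm (c j) * norm (a j x))" for x
        by (rule order_trans[OF norm_triangle_ineq4]) (auto intro: sum_norm_le simp: norm_mult)
      then have "(\<Sum>x\<in>K. norm (?r n x) * m x) \<le> (\<Sum>x\<in>K. (norm (g x) + (\<Sum>j<n. norm (c j) * norm (a j
          x))) * m x)"
        using m_nonneg by (intro sum_mono mult_right_mono) auto
      also have "\<dots> = (\<Sum>x\<in>K. norm (g x) * m x) + (\<Sum>x\<in>K. \<Sum>j<n. norm (c j) * (norm (a j x) * m x))"
        by (simp add: distrib_right sum.distrib sum_distrib_right mult.assoc)
      also have "\<dots> = (\<Sum>x\<in>K. norm (g x) * m x) + (\<Sum>j<n. norm (c j) * (\<Sum>x\<in>K. norm (a j x) * m x))"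
        unfolding sum_distrib_left by (subst sum.swap) simp
      also have "\<dots> \<le> nrm (Lp m 1) g + (\<Sum>j<n. norm (c j) * 1)"
        using Lp_1_D[OF g K] atom_L1[OF a K] by (intro add_mono sum_mono mult_left_mono) auto
      finally show ?thesis by simp
    qed
    then show ?thesis by (rule Lp_1_I[THEN conjunct1])
  qed
  have "norm (?r n x) \<le> nrm (Lp m 1) (?r n) * inverse (m x)" for n
    using Lp_1_D[OF r[of n], of "{x}"] m_pos[of x] by (simp add: field_simps)
  moreover have "(\<lambda>n. nrm (Lp m 1) (?r n) * inverse (m x)) \<longlonglongrightarrow> 0"
    using tendsto_mult_right[OF lim, of "inverse (m x)"] by simp
  ultimately have "(\<lambda>n. ?r n x) \<longlonglongrightarrow> 0"
    by (intro Lim_null_comparison[of "\<lambda>n. ?r n x"] always_eventually) auto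
  then have "(\<lambda>n. g x - ?r n x) \<longlonglongrightarrow> g x - 0" by (intro tendsto_diff tendsto_const)
  then show ?thesis by (simp add: sums_def)
qed

lemma H1_D:
  assumes "g \<in> car Hardy" "nrm Hardy g < B"
  shows "\<exists>c a. (\<forall>j. atom (a j)) \<and> summable (\<lambda>j. norm (c j)) \<and> (\<Sum>j. norm (c j)) \<le> B
      \<and> (\<forall>x. (\<lambda>j. c j * a j x) sums g x)"
proof -
  let ?S = "{(\<Sum>j. norm (c j)) |c a. atomic_decomp adj \<omega> \<beta> m g c a}"
  have g: "g \<in> car (Lp m 1)" and "?S \<noteq> {}" using assms(1) unfolding H1_def by auto
  moreover have "Inf ?S < B" using assms(2) by (simp add: H1_def)
  ultimately obtain s where s: "s \<in> ?S" "s < B" using cInf_lessD[of ?S B] by blast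
  then obtain c a where ca: "s = (\<Sum>j. norm (c j))" "atomic_decomp adj \<omega> \<beta> m g c a" by blast
  then have "\<forall>x. (\<lambda>j. c j * a j x) sums g x" using atomic_decomp_sums[OF g ca(2)] by blast
  moreover have "(\<Sum>j. norm (c j)) \<le> B" using ca(1) s(2) by simp
  ultimately show ?thesis using ca(2) unfolding atomic_decomp_def by blast
qed

lemma nrm_H1_nonneg: "g \<in> car Hardy \<Longrightarrow> 0 \<le> nrm Hardy g"
  unfolding H1_def atomic_decomp_def by (auto intro!: cInf_greatest suminf_nonneg)

lemma H1_L1:
  assumes "g \<in> car Hardy" "finite K"
  shows "(\<Sum>x\<in>K. norm (g x) * m x) \<le> nrm Hardy g"
proof (rule field_le_epsilon)
  fix e :: real assume "0 < e"
  then have "nrm Hardy g < nrm Hardy g + e" by simp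
  from H1_D[OF assms(1) this] obtain c a where "\<And>j. atom (a j)" "summable (\<lambda>j. norm (c j))"
    "(\<Sum>j. norm (c j)) \<le> nrm Hardy g + e" "\<And>x. (\<lambda>j. c j * a j x) sums g x" by blast
  then show "(\<Sum>x\<in>K. norm (g x) * m x) \<le> nrm Hardy g + e"
    using atomic_tail_L1[of a c g K 0] assms(2) by simp
qed

lemma H1_suminf:
  assumes u: "\<And>n. u n \<in> car Hardy" "\<And>n. nrm Hardy (u n) \<le> M n" and M: "summable M"
    and g: "\<And>x. (\<lambda>n. u n x) sums g x"
  shows "g \<in> car Hardy \<and> nrm Hardy g \<le> suminf M"
proof -
  have main: "g \<in> car Hardy \<and> nrm Hardy g \<le> suminf M + e" if e: "0 < e" for e
  proof -
    \<comment> \<open>The infimum defining the Hardy norm need not be attained, so the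
      \<open>n\<close>-th term gets a slack of \<open>e / 2 ^ (n + 1)\<close>; all slacks together
      add up to \<open>e\<close>.\<close>
    define M' where "M' n = M n + e * (1 / 2) ^ Suc n" for n
    have M': "M' sums (suminf M + e * 1)" unfolding M'_def
      by (intro sums_add sums_mult summable_sums[OF M] power_half_series)
    have "nrm Hardy (u n) < M' n" for n
    proof -
      have "0 < e * (1 / 2) ^ Suc n" using e by simp
      then show ?thesis using u(2)[of n] unfolding M'_def by linarith
    qed
    then have "\<exists>c a. (\<forall>j. atom (a j)) \<and> summable (\<lambda>j. norm (c j)) \<and> (\<Sum>j. norm (c j)) \<le> M' n
        \<and> (\<forall>x. (\<lambda>j. c j * a j x) sums u n x)" for n
      by (rule H1_D[OF u(1)])
    then obtain c :: "nat \<Rightarrow> nat \<Rightarrow> complex" and a where ca: "\<And>n j. atom (a n j)" "\<And>n. summable (\<lambda>j.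
        norm (c n j))"
      "\<And>n. (\<Sum>j. norm (c n j)) \<le> M' n" "\<And>n x. (\<lambda>j. c n j * a n j x) sums u n x" by metis
    let ?c = "\<lambda>k. c (fst (prod_decode k)) (snd (prod_decode k))"
    let ?a = "\<lambda>k. a (fst (prod_decode k)) (snd (prod_decode k))"
    note c = double_sums[OF ca(2,3) sums_summable[OF M']]
    have "(\<lambda>k. ?c k * ?a k x) sums g x" for x
    proof -
      have le: "norm (c n j * a n j x) \<le> norm (c n j) * inverse (m x)" for n j
      proof -
        have "norm (a n j x) \<le> inverse (m x)"
          using atom_L1[OF ca(1)[of n j], of "{x}"] m_pos[of x] by (simp add: field_simps)
        then show ?thesis unfolding norm_mult by (rule mult_left_mono) simp
      qed
      have s: "summable (\<lambda>j. norm (c n j * a n j x))" for n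
        by (rule summable_comparison_test'[OF summable_mult2[OF ca(2)[of n], of "inverse (m x)"], of 0])
           (use le in simp)
      have bound: "(\<Sum>j. norm (c n j * a n j x)) \<le> M' n * inverse (m x)" for n
      proof -
        have "(\<Sum>j. norm (c n j * a n j x)) \<le> (\<Sum>j. norm (c n j) * inverse (m x))"
          by (rule suminf_le[OF le s summable_mult2[OF ca(2)]])
        also have "\<dots> = (\<Sum>j. norm (c n j)) * inverse (m x)" by (rule suminf_mult2[OF ca(2), symmetric])
        also have "\<dots> \<le> M' n * inverse (m x)" using ca(3) m_nonneg by (intro mult_right_mono) auto
        finally show ?thesis .
      qed
      have "(\<lambda>k. ?c k * ?a k x) sums (\<Sum>n. \<Sum>j. c n j * a n j x)"
        by (rule double_sums(3)[OF s bound summable_mult2[OF sums_summable[OF M']]])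
      also have "(\<Sum>n. \<Sum>j. c n j * a n j x) = g x"
        using sums_unique[OF ca(4)] sums_unique[OF g] by simp
      finally show ?thesis .
    qed
    then have "g \<in> car Hardy" "nrm Hardy g \<le> (\<Sum>k. norm (?c k))" using H1_I[of ?a ?c g] ca(1) c(1) by auto
    then show ?thesis using c(2) sums_unique[OF M'] by simp
  qed
  then show ?thesis using main[of 1] by (auto intro: field_le_epsilon)
qed

lemma H1_zero: "(\<lambda>_. 0) \<in> car Hardy" "nrm Hardy (\<lambda>_. 0) = 0"
  using H1_I[of "\<lambda>_ _. 0" "\<lambda>_. 0" "\<lambda>_. 0"] atom_zero nrm_H1_nonneg by force+

lemma H1_sum:
  assumes "finite I" "\<And>i. i \<in> I \<Longrightarrow> u i \<in> car Hardy \<and> nrm Hardy (u i) \<le> M i"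
  shows "(\<lambda>x. \<Sum>i\<in>I. u i x) \<in> car Hardy \<and> nrm Hardy (\<lambda>x. \<Sum>i\<in>I. u i x) \<le> (\<Sum>i\<in>I. M i)"
  using assms
proof (induction I)
  case empty then show ?case using H1_zero by simp
next
  case (insert i I)
  let ?s = "\<lambda>x. \<Sum>i\<in>I. u i x"
  \<comment> \<open>A sum of two terms is read as a series continued by zeros, so that
    \<open>H1_suminf\<close> also yields the triangle inequality.\<close>
  define w where "w n = (if n = 0 then u i else if n = 1 then ?s else (\<lambda>_. 0))" for n :: nat
  define B where "B n = (if n = 0 then M i else if n = 1 then (\<Sum>i\<in>I. M i) else 0)" for n :: nat
  have wB: "w n \<in> car Hardy \<and> nrm Hardy (w n) \<le> B n" for n
    using insert H1_zero by (simp add: w_def B_def)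
  have "B sums (\<Sum>n<2. B n)" by (rule sums_finite) (auto simp: B_def)
  moreover have "(\<lambda>n. w n x) sums (\<Sum>n<2. w n x)" for x by (rule sums_finite) (auto simp: w_def)
  ultimately have "(\<lambda>x. \<Sum>n<2. w n x) \<in> car Hardy \<and> nrm Hardy (\<lambda>x. \<Sum>n<2. w n x) \<le> (\<Sum>n<2. B n)"
    using H1_suminf[of w B "\<lambda>x. \<Sum>n<2. w n x"] wB by (metis sums_iff)
  then show ?case using insert(1,2) by (simp add: w_def B_def numeral_2_eq_2)
qed

lemma H1_scale:
  assumes "g \<in> car Hardy"
  shows "(\<lambda>x. r * g x) \<in> car Hardy \<and> nrm Hardy (\<lambda>x. r * g x) \<le> norm r * nrm Hardy g"
proof -
  have main: "(\<lambda>x. r * g x) \<in> car Hardy \<and> nrm Hardy (\<lambda>x. r * g x) \<le> norm r * B" if B: "nrm Hardy g <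
      B" for B
  proof -
    obtain c a where ca: "\<And>j. atom (a j)" "summable (\<lambda>j. norm (c j))" "(\<Sum>j. norm (c j)) \<le> B"
      "\<And>x. (\<lambda>j. c j * a j x) sums g x" using H1_D[OF assms B] by blast
    have s: "summable (\<lambda>j. norm (r * c j))" using summable_mult[OF ca(2), of "norm r"] by (simp add:
        norm_mult)
    have "(\<Sum>j. norm (r * c j)) = norm r * (\<Sum>j. norm (c j))"
      using suminf_mult[OF ca(2), of "norm r"] by (simp add: norm_mult)
    also have "\<dots> \<le> norm r * B" using ca(3) by (intro mult_left_mono) auto
    finally have "(\<Sum>j. norm (r * c j)) \<le> norm r * B" .
    moreover have "(\<lambda>j. r * c j * a j x) sums (r * g x)" for x
      using sums_mult[OF ca(4)[of x], of r] by (simp add: mult.assoc)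
    ultimately show ?thesis using H1_I[of a "\<lambda>j. r * c j" "\<lambda>x. r * g x"] ca(1) s by auto
  qed
  have "nrm Hardy (\<lambda>x. r * g x) \<le> norm r * nrm Hardy g"
  proof (rule field_le_epsilon)
    fix e :: real assume e: "0 < e"
    \<comment> \<open>The denominator \<open>norm r + 1\<close> also covers
      \<open>r = 0\<close>.\<close>
    have "nrm Hardy (\<lambda>x. r * g x) \<le> norm r * (nrm Hardy g + e / (norm r + 1))"
      using main e by (simp add: add_pos_nonneg add_nonneg_pos)
    also have "\<dots> \<le> norm r * nrm Hardy g + e"
      using e by (simp add: distrib_left field_simps add_pos_nonneg add_nonneg_pos)
    finally show "nrm Hardy (\<lambda>x. r * g x) \<le> norm r * nrm Hardy g + e" .
  qed
  then show ?thesis using main[of "nrm Hardy g + 1"] by simp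
qed

text \<open>Layers are kept as finite combinations of atoms: a function in \<open>BMO\<close> need not be integrable
  against an infinite atomic series.\<close>

definition cell_bounded :: "('v \<Rightarrow> complex) \<Rightarrow> real \<Rightarrow> bool" where
  "cell_bounded b \<mu> \<longleftrightarrow> (\<exists>\<S> c. finite \<S> \<and> \<S> \<subseteq> cells \<and> disjoint \<S> \<and> (\<forall>x. x \<notin> \<Union> \<S> \<longrightarrow> b x = 0)
     \<and> 0 < c \<and> (\<forall>x. norm (b x) \<le> c) \<and> (\<forall>Q\<in>\<S>. (\<Sum>x\<in>Q. b x * of_real (m x)) = 0)
     \<and> c * (\<Sum>Q\<in>\<S>. sum m Q) \<le> \<mu>)"

lemma H1_single_cell:
  assumes "Q \<in> cells" "\<And>x. x \<notin> Q \<Longrightarrow> b x = 0" "\<And>x. norm (b x) \<le> c" "0 < c"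
    "(\<Sum>x\<in>Q. b x * of_real (m x)) = 0"
  shows "b \<in> car Hardy \<and> nrm Hardy b \<le> c * sum m Q"
proof -
  note Q = sum_m_cell_pos[OF assms(1)]
  define a where "a x = b x * of_real (inverse (c * sum m Q))" for x
  have "norm (a x) \<le> inverse (sum m Q)" for x
  proof -
    have "norm (a x) = norm (b x) * inverse (c * sum m Q)"
      using Q assms(4) by (simp add: a_def norm_mult del: of_real_inverse of_real_mult)
    also have "\<dots> \<le> c * inverse (c * sum m Q)" using Q assms(3,4) by (intro mult_right_mono) auto
    finally show ?thesis using assms(4) by (simp add: field_simps)
  qed
  moreover have "(\<Sum>x\<in>Q. a x * of_real (m x)) = (\<Sum>x\<in>Q. b x * of_real (m x)) * of_real (inverse (c *
      sum m Q))"
    unfolding a_def sum_distrib_right by (simp only: mult_ac)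
  ultimately have a: "atom a" unfolding atom_iff using assms(1,2,5) by (intro bexI[of _ Q]) (auto
      simp: a_def)
  define cs where "cs j = (if j = (0::nat) then complex_of_real (c * sum m Q) else 0)" for j
  have s: "(\<lambda>j. norm (cs j)) sums (c * sum m Q)"
    using sums_single[of 0 "\<lambda>_. c * sum m Q"] Q assms(4) unfolding cs_def
    by (simp add: if_distrib norm_mult cong: if_cong del: of_real_mult of_real_sum)
  have "(\<lambda>j. cs j * a x) sums b x" for x
  proof -
    have "complex_of_real (c * sum m Q) * a x = b x"
      unfolding a_def using Q assms(4) by (simp add: field_simps del: of_real_sum)
    then show ?thesis using sums_single[of 0 "\<lambda>_. b x"] unfolding cs_def
      by (simp add: if_distrib[of "\<lambda>u. u * a x"] cong: if_cong)
  qed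
  then show ?thesis using H1_I[of "\<lambda>_. a" cs b] a s by (auto simp: sums_iff)
qed

lemma cell_bounded_H1:
  assumes "cell_bounded b \<mu>" shows "b \<in> car Hardy \<and> nrm Hardy b \<le> \<mu>"
proof -
  obtain \<S> c where S: "finite \<S>" "\<S> \<subseteq> cells" "disjoint \<S>" "\<And>x. x \<notin> \<Union> \<S> \<Longrightarrow> b x = 0"
    "0 < c" "\<And>x. norm (b x) \<le> c" "\<And>Q. Q \<in> \<S> \<Longrightarrow> (\<Sum>x\<in>Q. b x * of_real (m x)) = 0"
    "c * (\<Sum>Q\<in>\<S>. sum m Q) \<le> \<mu>"
    using assms unfolding cell_bounded_def by blast
  let ?b = "\<lambda>Q x. if x \<in> Q then b x else 0"
  have "?b Q \<in> car Hardy \<and> nrm Hardy (?b Q) \<le> c * sum m Q" if "Q \<in> \<S>" for Q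
    using that S by (intro H1_single_cell) auto
  then have "(\<lambda>x. \<Sum>Q\<in>\<S>. ?b Q x) \<in> car Hardy \<and> nrm Hardy (\<lambda>x. \<Sum>Q\<in>\<S>. ?b Q x) \<le> (\<Sum>Q\<in>\<S>. c * sum m Q)"
    by (intro H1_sum S(1)) auto
  moreover have "(\<Sum>Q\<in>\<S>. ?b Q x) = b x" for x
  proof (cases "x \<in> \<Union> \<S>")
    case True
    then obtain Q where Q: "Q \<in> \<S>" "x \<in> Q" by blast
    then have "(\<Sum>P\<in>\<S>. ?b P x) = (\<Sum>P\<in>{Q}. ?b P x)"
      using S(1,3) by (intro sum.mono_neutral_right) (auto simp: disjoint_def)
    then show ?thesis using Q by simp
  next
    case False
    then show ?thesis using S(4)[OF False] by (intro sum.neutral[THEN trans]) auto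
  qed
  ultimately show ?thesis using S(8) by (simp add: sum_distrib_left)
qed

end

section \<open>Layers of a function of mean zero\<close>

text \<open>The factor \<open>exp (e w\<^sup>2)\<close> makes \<open>f\<close> small at the ends of the strip.\<close>

lemma three_lines_max:
  fixes f :: "complex \<Rightarrow> complex"
  assumes cont: "continuous_on {z. 0 \<le> Re z \<and> Re z \<le> 1} f"
    and bdd: "bounded (f ` {z. 0 \<le> Re z \<and> Re z \<le> 1})"
    and hol: "f holomorphic_on {z. 0 < Re z \<and> Re z < 1}"
    and left: "\<And>t. norm (f (Complex 0 t)) \<le> B" and right: "\<And>t. norm (f (Complex 1 t)) \<le> B"
    and z: "0 \<le> Re z" "Re z \<le> 1"
  shows "norm (f z) \<le> B"
proof -
  obtain M where M: "0 < M" "\<And>w. 0 \<le> Re w \<Longrightarrow> Re w \<le> 1 \<Longrightarrow> norm (f w) \<le> M"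
    using bdd unfolding bounded_pos by auto
  have main: "norm (f z) \<le> B' * exp (e * (1 - (Re z)\<^sup>2 + (Im z)\<^sup>2))" if e: "0 < e" and B': "0 < B'"
      "B \<le> B'" for e B'
  proof -
    define g where "g w = f w * exp (of_real e * w\<^sup>2)" for w
    have norm_g: "norm (g w) = norm (f w) * exp (e * ((Re w)\<^sup>2 - (Im w)\<^sup>2))" for w
      by (simp add: g_def norm_mult norm_exp_eq_Re power2_eq_square)
    \<comment> \<open>With this height
      \<open>M \<le> B' * e * Y\<^sup>2 \<le> B' * exp (e * Y\<^sup>2)\<close>, so on the horizontal
      sides the Gaussian decay beats the a priori bound \<open>M\<close>. The summand with
      \<open>Im z\<close> keeps \<open>z\<close> inside the box.\<close>
    define Y where "Y = \<bar>Im z\<bar> + 1 + M / (B' * e)"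
    have Y: "\<bar>Im z\<bar> \<le> Y" "1 \<le> Y" "M / (B' * e) \<le> Y" using M B' e by (auto simp: Y_def add_increasing2)
    have "M / (B' * e) \<le> Y\<^sup>2" using Y by (smt (verit) power2_eq_square mult_le_cancel_left1)
    then have "M \<le> B' * (e * Y\<^sup>2)" using B' e by (simp add: field_simps)
    also have "\<dots> \<le> B' * exp (e * Y\<^sup>2)"
      using B' exp_ge_add_one_self[of "e * Y\<^sup>2"] by (intro mult_left_mono) linarith+
    finally have MY: "M \<le> B' * exp (e * Y\<^sup>2)" .
    let ?S = "cbox (Complex 0 (- Y)) (Complex 1 Y)"
    have "norm (g z) \<le> B' * exp e"
    proof (rule maximum_modulus_frontier[of g ?S])
      show "g holomorphic_on interior ?S"
        unfolding interior_cbox g_def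
        by (intro holomorphic_intros holomorphic_on_subset[OF hol]) (auto simp: in_box_complex_iff)
      show "continuous_on (closure ?S) g"
        unfolding closure_cbox g_def
        by (intro continuous_intros continuous_on_subset[OF cont]) (auto simp: in_cbox_complex_iff)
      show "bounded ?S" by (rule bounded_cbox)
      show "z \<in> ?S" using z Y by (auto simp: in_cbox_complex_iff)
      fix w assume "w \<in> frontier ?S"
      then have w: "w \<in> ?S" "w \<notin> box (Complex 0 (- Y)) (Complex 1 Y)"
        by (auto simp: frontier_def interior_cbox closure_cbox)
      then have Re: "0 \<le> Re w" "Re w \<le> 1" by (auto simp: in_cbox_complex_iff)
      then have Re2: "(Re w)\<^sup>2 \<le> 1" by (simp add: power_le_one)
      have "Re w = 0 \<or> Re w = 1 \<or> Im w = Y \<or> Im w = - Y"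
        using w unfolding in_cbox_complex_iff in_box_complex_iff by (auto simp: not_less)
      then consider "Re w = 0 \<or> Re w = 1" | "(Im w)\<^sup>2 = Y\<^sup>2" by fastforce
      then show "norm (g w) \<le> B' * exp e"
      proof cases
        case 1
        then have "norm (f w) \<le> B'"
          using left[of "Im w"] right[of "Im w"] B'(2) by (cases w) force
        moreover have "e * ((Re w)\<^sup>2 - (Im w)\<^sup>2) \<le> e * 1"
          using e Re2 zero_le_power2[of "Im w"] by (intro mult_left_mono) linarith+
        ultimately show ?thesis unfolding norm_g using B' by (intro mult_mono) auto
      next
        case 2
        have "norm (f w) \<le> B' * exp (e * Y\<^sup>2)" using M(2)[OF Re] MY by simp
        moreover have "e * ((Re w)\<^sup>2 - (Im w)\<^sup>2) \<le> e * (1 - Y\<^sup>2)"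
          using e Re2 2 by (intro mult_left_mono) linarith+
        ultimately have "norm (g w) \<le> B' * exp (e * Y\<^sup>2) * exp (e * (1 - Y\<^sup>2))"
          unfolding norm_g using B' by (intro mult_mono) auto
        also have "\<dots> = B' * exp e" by (simp add: exp_add[symmetric] algebra_simps)
        finally show ?thesis .
      qed
    qed
    then have "norm (f z) * exp (e * ((Re z)\<^sup>2 - (Im z)\<^sup>2)) \<le> B' * exp e" by (simp add: norm_g)
    then have "norm (f z) \<le> B' * exp e / exp (e * ((Re z)\<^sup>2 - (Im z)\<^sup>2))" by (simp add: pos_le_divide_eq)
    also have "\<dots> = B' * exp (e * (1 - (Re z)\<^sup>2 + (Im z)\<^sup>2))"
      by (simp add: exp_diff[symmetric] algebra_simps flip: times_divide_eq_right)
    finally show ?thesis .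
  qed
  have B0: "0 \<le> B" using left[of 0] norm_ge_zero order_trans by blast
  \<comment> \<open>\<open>B\<close> may be zero, whereas the choice of \<open>Y\<close> divides by
    the bound. So \<open>e\<close> tends to zero first, with a larger bound \<open>B'\<close>, and
    then \<open>B'\<close> decreases to \<open>B\<close>.\<close>
  have "norm (f z) \<le> B'" if "B < B'" for B'
  proof (rule tendsto_lowerbound)
    let ?c = "1 - (Re z)\<^sup>2 + (Im z)\<^sup>2"
    have "((\<lambda>e. B' * exp (e * ?c)) \<longlongrightarrow> B' * exp (0 * ?c)) (at_right 0)" by (intro tendsto_intros)
    then show "((\<lambda>e. B' * exp (e * ?c)) \<longlongrightarrow> B') (at_right 0)" by simp
    show "\<forall>\<^sub>F e in at_right 0. norm (f z) \<le> B' * exp (e * ?c)"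
      using that B0 by (intro eventually_at_rightI[of 0 1] main) auto
  qed simp
  then show ?thesis by (rule dense_ge)
qed

lemma sum_int_telescope:
  fixes F :: "int \<Rightarrow> 'a::ab_group_add"
  shows "(\<Sum>k\<in>{a..<a + int n}. F (k + 1) - F k) = F (a + int n) - F a"
proof (induction n)
  case (Suc n)
  have "{a..<a + int (Suc n)} = insert (a + int n) {a..<a + int n}" by auto
  then show ?case using Suc by (simp add: add.assoc algebra_simps)
qed simp

lemma powr_layer: "2 powr (real_of_int k * (s - 1)) * 2 powr real_of_int k = 2 powr (real_of_int k * s)"
  by (simp add: powr_add[symmetric] algebra_simps)

context flow_space
begin

definition mean_zero :: "('v \<Rightarrow> complex) \<Rightarrow> bool" where
  "mean_zero g \<longleftrightarrow> finite {x. g x \<noteq> 0} \<and> (\<Sum>x | g x \<noteq> 0. g x * of_real (m x)) = 0"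

lemma mean_zero_iff:
  assumes "finite K" "\<And>x. x \<notin> K \<Longrightarrow> g x = 0"
  shows "mean_zero g \<longleftrightarrow> (\<Sum>x\<in>K. g x * of_real (m x)) = 0"
proof -
  have sub: "{x. g x \<noteq> 0} \<subseteq> K" using assms(2) by blast
  then have "(\<Sum>x | g x \<noteq> 0. g x * of_real (m x)) = (\<Sum>x\<in>K. g x * of_real (m x))"
    using assms(1) by (intro sum.mono_neutral_left) auto
  then show ?thesis unfolding mean_zero_def using finite_subset[OF sub assms(1)] by simp
qed

lemma mean_zero_sum:
  assumes "mean_zero g" "finite K" "\<And>x. x \<notin> K \<Longrightarrow> g x = 0"
  shows "(\<Sum>x\<in>K. g x * of_real (m x)) = 0"
  using mean_zero_iff[of K g] assms by blast

lemma mean_zero_lincomb: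
  assumes "mean_zero g" "mean_zero h" shows "mean_zero (\<lambda>x. c * g x + d * h x)"
proof -
  let ?K = "{x. g x \<noteq> 0} \<union> {x. h x \<noteq> 0}"
  have K: "finite ?K" using assms by (simp add: mean_zero_def)
  have "(\<Sum>x\<in>?K. (c * g x + d * h x) * of_real (m x))
      = c * (\<Sum>x\<in>?K. g x * of_real (m x)) + d * (\<Sum>x\<in>?K. h x * of_real (m x))"
    by (simp add: sum_distrib_left sum.distrib algebra_simps)
  also have "\<dots> = 0" using mean_zero_sum[OF assms(1) K] mean_zero_sum[OF assms(2) K] by simp
  finally show ?thesis using K by (subst mean_zero_iff[of ?K]) auto
qed

text \<open>The two bounds by \<open>C\<close> are those that the analytic family needs on the
  edges: atomic weight on the left, norm of exponent \<open>p1\<close> on the right. The powers of 2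
  are the moduli of its coefficients there.\<close>

definition layered :: "real \<Rightarrow> real \<Rightarrow> real \<Rightarrow> ('v \<Rightarrow> complex) \<Rightarrow> 'v set \<Rightarrow> int set
    \<Rightarrow> (int \<Rightarrow> 'v \<Rightarrow> complex) \<Rightarrow> (int \<Rightarrow> real) \<Rightarrow> bool" where
  "layered p p1 C g K I b \<mu> \<longleftrightarrow> finite K \<and> finite I \<and> (\<forall>k x. x \<notin> K \<longrightarrow> b k x = 0) \<and>
     (\<forall>x. g x = (\<Sum>k\<in>I. b k x)) \<and> (\<forall>k\<in>I. cell_bounded (b k) (\<mu> k) \<and> 0 \<le> \<mu> k) \<and>
     (\<Sum>k\<in>I. 2 powr (real_of_int k * (p - 1)) * \<mu> k) \<le> C \<and>
     Lp_sums_le p1 (\<lambda>x. of_real (\<Sum>k\<in>I. 2 powr (real_of_int k * (p / p1 - 1)) * norm (b k x))) (C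
         powr p1)"

text \<open>The summation of the Marcinkiewicz theorem. After inserting \<open>weak_type\<close> and
  exchanging the sums, a vertex sees only the \<open>k\<close> with
  \<open>2 powr k < 2 * norm (g x)\<close>, a geometric sum comparable to the power
  \<open>p - 1\<close> of \<open>norm (g x)\<close>.\<close>

lemma sum_powr_level_sets_le:
  assumes "1 < p" "finite I" "cz_decomposition m A cells R \<D> g" "Lp_sums_le p g 1"
  shows "(\<Sum>k\<in>I. 2 powr (real_of_int k * p) * sum m (cz_decomposition.level_set m R \<D> g (2 powr
      real_of_int k)))
      \<le> 2 powr p / (1 - 2 powr - (p - 1))"
proof -
  interpret cz: cz_decomposition m A cells R \<D> g by fact
  let ?q = "1 - 2 powr - (p - 1)"
  have q: "0 < ?q" using assms(1) powr_less_one[of 2 "- (p - 1)"] by simp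
  let ?I = "\<lambda>x. {k \<in> I. 2 powr real_of_int k / 2 < norm (g x)}"
  have "(\<Sum>k\<in>I. 2 powr (real_of_int k * p) * sum m (cz.level_set (2 powr real_of_int k)))
      \<le> (\<Sum>k\<in>I. 2 * 2 powr (real_of_int k * (p - 1)) *
            (\<Sum>x\<in>R. if 2 powr real_of_int k / 2 < norm (g x) then norm (g x) * m x else 0))"
  proof (rule sum_mono)
    fix k
    have "2 powr (real_of_int k * p) * sum m (cz.level_set (2 powr real_of_int k))
      = 2 * 2 powr (real_of_int k * (p - 1)) *
          (2 powr real_of_int k / 2 * sum m (cz.level_set (2 powr real_of_int k)))"
      unfolding powr_layer[of k p, symmetric] by simp
    also have "\<dots> \<le> 2 * 2 powr (real_of_int k * (p - 1)) *
          (\<Sum>x | x \<in> R \<and> 2 powr real_of_int k / 2 < norm (g x). norm (g x) * m x)"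
      by (intro mult_left_mono cz.weak_type) auto
    finally show "2 powr (real_of_int k * p) * sum m (cz.level_set (2 powr real_of_int k))
      \<le> 2 * 2 powr (real_of_int k * (p - 1)) *
            (\<Sum>x\<in>R. if 2 powr real_of_int k / 2 < norm (g x) then norm (g x) * m x else 0)"
      using cz.finite_R by (simp add: sum.inter_filter)
  qed
  also have "\<dots> = (\<Sum>x\<in>R. 2 * (norm (g x) * m x) * (\<Sum>k\<in>?I x. 2 powr (real_of_int k * (p - 1))))"
    unfolding sum.inter_filter[OF assms(2)] sum_distrib_left
    by (subst sum.swap) (intro sum.cong refl, simp)
  also have "\<dots> \<le> (\<Sum>x\<in>R. 2 powr p / ?q * (norm (g x) powr p * m x))"
  proof (rule sum_mono)
    fix x
    show "2 * (norm (g x) * m x) * (\<Sum>k\<in>?I x. 2 powr (real_of_int k * (p - 1)))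
      \<le> 2 powr p / ?q * (norm (g x) powr p * m x)"
    proof (cases "g x = 0")
      case False
      have "(\<Sum>k\<in>?I x. 2 powr (real_of_int k * (p - 1))) \<le> (2 * norm (g x)) powr (p - 1) / ?q"
        using assms(1,2) False by (intro sum_powr_geometric_le) auto
      then have "2 * (norm (g x) * m x) * (\<Sum>k\<in>?I x. 2 powr (real_of_int k * (p - 1)))
          \<le> 2 * (norm (g x) * m x) * ((2 * norm (g x)) powr (p - 1) / ?q)"
        by (intro mult_left_mono) (auto simp: m_nonneg)
      also have "\<dots> = (2 * norm (g x)) powr 1 * (2 * norm (g x)) powr (p - 1) / ?q * m x"
        by simp
      also have "(2 * norm (g x)) powr 1 * (2 * norm (g x)) powr (p - 1) = 2 powr p * norm (g x) powr p"
        unfolding powr_add[symmetric] by (simp add: powr_mult)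
      finally show ?thesis by simp
    qed simp
  qed
  also have "\<dots> = 2 powr p / ?q * (\<Sum>x\<in>R. norm (g x) powr p * m x)" by (simp add: sum_distrib_left)
  also have "\<dots> \<le> 2 powr p / ?q * 1"
    using q Lp_sums_leD[OF assms(4) cz.finite_R] by (intro mult_left_mono) auto
  finally show ?thesis by simp
qed

proposition layered_exists:
  assumes p: "1 < p" "p < p1"
  shows "\<exists>C>0. \<forall>g. mean_zero g \<longrightarrow> Lp_sums_le p g 1 \<longrightarrow> (\<exists>K I b \<mu>. layered p p1 C g K I b \<mu>)"
proof -
  \<comment> \<open>\<open>c1\<close> bounds the weighted sum of the masses of the level sets and
    \<open>c2\<close> is the constant of a geometric sum with exponent \<open>s\<close>. The
    identity \<open>s * p1 = p\<close> lets both edge bounds end in the same sum.\<close>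
  define s where "s = p / p1"
  have s: "0 < s" "s * p1 = p" using p by (auto simp: s_def)
  define c1 where "c1 = 2 powr p / (1 - 2 powr - (p - 1))"
  define c2 where "c2 = 1 / (1 - 2 powr - s)"
  have c: "0 < c1" "0 < c2"
    using p s powr_less_one[of 2 "- (p - 1)"] powr_less_one[of 2 "- s"] by (auto simp: c1_def c2_def)
  define C where "C = 3 * A * c1 + 3 * A * c2 * c1 powr (1 / p1)"
  have C: "0 < C" "3 * A * c1 \<le> C" "3 * A * c2 * c1 powr (1 / p1) \<le> C"
    using c A_ge_1 by (auto simp: C_def add_pos_pos)
  have "\<exists>K I b \<mu>. layered p p1 C g K I b \<mu>" if g: "mean_zero g" "Lp_sums_le p g 1" for g
  proof (cases "\<forall>x. g x = 0")
    case True
    then show ?thesis unfolding layered_def using C p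
      by (intro exI[of _ "{}"] exI[of _ "\<lambda>_ _. 0"] exI[of _ "\<lambda>_. 0"]) (simp add: Lp_sums_le_def)
  next
    case False
    have "finite {x. g x \<noteq> 0}" using g(1) by (simp add: mean_zero_def)
    then obtain R \<D> where R: "R \<in> cells" "{x. g x \<noteq> 0} \<subseteq> R" "laminar_refinement A m cells R \<D>"
      using exhaustion by meson
    have cz: "cz_decomposition m A cells R \<D> g"
      using R cells_finite[OF R(1)] A_ge_1 mean_zero_sum[OF g(1), of R] by unfold_locales auto
    interpret cz: cz_decomposition m A cells R \<D> g by fact
    obtain x0 where x0: "x0 \<in> R" "g x0 \<noteq> 0" using False R(2) by blast
    have avR: "0 < cz.abs_average R"
    proof -
      have "0 < (\<Sum>x\<in>R. norm (g x) * m x)"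
        using x0 m_pos m_nonneg cz.finite_R by (intro sum_pos2[of R x0]) auto
      then show ?thesis unfolding cz.abs_average_def using sum_m_cell_pos[OF R(1)] by simp
    qed
    define G where "G = (\<Sum>x\<in>R. norm (g x))"
    have gG: "norm (g x) \<le> G" for x
      using member_le_sum[of x R "\<lambda>x. norm (g x)"] cz.finite_R cz.g_support[of x] sum_nonneg[of R
          "\<lambda>x. norm (g x)"]
      by (cases "x \<in> R") (auto simp: G_def)
    \<comment> \<open>At \<open>2 powr N\<close> nothing stops and at \<open>2 powr - N\<close> all
      of \<open>R\<close> stops, so the layers between these levels suffice.\<close>
    obtain N :: nat where N: "G \<le> 2 powr real N" "2 powr - real N < cz.abs_average R"
    proof -
      obtain N1 where "G < 2 ^ N1" using real_arch_pow[of 2 G] by auto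
      obtain N2 where "(1 / 2) ^ N2 < cz.abs_average R" using real_arch_pow_inv[OF avR, of "1 / 2"]
          by auto
      have "(2::real) ^ N1 \<le> 2 ^ (max N1 N2)" "(1 / 2 :: real) ^ max N1 N2 \<le> (1 / 2) ^ N2"
        by (auto intro: power_increasing power_decreasing)
      then have "G \<le> 2 ^ max N1 N2" "(1 / 2) ^ max N1 N2 < cz.abs_average R"
        using \<open>G < 2 ^ N1\<close> \<open>(1 / 2) ^ N2 < cz.abs_average R\<close> by linarith+
      then show thesis using that[of "max N1 N2"] by (simp add: powr_realpow powr_minus
          power_one_over inverse_eq_divide)
    qed
    define I where "I = {- int N..<- int N + int (2 * N)}"
    define b where "b k = cz.layer (2 powr real_of_int k) (2 powr real_of_int (k + 1))" for k
    \<comment> \<open>The 3 comes from \<open>2 powr k + 2 powr (k + 1)\<close> in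
      \<open>layer_bound\<close>.\<close>
    define \<mu> where "\<mu> k = 3 * A * 2 powr real_of_int k * sum m (cz.level_set (2 powr real_of_int
        k))" for k
    have pw: "2 powr real_of_int k \<le> 2 powr real_of_int (k + 1)" for k by simp
    have b0: "b k x = 0" if "x \<notin> cz.level_set (2 powr real_of_int k)" for k x
      unfolding b_def using cz.layer_support[OF pw] that by blast
    have bb: "norm (b k x) \<le> 3 * A * 2 powr real_of_int k" for k x
    proof -
      have "norm (b k x) \<le> A * (2 powr real_of_int k + 2 powr real_of_int (k + 1))"
        unfolding b_def by (rule cz.layer_bound) auto
      then show ?thesis by (simp add: powr_add)
    qed
    have fin: "finite I" by (simp add: I_def)
    have supp: "b k x = 0" if "x \<notin> R" for k x
      using that b0[of x k] by (auto simp: cz.level_set_def)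
    have sum_b: "g x = (\<Sum>k\<in>I. b k x)" for x
    proof -
      have "(\<Sum>k\<in>I. b k x) = cz.good (2 powr real N) x - cz.good (2 powr - real N) x"
        unfolding I_def b_def cz.layer_def
        using sum_int_telescope[of "\<lambda>k. cz.good (2 powr real_of_int k) x" "- int N" "2 * N"] by simp
      also have "cz.good (2 powr real N) = g" by (rule cz.good_large) (rule order_trans[OF gG N(1)])
      also have "cz.good (2 powr - real N) x = 0" by (rule cz.good_small[OF N(2)])
      finally show ?thesis by simp
    qed
    have cb: "cell_bounded (b k) (\<mu> k)" for k
      unfolding cell_bounded_def
    proof (intro exI conjI ballI allI impI)
      let ?l = "2 powr real_of_int k"
      show "finite (cz.stops ?l)" "disjoint (cz.stops ?l)" by (rule cz.stops)+
      show "cz.stops ?l \<subseteq> cells" using cz.stops(2) cz.lamD(2) by blast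
      show "b k x = 0" if "x \<notin> \<Union> (cz.stops ?l)" for x using that b0 cz.stops(4) by simp
      show "0 < 3 * A * ?l" using A_ge_1 by simp
      show "norm (b k x) \<le> 3 * A * ?l" for x by (rule bb)
      show "(\<Sum>x\<in>Q. b k x * of_real (m x)) = 0" if "Q \<in> cz.stops ?l" for Q
        unfolding b_def by (rule cz.sum_layer_stop[OF that pw])
      show "3 * A * ?l * (\<Sum>Q\<in>cz.stops ?l. sum m Q) \<le> \<mu> k" by (simp add: \<mu>_def cz.sum_over_stops)
    qed
    have mu0: "0 \<le> \<mu> k" for k unfolding \<mu>_def using A_ge_1 m_nonneg by (simp add: sum_nonneg)
    define W where "W = (\<Sum>k\<in>I. 2 powr (real_of_int k * p) * sum m (cz.level_set (2 powr real_of_int k)))"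
    have W: "W \<le> c1" unfolding W_def c1_def by (rule sum_powr_level_sets_le[OF p(1) fin cz g(2)])
    have "(\<Sum>k\<in>I. 2 powr (real_of_int k * (p - 1)) * \<mu> k) = 3 * A * W"
      unfolding W_def \<mu>_def sum_distrib_left
      by (intro sum.cong refl) (simp add: powr_layer[of _ p, symmetric])
    also have "\<dots> \<le> 3 * A * c1" using W A_ge_1 by (intro mult_left_mono) auto
    finally have mu: "(\<Sum>k\<in>I. 2 powr (real_of_int k * (p - 1)) * \<mu> k) \<le> C" using C(2) by simp
    define h where "h x = (\<Sum>k\<in>I. 2 powr (real_of_int k * (s - 1)) * norm (b k x))" for x
    have h0: "0 \<le> h x" for x unfolding h_def by (intro sum_nonneg) auto
    let ?I = "\<lambda>x. {k \<in> I. x \<in> cz.level_set (2 powr real_of_int k)}"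
    have hx: "h x powr p1 \<le> (3 * A * c2) powr p1 * (\<Sum>k\<in>?I x. 2 powr (real_of_int k * p))" for x
    proof -
      have "h x = (\<Sum>k\<in>?I x. 2 powr (real_of_int k * (s - 1)) * norm (b k x))"
        unfolding h_def using fin b0 by (intro sum.mono_neutral_right) auto
      also have "\<dots> \<le> (\<Sum>k\<in>?I x. 2 powr (real_of_int k * (s - 1)) * (3 * A * 2 powr real_of_int k))"
        by (intro sum_mono mult_left_mono bb) auto
      also have "\<dots> = 3 * A * (\<Sum>k\<in>?I x. 2 powr (real_of_int k * s))"
        unfolding sum_distrib_left
        by (intro sum.cong refl) (simp add: powr_layer[of _ s, symmetric])
      finally have hs: "h x \<le> 3 * A * (\<Sum>k\<in>?I x. 2 powr (real_of_int k * s))" .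
      show ?thesis
      proof (cases "?I x = {}")
        case True
        then have "h x = 0" using hs h0[of x] by (simp only: sum.empty)
        then show ?thesis using sum_nonneg[of "?I x" "\<lambda>k. 2 powr (real_of_int k * p)"] by simp
      next
        case False
        have finI: "finite (?I x)" using fin by simp
        \<comment> \<open>The geometric sum is reduced to its top level before the power
          \<open>p1\<close> is taken; afterwards the single term \<open>2 powr (k0 * p)\<close> is
          estimated by the sum over all levels at the vertex, which integrates to
          \<open>W\<close>.\<close>
        define k0 where "k0 = Max (?I x)"
        have k0: "k0 \<in> ?I x" "\<And>k. k \<in> ?I x \<Longrightarrow> k \<le> k0"
          unfolding k0_def using Max_in[OF finI False] Max_ge[OF finI] by auto
        have "(\<Sum>k\<in>?I x. 2 powr (real_of_int k * s)) \<le> (2 powr real_of_int k0) powr s / (1 - 2 powr - s)"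
          using k0(2) finI s(1) by (intro sum_powr_geometric_le) auto
        also have "\<dots> = c2 * 2 powr (real_of_int k0 * s)" by (simp add: c2_def powr_powr)
        finally have "h x \<le> 3 * A * (c2 * 2 powr (real_of_int k0 * s))"
          using hs A_ge_1 by (meson mult_left_mono order_trans zero_le_mult_iff zero_le_numeral
              zero_le_one)
        then have "h x powr p1 \<le> (3 * A * c2 * 2 powr (real_of_int k0 * s)) powr p1"
          using h0 p by (intro powr_mono2) (auto simp: mult.assoc)
        also have "\<dots> = (3 * A * c2) powr p1 * 2 powr (real_of_int k0 * p)"
          using A_ge_1 c s(2) by (subst powr_mult) (auto simp: powr_powr mult.assoc)
        also have "\<dots> \<le> (3 * A * c2) powr p1 * (\<Sum>k\<in>?I x. 2 powr (real_of_int k * p))"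
          using k0(1) finI by (intro mult_left_mono member_le_sum[of k0 _ "\<lambda>k. 2 powr (real_of_int k
              * p)"]) auto
        finally show ?thesis .
      qed
    qed
    have "(\<Sum>x\<in>R. h x powr p1 * m x) \<le> (\<Sum>x\<in>R. (3 * A * c2) powr p1 * (\<Sum>k\<in>?I x. 2 powr (real_of_int k
        * p)) * m x)"
      by (intro sum_mono mult_right_mono hx m_nonneg)
    also have "\<dots> = (3 * A * c2) powr p1 * (\<Sum>x\<in>R. \<Sum>k\<in>I. if x \<in> cz.level_set (2 powr real_of_int k)
        then 2 powr (real_of_int k * p) * m x else 0)"
      unfolding sum.inter_filter[OF fin] sum_distrib_left sum_distrib_right
      by (intro sum.cong refl) simp
    also have "(\<Sum>x\<in>R. \<Sum>k\<in>I. if x \<in> cz.level_set (2 powr real_of_int k)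
        then 2 powr (real_of_int k * p) * m x else 0) = W"
    proof -
      have "{x \<in> R. x \<in> cz.level_set (2 powr real_of_int k)} = cz.level_set (2 powr real_of_int k)" for k
        by (auto simp: cz.level_set_def)
      then show ?thesis unfolding W_def
        by (subst sum.swap) (simp add: sum.inter_filter[OF cz.finite_R, symmetric] sum_distrib_left)
    qed
    also have "(3 * A * c2) powr p1 * W \<le> (3 * A * c2) powr p1 * c1" using W by (intro
        mult_left_mono) auto
    also have "\<dots> = (3 * A * c2 * c1 powr (1 / p1)) powr p1"
      using A_ge_1 c p by (simp add: powr_mult powr_powr)
    also have "\<dots> \<le> C powr p1" using C(3) A_ge_1 c p by (intro powr_mono2) auto
    finally have "(\<Sum>x\<in>R. norm (complex_of_real (h x)) powr p1 * m x) \<le> C powr p1" using h0 by simp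
    then have "Lp_sums_le p1 (\<lambda>x. of_real (h x)) (C powr p1)"
      using supp p by (intro Lp_sums_le_finite_support[OF cz.finite_R]) (auto simp: h_def)
    then have "layered p p1 C g R I b \<mu>"
      unfolding layered_def using cz.finite_R fin supp sum_b cb mu0 mu by (simp add: h_def s_def)
    then show ?thesis by blast
  qed
  then show ?thesis using C(1) by blast
qed

end

section \<open>Analytic families and the Calderon class\<close>

context flow_space
begin

text \<open>Mean zero is obtained by subtracting a constant spread over a set of huge mass. For
  \<open>p > 1\<close> the norm of that correction tends to zero as the mass grows.\<close>

lemma Lp_density:
  assumes p: "1 < p" and f: "Lp_sums_le p f B" and d: "0 < d"
  shows "\<exists>h. mean_zero h \<and> Lp_sums_le p (\<lambda>x. f x - h x) d"
proof -
  define e where "e = d / (2 * 2 powr p)"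
  have e: "0 < e" "2 powr p * (e + e) = d" using d by (auto simp: e_def field_simps)
  let ?s = "\<lambda>K. \<Sum>x\<in>K. norm (f x) powr p * m x"
  define S where "S = (SUP K\<in>Collect finite. ?s K)"
  have bdd: "bdd_above (?s ` Collect finite)"
    using Lp_sums_leD[OF f] by (intro bdd_aboveI2[of _ _ B]) auto
  have "S - e < S" using e by simp
  then obtain K where K: "finite K" "S - e < ?s K"
    unfolding S_def using less_cSUP_iff[OF _ bdd, of "S - e"] by (auto simp: S_def)
  define h0 where "h0 x = (if x \<in> K then f x else 0)" for x
  have tail: "Lp_sums_le p (\<lambda>x. f x - h0 x) e"
    unfolding Lp_sums_le_def
  proof (intro allI impI)
    fix L :: "'v set" assume L: "finite L"
    have "?s K + ?s (L - K) = ?s (K \<union> (L - K))"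
      using K L by (intro sum.union_disjoint[symmetric]) auto
    also have "\<dots> \<le> S" unfolding S_def using K L by (intro cSUP_upper bdd) auto
    finally have "?s (L - K) \<le> e" using K(2) by linarith
    moreover have "(\<Sum>x\<in>L. norm (f x - h0 x) powr p * m x) = ?s (L - K)"
      using L by (intro sum.mono_neutral_cong_right) (auto simp: h0_def)
    ultimately show "(\<Sum>x\<in>L. norm (f x - h0 x) powr p * m x) \<le> e" by simp
  qed
  define \<sigma> where "\<sigma> = (\<Sum>x\<in>K. f x * of_real (m x))"
  \<comment> \<open>The correction contributes
    \<open>norm \<sigma> powr p / sum m R powr (p - 1)\<close>, which is at most \<open>e\<close>
    once the mass of \<open>R\<close> exceeds \<open>t\<close>.\<close>
  define t where "t = (norm \<sigma> powr p / e) powr (1 / (p - 1)) + 1"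
  obtain R where R: "R \<in> cells" "K \<subseteq> R" "t \<le> sum m R" using exhaustion[OF K(1), of t] by blast
  note finR = conjunct1[OF cells_finite[OF R(1)]]
  have mR: "0 < sum m R" by (rule sum_m_cell_pos[OF R(1)])
  define h1 where "h1 x = (if x \<in> R then \<sigma> / of_real (sum m R) else 0)" for x
  define h where "h x = h0 x - h1 x" for x
  have "(\<Sum>x\<in>R. h x * of_real (m x)) = (\<Sum>x\<in>R. h0 x * of_real (m x)) - (\<Sum>x\<in>R. h1 x * of_real (m x))"
    by (simp add: h_def left_diff_distrib sum_subtractf)
  also have "(\<Sum>x\<in>R. h0 x * of_real (m x)) = \<sigma>"
    unfolding \<sigma>_def using R(2) finR by (intro sum.mono_neutral_cong_right) (auto simp: h0_def)
  also have "(\<Sum>x\<in>R. h1 x * of_real (m x)) = \<sigma> / of_real (sum m R) * of_real (sum m R)"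
    unfolding of_real_sum sum_distrib_left by (intro sum.cong) (auto simp: h1_def)
  also have "\<dots> = \<sigma>" using mR by (simp del: of_real_sum)
  finally have "mean_zero h"
    using finR R(2) by (subst mean_zero_iff[of R]) (auto simp: h_def h0_def h1_def)
  moreover have "Lp_sums_le p h1 e"
  proof (rule Lp_sums_le_finite_support[OF finR])
    have "norm \<sigma> powr p / e = ((norm \<sigma> powr p / e) powr (1 / (p - 1))) powr (p - 1)"
      using p e by (simp add: powr_powr)
    also have "\<dots> \<le> sum m R powr (p - 1)"
      using p R(3) by (intro powr_mono2) (auto simp: t_def)
    finally have *: "norm \<sigma> powr p \<le> e * sum m R powr (p - 1)" using e by (simp add: field_simps)
    have "(\<Sum>x\<in>R. norm (h1 x) powr p * m x) = (norm \<sigma> / sum m R) powr p * sum m R"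
      unfolding sum_distrib_left using mR
      by (intro sum.cong) (auto simp: h1_def norm_divide simp del: of_real_sum)
    also have "\<dots> = norm \<sigma> powr p / sum m R powr (p - 1)"
      using mR by (simp add: powr_divide powr_diff)
    also have "\<dots> \<le> e" using * mR by (simp add: field_simps)
    finally show "(\<Sum>x\<in>R. norm (h1 x) powr p * m x) \<le> e" .
  qed (use p in \<open>auto simp: h1_def\<close>)
  then have "Lp_sums_le p (\<lambda>x. f x - h x) (2 powr p * (e + e))"
  proof (rule Lp_sums_le_add[OF tail])
    show "norm (f x - h x) \<le> norm (f x - h0 x) + norm (h1 x)" for x
      using norm_triangle_ineq[of "f x - h0 x" "h1 x"] by (simp add: h_def algebra_simps)
  qed (use p in simp)
  ultimately show ?thesis using e(2) by auto
qed

text \<open>Normalised differences of a sequence of approximations that converges geometrically to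
  \<open>f\<close>. Each term is finitely supported and of mean zero, as the layer decomposition
  requires.\<close>

lemma Lp_split:
  assumes p: "1 < p" and M: "0 < M" and f: "Lp_sums_le p f (M powr p)"
  shows "\<exists>g. (\<forall>n. mean_zero (g n) \<and> Lp_sums_le p (g n) 1) \<and>
             (\<forall>x. (\<lambda>n. (1 / 2) ^ n * g n x) sums (f x / of_real (4 * M)))"
proof -
  define \<delta> where "\<delta> n = (M * (1 / 2) ^ n) powr p" for n
  have "\<exists>h. mean_zero h \<and> Lp_sums_le p (\<lambda>x. f x - h x) (\<delta> n)" for n
    using M by (intro Lp_density[OF p f]) (simp add: \<delta>_def)
  then obtain h' where h': "\<And>n. mean_zero (h' n)" "\<And>n. Lp_sums_le p (\<lambda>x. f x - h' n x) (\<delta> n)"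
    by metis
  \<comment> \<open>Starting from 0 makes the differences telescope to \<open>f\<close> itself; the
    error bound at \<open>n = 0\<close> is just the hypothesis on \<open>f\<close>.\<close>
  define h where "h n = (if n = 0 then (\<lambda>_. 0) else h' n)" for n
  have h: "mean_zero (h n)" "Lp_sums_le p (\<lambda>x. f x - h n x) (\<delta> n)" for n
    using h' f by (auto simp: h_def mean_zero_def \<delta>_def)
  \<comment> \<open>One factor \<open>2 powr p\<close> is the crude triangle inequality, another
    absorbs the two error terms; together they give the 4 in the normalisation.\<close>
  have \<delta>: "2 powr p * (\<delta> n + \<delta> (Suc n)) \<le> (4 * M * (1 / 2) ^ n) powr p" for n
  proof -
    have "\<delta> (Suc n) \<le> \<delta> n" unfolding \<delta>_def using p M by (intro powr_mono2) auto
    then have "2 powr p * (\<delta> n + \<delta> (Suc n)) \<le> 2 powr p * (2 powr p * \<delta> n)"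
      using p powr_mono[of 1 p 2] by (intro mult_left_mono) (auto simp: \<delta>_def intro: order_trans[OF
          _ mult_right_mono[of 2 "2 powr p"]])
    also have "\<dots> = (4 * M * (1 / 2) ^ n) powr p"
      unfolding \<delta>_def mult.assoc[symmetric] powr_mult[symmetric] using M by (simp add:
          powr_mult[symmetric] mult.assoc)
    finally show ?thesis .
  qed
  define g where "g n x = (h (Suc n) x - h n x) * of_real (inverse (4 * M * (1 / 2) ^ n))" for n x
  have "mean_zero (g n)" for n
  proof -
    define w where "w = complex_of_real (inverse (4 * M * (1 / 2) ^ n))"
    have "g n = (\<lambda>x. w * h (Suc n) x + (- w) * h n x)"
      unfolding g_def w_def[symmetric] by (rule ext) (simp add: algebra_simps)
    then show ?thesis using mean_zero_lincomb[OF h(1) h(1)] by metis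
  qed
  moreover have "Lp_sums_le p (g n) 1" for n
  proof -
    let ?c = "4 * M * (1 / 2) ^ n"
    have c: "0 < ?c" using M by simp
    have "norm (h (Suc n) x - h n x) \<le> norm (f x - h n x) + norm (f x - h (Suc n) x)" for x
      using norm_triangle_ineq4[of "f x - h n x" "f x - h (Suc n) x"] by simp
    then have "Lp_sums_le p (\<lambda>x. h (Suc n) x - h n x) (2 powr p * (\<delta> n + \<delta> (Suc n)))"
      using p by (intro Lp_sums_le_add[OF h(2) h(2)]) auto
    then have "Lp_sums_le p (\<lambda>x. h (Suc n) x - h n x) (?c powr p)"
      using \<delta> by (rule Lp_sums_le_mono)
    then have "Lp_sums_le p (g n) (inverse ?c powr p * ?c powr p)"
    proof (rule Lp_sums_le_scale)
      have c': "0 < inverse ?c" using c by (rule positive_imp_inverse_positive)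
      then show "0 \<le> inverse ?c" by (rule less_imp_le)
      show "norm (g n x) \<le> inverse ?c * norm (h (Suc n) x - h n x)" for x
        unfolding g_def norm_mult norm_of_real abs_of_pos[OF c'] by (simp only: mult.commute order_refl)
    qed (use p in simp)
    moreover have "inverse ?c powr p * ?c powr p = (inverse ?c * ?c) powr p"
      by (rule powr_mult[symmetric])
    moreover have "inverse ?c * ?c = 1" using c by (intro left_inverse) linarith
    ultimately show ?thesis by (simp only: powr_one_eq_one)
  qed
  moreover have "(\<lambda>n. (1 / 2) ^ n * g n x) sums (f x / of_real (4 * M))" for x
  proof -
    have "norm (f x - h n x) \<le> M * (1 / 2) ^ n * m x powr (- (1 / p))" for n
      using p M by (intro Lp_point_bound h(2)[unfolded \<delta>_def]) auto
    moreover have "(\<lambda>n. M * (1 / 2) ^ n * m x powr (- (1 / p))) \<longlonglongrightarrow> M * 0 * m x powr (- (1 / p))"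
      by (intro tendsto_intros LIMSEQ_power_zero) auto
    ultimately have "(\<lambda>n. f x - h n x) \<longlonglongrightarrow> 0"
      by (intro Lim_null_comparison[of "\<lambda>n. f x - h n x"] always_eventually) auto
    then have "(\<lambda>n. f x - (f x - h n x)) \<longlonglongrightarrow> f x - 0" by (intro tendsto_diff tendsto_const)
    then have "(\<lambda>n. h (Suc n) x - h n x) sums (f x - h 0 x)" by (intro telescope_sums) simp
    then have "(\<lambda>n. (h (Suc n) x - h n x) / of_real (4 * M)) sums ((f x - h 0 x) / of_real (4 * M))"
      by (rule sums_divide)
    moreover have "(1 / 2) ^ n * g n x = (h (Suc n) x - h n x) / of_real (4 * M)" for n
      unfolding g_def using M by (simp add: field_simps)
    ultimately show ?thesis by (simp add: h_def)
  qed
  ultimately show ?thesis by blast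
qed

end

section \<open>The strip, norms defined by infima, and the Calderon class\<close>

abbreviation "strip \<equiv> {z :: complex. 0 \<le> Re z \<and> Re z \<le> 1}"
abbreviation "open_strip \<equiv> {z :: complex. 0 < Re z \<and> Re z < 1}"

lemma open_open_strip: "open open_strip"
proof -
  have "open_strip = {z. 0 < Re z} \<inter> {z. Re z < 1}" by auto
  then show ?thesis by (simp add: open_Int open_halfspace_Re_gt open_halfspace_Re_lt)
qed

text \<open>Spaces are records without axioms. Nonnegativity is what makes the infima in sum,
  quotient and interpolation norms infima of sets bounded below.\<close>

definition nrm_nonneg :: "'x nspace \<Rightarrow> bool" where
  "nrm_nonneg X \<longleftrightarrow> (\<forall>u\<in>car X. 0 \<le> nrm X u)"

lemma sum_space_I:
  assumes "nrm_nonneg A0" "nrm_nonneg A1" "a \<in> car A0" "b \<in> car A1"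
  shows "a + b \<in> car (sum_space A0 A1)" "nrm (sum_space A0 A1) (a + b) \<le> nrm A0 a + nrm A1 b"
proof -
  show "a + b \<in> car (sum_space A0 A1)" using assms unfolding sum_space_def by auto
  have "bdd_below {nrm A0 a' + nrm A1 b' |a' b'. a' \<in> car A0 \<and> b' \<in> car A1 \<and> a + b = a' + b'}"
    using assms(1,2) unfolding nrm_nonneg_def bdd_below_def by (force intro: exI[of _ 0])
  then show "nrm (sum_space A0 A1) (a + b) \<le> nrm A0 a + nrm A1 b"
    unfolding sum_space_def using assms(3,4) by (auto intro!: cInf_lower)
qed

lemma le_sum_space_nrm:
  assumes "u \<in> car (sum_space A0 A1)" "0 \<le> K"
    "\<And>a b. a \<in> car A0 \<Longrightarrow> b \<in> car A1 \<Longrightarrow> u = a + b \<Longrightarrow> B \<le> K * (nrm A0 a + nrm A1 b)"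
  shows "B \<le> K * nrm (sum_space A0 A1) u"
proof -
  let ?S = "{nrm A0 a + nrm A1 b |a b. a \<in> car A0 \<and> b \<in> car A1 \<and> u = a + b}"
  have ne: "?S \<noteq> {}" using assms(1) unfolding sum_space_def by auto
  show ?thesis
  proof (cases "K = 0")
    case True
    then show ?thesis using ne assms(3) by auto
  next
    case False
    then have K: "0 < K" using assms(2) by simp
    have "B / K \<le> Inf ?S"
      using assms(3) K by (intro cInf_greatest[OF ne]) (auto simp: field_simps)
    then show ?thesis using K unfolding sum_space_def by (simp add: field_simps)
  qed
qed

lemma calderon_norm_bounds:
  assumes "F \<in> calderon_class sc A0 A1" "nrm_nonneg A0"
  shows "nrm A0 (F (Complex 0 t)) \<le> calderon_norm A0 A1 F"
    "nrm A1 (F (Complex 1 t)) \<le> calderon_norm A0 A1 F" "0 \<le> calderon_norm A0 A1 F"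
proof -
  obtain K0 K1 where "\<And>t. nrm A0 (F (Complex 0 t)) \<le> K0" "\<And>t. nrm A1 (F (Complex 1 t)) \<le> K1"
    using assms(1) unfolding calderon_class_def by blast
  then have bdd: "bdd_above (range (\<lambda>t. max (nrm A0 (F (Complex 0 t))) (nrm A1 (F (Complex 1 t)))))"
    by (intro bdd_aboveI2[of _ _ "max K0 K1"] max.mono)
  have le: "max (nrm A0 (F (Complex 0 t))) (nrm A1 (F (Complex 1 t))) \<le> calderon_norm A0 A1 F" for t
    unfolding calderon_norm_def by (rule cSUP_upper[OF _ bdd]) simp
  then show "nrm A0 (F (Complex 0 t)) \<le> calderon_norm A0 A1 F"
    "nrm A1 (F (Complex 1 t)) \<le> calderon_norm A0 A1 F" by (simp_all add: max.bounded_iff)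
  have "0 \<le> nrm A0 (F (Complex 0 0))"
    using assms unfolding calderon_class_def nrm_nonneg_def by blast
  then show "0 \<le> calderon_norm A0 A1 F" using le[of 0] by simp
qed

lemma interp_nrm_le:
  assumes "F \<in> calderon_class sc A0 A1" "nrm_nonneg A0" "F (of_real \<theta>) = f" "calderon_norm A0 A1 F \<le> B"
  shows "f \<in> car (interp sc A0 A1 \<theta>)" "nrm (interp sc A0 A1 \<theta>) f \<le> B"
proof -
  show "f \<in> car (interp sc A0 A1 \<theta>)" using assms unfolding interp_def by auto
  have "bdd_below {calderon_norm A0 A1 F |F. F \<in> calderon_class sc A0 A1 \<and> F (of_real \<theta>) = f}"
    using calderon_norm_bounds(3)[OF _ assms(2)] unfolding bdd_below_def by blast
  then have "Inf {calderon_norm A0 A1 F |F. F \<in> calderon_class sc A0 A1 \<and> F (of_real \<theta>) = f} \<le>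
      calderon_norm A0 A1 F"
    using assms by (intro cInf_lower) auto
  then show "nrm (interp sc A0 A1 \<theta>) f \<le> B" using assms(4) unfolding interp_def by simp
qed

text \<open>Both inclusions are requested with slack, a strict \<open>M\<close> and a positive
  \<open>B\<close>, because none of the infima need be attained; the slack is removed here once for
  both parts.\<close>

lemma same_space_interp_I:
  assumes nn: "nrm_nonneg A0"
    and C: "0 < C"
    and up: "\<And>u M. u \<in> car X \<Longrightarrow> nrm X u < M \<Longrightarrow> 0 < M \<Longrightarrow>
        u \<in> car (interp sc A0 A1 \<theta>) \<and> nrm (interp sc A0 A1 \<theta>) u \<le> C * M"
    and nnX: "nrm_nonneg X"
    and low: "\<And>F B. F \<in> calderon_class sc A0 A1 \<Longrightarrow> 0 < B \<Longrightarrow> calderon_norm A0 A1 F \<le> B \<Longrightarrow>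
        F (of_real \<theta>) \<in> car X \<and> nrm X (F (of_real \<theta>)) \<le> C * B"
  shows "same_space (interp sc A0 A1 \<theta>) X"
proof -
  let ?I = "interp sc A0 A1 \<theta>"
  have "car ?I \<subseteq> car X"
  proof
    fix u assume "u \<in> car ?I"
    then obtain F where F: "F \<in> calderon_class sc A0 A1" "u = F (of_real \<theta>)" unfolding interp_def by auto
    then show "u \<in> car X" using low[OF F(1), of "calderon_norm A0 A1 F + 1"]
        calderon_norm_bounds(3)[OF F(1) nn] by simp
  qed
  moreover have "car X \<subseteq> car ?I"
  proof
    fix u assume u: "u \<in> car X"
    then have "0 \<le> nrm X u" using nnX by (simp add: nrm_nonneg_def)
    then show "u \<in> car ?I" using up[OF u, of "nrm X u + 1"] by simp
  qed
  ultimately have car: "car ?I = car X" by blast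
  have "nrm ?I u \<le> C * nrm X u" if u: "u \<in> car X" for u
  proof (rule field_le_epsilon)
    fix e :: real assume e: "0 < e"
    have "0 \<le> nrm X u" using nnX u by (simp add: nrm_nonneg_def)
    then have "nrm ?I u \<le> C * (nrm X u + e / C)"
      using up[OF u, of "nrm X u + e / C"] e C by (simp add: add_nonneg_pos)
    then show "nrm ?I u \<le> C * nrm X u + e" using C by (simp add: distrib_left)
  qed
  moreover have "inverse C * nrm X u \<le> nrm ?I u" if u: "u \<in> car X" for u
  proof -
    let ?S = "{calderon_norm A0 A1 F |F. F \<in> calderon_class sc A0 A1 \<and> F (of_real \<theta>) = u}"
    have ne: "?S \<noteq> {}"
    proof -
      have "u \<in> car ?I" using u car by simp
      then show ?thesis unfolding interp_def by auto
    qed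
    have "inverse C * nrm X u \<le> calderon_norm A0 A1 F"
      if F: "F \<in> calderon_class sc A0 A1" "F (of_real \<theta>) = u" for F
    proof (rule field_le_epsilon)
      fix e :: real assume e: "0 < e"
      have "nrm X u \<le> C * (calderon_norm A0 A1 F + e)"
        using low[OF F(1), of "calderon_norm A0 A1 F + e"] F e calderon_norm_bounds(3)[OF F(1) nn]
            by simp
      then have "nrm X u / C \<le> calderon_norm A0 A1 F + e" using C by (simp add: pos_divide_le_eq
          mult.commute)
      then show "inverse C * nrm X u \<le> calderon_norm A0 A1 F + e" by (simp add: divide_inverse
          mult.commute)
    qed
    then have "inverse C * nrm X u \<le> Inf ?S" by (intro cInf_greatest[OF ne]) auto
    then show ?thesis unfolding interp_def by simp
  qed
  ultimately show ?thesis unfolding same_space_def using car C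
    by (intro conjI exI[of _ "inverse C"] exI[of _ C]) auto
qed

text \<open>Only scalar functions \<open>l (F z)\<close> are known to be analytic. A test family
  that moves with \<open>z\<close> is admissible if it is a finite combination of fixed functionals
  with entire coefficients bounded on the strip.\<close>

lemma calderon_class_three_lines:
  assumes F: "F \<in> calderon_class sc A0 A1" and J: "finite J"
    and l: "\<And>j. j \<in> J \<Longrightarrow> in_dual sc (sum_space A0 A1) (l j)"
    and phi: "\<And>j. j \<in> J \<Longrightarrow> \<phi> j holomorphic_on UNIV" "\<And>j. j \<in> J \<Longrightarrow> bounded (\<phi> j ` strip)"
    and left: "\<And>t. norm (\<Sum>j\<in>J. \<phi> j (Complex 0 t) * l j (F (Complex 0 t))) \<le> B"
    and right: "\<And>t. norm (\<Sum>j\<in>J. \<phi> j (Complex 1 t) * l j (F (Complex 1 t))) \<le> B"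
    and z: "z \<in> strip"
  shows "norm (\<Sum>j\<in>J. \<phi> j z * l j (F z)) \<le> B"
proof (rule three_lines_max[where f = "\<lambda>z. \<Sum>j\<in>J. \<phi> j z * l j (F z)"])
  have lF: "continuous_on strip (\<lambda>z. l j (F z))" "bounded ((\<lambda>z. l j (F z)) ` strip)"
    "(\<lambda>z. l j (F z)) holomorphic_on open_strip" if "j \<in> J" for j
    using F l[OF that] analytic_imp_holomorphic unfolding calderon_class_def by blast+
  have cphi: "continuous_on strip (\<phi> j)" if "j \<in> J" for j
    using phi(1)[OF that] holomorphic_on_imp_continuous_on continuous_on_subset by blast
  show "continuous_on strip (\<lambda>z. \<Sum>j\<in>J. \<phi> j z * l j (F z))"
    by (intro continuous_on_sum continuous_on_mult lF cphi)
  show "(\<lambda>z. \<Sum>j\<in>J. \<phi> j z * l j (F z)) holomorphic_on open_strip"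
    using lF(3) phi(1) by (intro holomorphic_intros) (auto intro: holomorphic_on_subset)
  have "\<exists>K. \<forall>z\<in>strip. norm (\<phi> j z * l j (F z)) \<le> K" if j: "j \<in> J" for j
  proof -
    obtain a b where ab: "\<forall>z\<in>strip. norm (\<phi> j z) \<le> a" "\<forall>z\<in>strip. norm (l j (F z)) \<le> b"
      using phi(2)[OF j] lF(2)[OF j] unfolding bounded_iff by blast
    have "norm (\<phi> j z * l j (F z)) \<le> a * b" if "z \<in> strip" for z
      unfolding norm_mult using ab that by (intro mult_mono') auto
    then show ?thesis by blast
  qed
  then obtain K where K: "\<And>j z. j \<in> J \<Longrightarrow> z \<in> strip \<Longrightarrow> norm (\<phi> j z * l j (F z)) \<le> K j" by metis
  then have "norm (\<Sum>j\<in>J. \<phi> j z * l j (F z)) \<le> (\<Sum>j\<in>J. K j)" if "z \<in> strip" for z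
    using that by (intro sum_norm_le)
  then show "bounded ((\<lambda>z. \<Sum>j\<in>J. \<phi> j z * l j (F z)) ` strip)" unfolding bounded_iff by blast
qed (use left right z in auto)

text \<open>The family \<open>\<bar>f\<bar>\<^sup>z\<close> of a function of infinite support need not be weakly continuous up to the
  boundary of the strip, as the dual of \<open>L\<close> with exponent \<open>\<infinity>\<close> contains functionals that vanish on
      finitely
  supported functions. Series with weights \<open>(1 / 2)\<^sup>n\<close> of families of finite support avoid this.\<close>

locale sigma_couple =
  fixes sc :: "complex \<Rightarrow> 'x \<Rightarrow> 'x::ab_group_add" and A0 A1 :: "'x nspace"
    and \<pi> :: "('v \<Rightarrow> complex) \<Rightarrow> 'x" and U0 U1 :: "('v \<Rightarrow> complex) set" and C :: real
  assumes nonneg: "nrm_nonneg A0" "nrm_nonneg A1"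
    and pi_add: "\<pi> (\<lambda>x. f x + g x) = \<pi> f + \<pi> g"
    and pi_scale: "\<pi> (\<lambda>x. c * f x) = sc c (\<pi> f)"
    and finite_support: "finite {x. h x \<noteq> 0} \<Longrightarrow> \<pi> h \<in> car (sum_space A0 A1)"
    and U0_summable: "(\<And>n. u n \<in> U0) \<Longrightarrow> summable (\<lambda>n. (1 / 2) ^ n * u n x)"
    and U1_summable: "(\<And>n. u n \<in> U1) \<Longrightarrow> summable (\<lambda>n. (1 / 2) ^ n * u n x)"
    and U0_bound: "(\<And>n. u n \<in> U0) \<Longrightarrow> 0 \<le> r \<Longrightarrow>
        \<pi> (\<lambda>x. of_real r * (\<Sum>n. (1 / 2) ^ n * u n x)) \<in> car A0 \<and>
        nrm A0 (\<pi> (\<lambda>x. of_real r * (\<Sum>n. (1 / 2) ^ n * u n x))) \<le> C * r"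
    and U1_bound: "(\<And>n. u n \<in> U1) \<Longrightarrow> 0 \<le> r \<Longrightarrow>
        \<pi> (\<lambda>x. of_real r * (\<Sum>n. (1 / 2) ^ n * u n x)) \<in> car A1 \<and>
        nrm A1 (\<pi> (\<lambda>x. of_real r * (\<Sum>n. (1 / 2) ^ n * u n x))) \<le> C * r"
begin

text \<open>The splitting only bounds the value at \<open>z\<close> in the sum space, so it may
  depend on \<open>z\<close> in any manner, even discontinuously. On each edge one summand
  disappears, which places the value in the space required there.\<close>

definition analytic_family :: "(complex \<Rightarrow> 'v \<Rightarrow> complex) \<Rightarrow> bool" where
  "analytic_family H \<longleftrightarrow>
     (\<exists>K. finite K \<and> (\<forall>z x. x \<notin> K \<longrightarrow> H z x = 0)) \<and>
     (\<forall>x. (\<lambda>z. H z x) holomorphic_on UNIV) \<and>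
     (\<exists>u v. \<forall>z\<in>strip. u z \<in> U0 \<and> v z \<in> U1 \<and> (\<forall>x. H z x = u z x + v z x)
         \<and> (Re z = 0 \<longrightarrow> v z = (\<lambda>_. 0)) \<and> (Re z = 1 \<longrightarrow> u z = (\<lambda>_. 0)))"

lemma analytic_familyI:
  assumes "finite K" "\<And>z x. x \<notin> K \<Longrightarrow> H z x = 0" "\<And>x. (\<lambda>z. H z x) holomorphic_on UNIV"
    "\<And>z. z \<in> strip \<Longrightarrow> u z \<in> U0" "\<And>z. z \<in> strip \<Longrightarrow> v z \<in> U1"
    "\<And>z x. H z x = u z x + v z x"
    "\<And>z. Re z = 0 \<Longrightarrow> v z = (\<lambda>_. 0)" "\<And>z. Re z = 1 \<Longrightarrow> u z = (\<lambda>_. 0)"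
  shows "analytic_family H"
  unfolding analytic_family_def
  by (intro conjI exI[of _ K] exI[of _ u] exI[of _ v] ballI allI impI assms)

text \<open>On functions supported in a finite set every functional is a finite combination of point
  values. Weak analyticity of such a family is thus analyticity at each vertex.\<close>

lemma dual_finite_sum:
  assumes l: "in_dual sc (sum_space A0 A1) l" and K: "finite K" "\<And>x. x \<notin> K \<Longrightarrow> f x = 0"
  shows "l (\<pi> f) = (\<Sum>x\<in>K. f x * l (\<pi> (\<lambda>y. if y = x then 1 else 0)))"
  using K
proof (induction K arbitrary: f)
  case empty
  have "\<pi> (\<lambda>_. 0) \<in> car (sum_space A0 A1)" by (rule finite_support) simp
  then have "l (\<pi> (\<lambda>x. 0 * (0::complex))) = 0 * l (\<pi> (\<lambda>_. 0))"
    using l unfolding in_dual_def pi_scale by blast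
  moreover have "f = (\<lambda>_. 0)" using empty by auto
  ultimately show ?case by simp
next
  case (insert a K)
  let ?d = "\<lambda>y. if y = a then 1 else (0::complex)"
  define g where "g x = (if x = a then 0 else f x)" for x
  have f: "f = (\<lambda>x. g x + f a * ?d x)" by (auto simp: g_def)
  have sup: "finite {x. g x \<noteq> 0}" by (rule finite_subset[OF _ insert(1)]) (use insert in \<open>auto simp:
      g_def\<close>)
  have mem: "\<pi> g \<in> car (sum_space A0 A1)" "\<pi> ?d \<in> car (sum_space A0 A1)"
    "\<pi> (\<lambda>x. f a * ?d x) \<in> car (sum_space A0 A1)" using sup by (auto intro!: finite_support)
  have "l (\<pi> f) = l (\<pi> g + \<pi> (\<lambda>x. f a * ?d x))" by (subst f) (simp only: pi_add)
  also have "\<dots> = l (\<pi> g) + l (\<pi> (\<lambda>x. f a * ?d x))" using l mem unfolding in_dual_def by blast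
  also have "l (\<pi> (\<lambda>x. f a * ?d x)) = f a * l (\<pi> ?d)"
    unfolding pi_scale using l mem(2) unfolding in_dual_def by blast
  also have "l (\<pi> g) = (\<Sum>x\<in>K. g x * l (\<pi> (\<lambda>y. if y = x then 1 else 0)))"
    using insert by (intro insert.IH) (auto simp: g_def)
  also have "\<dots> = (\<Sum>x\<in>K. f x * l (\<pi> (\<lambda>y. if y = x then 1 else 0)))"
    using insert(2) by (intro sum.cong) (auto simp: g_def)
  finally show ?case using insert(1,2) by (simp add: add.commute)
qed

text \<open>The partial sums have finite support and are weakly entire. The tails are small in the
  sum norm uniformly on the closed strip, so every functional of the series is a uniform limit,
  which keeps continuity up to the boundary and analyticity inside.\<close>

proposition interp_upper:
  assumes H: "\<And>n. analytic_family (H n)" and M: "0 \<le> M"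
    and f: "\<And>x. (\<lambda>n. (1 / 2) ^ n * H n (of_real \<theta>) x) sums f x" and \<theta>: "0 < \<theta>" "\<theta> < 1"
  shows "\<pi> (\<lambda>x. of_real M * f x) \<in> car (interp sc A0 A1 \<theta>)
      \<and> nrm (interp sc A0 A1 \<theta>) (\<pi> (\<lambda>x. of_real M * f x)) \<le> C * M"
proof -
  have "\<forall>n. \<exists>K. finite K \<and> (\<forall>z x. x \<notin> K \<longrightarrow> H n z x = 0)"
    using H unfolding analytic_family_def by blast
  then obtain K where K: "\<And>n. finite (K n)" "\<And>n z x. x \<notin> K n \<Longrightarrow> H n z x = 0" by metis
  have "\<forall>n. \<exists>u v. \<forall>z\<in>strip. u z \<in> U0 \<and> v z \<in> U1 \<and> (\<forall>x. H n z x = u z x + v z x)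
      \<and> (Re z = 0 \<longrightarrow> v z = (\<lambda>_. 0)) \<and> (Re z = 1 \<longrightarrow> u z = (\<lambda>_. 0))"
    using H unfolding analytic_family_def by (intro allI) (elim meta_allE conjE)
  from choice[OF this] obtain u where "\<forall>n. \<exists>v. \<forall>z\<in>strip. u n z \<in> U0 \<and> v z \<in> U1
      \<and> (\<forall>x. H n z x = u n z x + v z x)
      \<and> (Re z = 0 \<longrightarrow> v z = (\<lambda>_. 0)) \<and> (Re z = 1 \<longrightarrow> u n z = (\<lambda>_. 0))" ..
  from choice[OF this] obtain v where "\<forall>n. \<forall>z\<in>strip. u n z \<in> U0 \<and> v n z \<in> U1
      \<and> (\<forall>x. H n z x = u n z x + v n z x)
      \<and> (Re z = 0 \<longrightarrow> v n z = (\<lambda>_. 0)) \<and> (Re z = 1 \<longrightarrow> u n z = (\<lambda>_. 0))" ..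
  then have uv: "\<And>n z. z \<in> strip \<Longrightarrow> u n z \<in> U0" "\<And>n z. z \<in> strip \<Longrightarrow> v n z \<in> U1"
    "\<And>n z x. z \<in> strip \<Longrightarrow> H n z x = u n z x + v n z x"
    "\<And>n z. z \<in> strip \<Longrightarrow> Re z = 0 \<Longrightarrow> v n z = (\<lambda>_. 0)" "\<And>n z. z \<in> strip \<Longrightarrow> Re z = 1 \<Longrightarrow> u n z = (\<lambda>_. 0)"
    by (simp_all only:)
  have hol: "(\<lambda>z. H n z x) holomorphic_on UNIV" for n x using H unfolding analytic_family_def by blast
  define F where "F z x = of_real M * (\<Sum>n. (1 / 2) ^ n * H n z x)" for z x
  define FN where "FN N z x = of_real M * (\<Sum>n<N. (1 / 2) ^ n * H n z x)" for N z x
  let ?S = "sum_space A0 A1"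
  \<comment> \<open>After the weight \<open>(1 / 2) ^ N\<close> is pulled out, the tail is again a
    full series of the same kind, so the bounds of the couple apply with
    \<open>r = M * (1 / 2) ^ N\<close>.\<close>
  have tail: "\<pi> (\<lambda>x. F z x - FN N z x) \<in> car ?S \<and> nrm ?S (\<pi> (\<lambda>x. F z x - FN N z x)) \<le> 2 * C * M * (1
      / 2) ^ N"
    if z: "z \<in> strip" for z N
  proof -
    let ?r = "M * (1 / 2) ^ N"
    let ?a = "\<lambda>x. of_real ?r * (\<Sum>n. (1 / 2) ^ n * u (n + N) z x)"
    let ?b = "\<lambda>x. of_real ?r * (\<Sum>n. (1 / 2) ^ n * v (n + N) z x)"
    have r: "0 \<le> ?r" using M by simp
    note a = U0_bound[of "\<lambda>n. u (n + N) z", OF uv(1)[OF z] r]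
    note b = U1_bound[of "\<lambda>n. v (n + N) z", OF uv(2)[OF z] r]
    have "F z x - FN N z x = ?a x + ?b x" for x
    proof -
      have su: "summable (\<lambda>n. (1 / 2) ^ n * u (n + N) z x)" for N by (rule U0_summable) (rule
          uv(1)[OF z])
      have sv: "summable (\<lambda>n. (1 / 2) ^ n * v (n + N) z x)" for N by (rule U1_summable) (rule
          uv(2)[OF z])
      have sH: "summable (\<lambda>n. (1 / 2) ^ n * H n z x)"
        using summable_add[OF su[of 0] sv[of 0]] by (simp add: uv(3)[OF z] distrib_left)
      have "(\<Sum>n. (1 / 2) ^ n * H n z x) - (\<Sum>n<N. (1 / 2) ^ n * H n z x) = (\<Sum>n. (1 / 2) ^ (n + N) * H
          (n + N) z x)"
        by (simp add: suminf_minus_initial_segment[OF sH])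
      also have "\<dots> = (\<Sum>n. (1 / 2) ^ N * ((1 / 2) ^ n * u (n + N) z x + (1 / 2) ^ n * v (n + N) z x))"
        by (simp add: uv(3)[OF z] power_add algebra_simps)
      also have "\<dots> = (1 / 2) ^ N * ((\<Sum>n. (1 / 2) ^ n * u (n + N) z x) + (\<Sum>n. (1 / 2) ^ n * v (n + N)
          z x))"
        by (simp only: suminf_mult[OF summable_add[OF su sv]] suminf_add[OF su sv])
      finally show ?thesis unfolding F_def FN_def right_diff_distrib[symmetric] by (simp add:
          algebra_simps)
    qed
    then have eq: "\<pi> (\<lambda>x. F z x - FN N z x) = \<pi> ?a + \<pi> ?b" by (simp only: pi_add)
    show ?thesis unfolding eq
      using sum_space_I[OF nonneg conjunct1[OF a] conjunct1[OF b]] a b by simp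
  qed
  have F0: "F z x = F z x - FN 0 z x" for z x by (simp add: FN_def)
  have inS: "\<pi> (F z) \<in> car ?S" "nrm ?S (\<pi> (F z)) \<le> 2 * C * M" if "z \<in> strip" for z
    using tail[OF that, of 0] by (auto simp: FN_def)
  have suppN: "FN N z x = 0" if "x \<notin> (\<Union>n<N. K n)" for N z x
    using that K(2) unfolding FN_def by (intro mult_eq_0_iff[THEN iffD2] disjI2 sum.neutral) auto
  have finN: "finite (\<Union>n<N. K n)" for N using K(1) by simp
  have FNS: "\<pi> (FN N z) \<in> car ?S" for N z
    by (rule finite_support, rule finite_subset[OF _ finN[of N]]) (use suppN in blast)
  have holFN: "(\<lambda>z. FN N z x) holomorphic_on UNIV" for N x
    unfolding FN_def by (intro holomorphic_intros hol)
  have weak: "continuous_on strip (\<lambda>z. l (\<pi> (F z))) \<and> bounded ((\<lambda>z. l (\<pi> (F z))) ` strip)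
      \<and> (\<lambda>z. l (\<pi> (F z))) analytic_on open_strip" if l: "in_dual sc ?S l" for l
  proof -
    obtain B' where "\<forall>w\<in>car ?S. norm (l w) \<le> B' * nrm ?S w" using l unfolding in_dual_def by blast
    moreover have nnS: "0 \<le> nrm ?S w" if "w \<in> car ?S" for w
      using le_sum_space_nrm[OF that, of 1 0] nonneg unfolding nrm_nonneg_def by simp
    \<comment> \<open>The constant in \<open>in_dual\<close> has no sign; its absolute value allows
      monotonicity arguments.\<close>
    ultimately have B: "norm (l w) \<le> \<bar>B'\<bar> * nrm ?S w" if "w \<in> car ?S" for w
      using that by (meson abs_ge_self mult_right_mono order_trans)
    define D where "D = \<bar>B'\<bar> * (2 * C * M)"
    have lF: "norm (l (\<pi> (F z))) \<le> D" if "z \<in> strip" for z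
      using B[OF inS(1)[OF that]] mult_left_mono[OF inS(2)[OF that], of "\<bar>B'\<bar>"] by (simp add: D_def)
    define \<phi> where "\<phi> N z = l (\<pi> (FN N z))" for N z
    have phi_eq: "\<phi> N = (\<lambda>z. \<Sum>x\<in>(\<Union>n<N. K n). FN N z x * l (\<pi> (\<lambda>y. if y = x then 1 else 0)))" for N
      unfolding \<phi>_def by (intro ext dual_finite_sum[OF l finN suppN])
    have phi_hol: "\<phi> N holomorphic_on UNIV" for N
      unfolding phi_eq by (intro holomorphic_intros holFN)
    have dist: "norm (l (\<pi> (F z)) - \<phi> N z) \<le> D * (1 / 2) ^ N" if z: "z \<in> strip" for z N
    proof -
      have "\<pi> (F z) = \<pi> (FN N z) + \<pi> (\<lambda>x. F z x - FN N z x)" by (simp flip: pi_add)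
      then have "l (\<pi> (F z)) = \<phi> N z + l (\<pi> (\<lambda>x. F z x - FN N z x))"
        using l FNS[of N z] tail[OF z, of N] unfolding in_dual_def \<phi>_def by simp
      then have "norm (l (\<pi> (F z)) - \<phi> N z) \<le> \<bar>B'\<bar> * nrm ?S (\<pi> (\<lambda>x. F z x - FN N z x))"
        using B tail[OF z, of N] by simp
      also have "\<dots> \<le> \<bar>B'\<bar> * (2 * C * M * (1 / 2) ^ N)"
        using tail[OF z, of N] by (intro mult_left_mono) auto
      finally show ?thesis by (simp add: D_def mult.assoc)
    qed
    have "uniform_limit strip \<phi> (\<lambda>z. l (\<pi> (F z))) sequentially"
    proof (rule uniform_limitI)
      fix e :: real assume e: "0 < e"
      have "(\<lambda>N. D * (1 / 2) ^ N) \<longlonglongrightarrow> D * 0" by (intro tendsto_intros LIMSEQ_power_zero) auto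
      then have "\<forall>\<^sub>F N in sequentially. D * (1 / 2) ^ N < e"
        using e by (intro order_tendstoD(2)) auto
      then show "\<forall>\<^sub>F N in sequentially. \<forall>z\<in>strip. dist (\<phi> N z) (l (\<pi> (F z))) < e"
      proof (rule eventually_mono)
        fix N assume "D * (1 / 2) ^ N < e"
        then show "\<forall>z\<in>strip. dist (\<phi> N z) (l (\<pi> (F z))) < e"
          using dist by (metis (no_types, lifting) dist_commute dist_norm le_less_trans)
      qed
    qed
    note lim = this
    have "continuous_on strip (\<lambda>z. l (\<pi> (F z)))"
      by (rule uniform_limit_theorem[OF _ lim])
         (auto intro!: always_eventually continuous_on_subset[OF holomorphic_on_imp_continuous_on[OF
             phi_hol]])
    moreover have "bounded ((\<lambda>z. l (\<pi> (F z))) ` strip)"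
      using lF unfolding bounded_iff by blast
    moreover have "(\<lambda>z. l (\<pi> (F z))) holomorphic_on open_strip"
    proof (rule holomorphic_uniform_sequence[OF open_open_strip])
      show "\<phi> N holomorphic_on open_strip" for N using phi_hol by (rule holomorphic_on_subset) simp
      fix z assume "z \<in> open_strip"
      then obtain d where "0 < d" "cball z d \<subseteq> open_strip" using open_open_strip open_contains_cball
          by metis
      moreover have "cball z d \<subseteq> strip" using calculation(2) by fastforce
      ultimately show "\<exists>d>0. cball z d \<subseteq> open_strip \<and> uniform_limit (cball z d) \<phi> (\<lambda>z. l (\<pi> (F z)))
          sequentially"
        using uniform_limit_on_subset[OF lim] by blast
    qed
    ultimately show ?thesis using analytic_on_open[OF open_open_strip] by blast
  qed
  have left: "\<pi> (F (Complex 0 t)) \<in> car A0 \<and> nrm A0 (\<pi> (F (Complex 0 t))) \<le> C * M" for t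
  proof -
    have "F (Complex 0 t) = (\<lambda>x. of_real M * (\<Sum>n. (1 / 2) ^ n * u n (Complex 0 t) x))"
      unfolding F_def using uv(3,4)[of "Complex 0 t"] by simp
    then show ?thesis using U0_bound[of "\<lambda>n. u n (Complex 0 t)" M] uv(1) M by simp
  qed
  have right: "\<pi> (F (Complex 1 t)) \<in> car A1 \<and> nrm A1 (\<pi> (F (Complex 1 t))) \<le> C * M" for t
  proof -
    have "F (Complex 1 t) = (\<lambda>x. of_real M * (\<Sum>n. (1 / 2) ^ n * v n (Complex 1 t) x))"
      unfolding F_def using uv(3,5)[of "Complex 1 t"] by simp
    then show ?thesis using U1_bound[of "\<lambda>n. v n (Complex 1 t)" M] uv(2) M by simp
  qed
  have cls: "(\<lambda>z. \<pi> (F z)) \<in> calderon_class sc A0 A1"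
    unfolding calderon_class_def using inS(1) weak left right by blast
  have "calderon_norm A0 A1 (\<lambda>z. \<pi> (F z)) \<le> C * M"
    unfolding calderon_norm_def using left right by (intro cSUP_least) auto
  moreover have "F (of_real \<theta>) = (\<lambda>x. of_real M * f x)"
    unfolding F_def using sums_unique[OF f] by simp
  ultimately show ?thesis using interp_nrm_le[OF cls nonneg(1)] by auto
qed

end

section \<open>Interpolation between Hardy and Lebesgue spaces\<close>

text \<open>The exponent has real part \<open>k (p - 1)\<close> on the left edge of the strip, \<open>k (p / p1 - 1)\<close> on the
  right edge, and vanishes at \<open>\<theta>\<close> when \<open>1 / p = 1 - \<theta> + \<theta> / p1\<close>.\<close>

definition interp_exp :: "real \<Rightarrow> real \<Rightarrow> int \<Rightarrow> complex \<Rightarrow> complex" where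
  "interp_exp p p1 k z =
     exp (of_real (ln 2 * real_of_int k) * (of_real p * (1 - z) + of_real (p / p1) * z - 1))"

lemma interp_exp_holomorphic: "interp_exp p p1 k holomorphic_on UNIV"
  unfolding interp_exp_def by (intro holomorphic_intros)

lemma norm_interp_exp:
  "norm (interp_exp p p1 k z) = 2 powr (real_of_int k * (p * (1 - Re z) + p / p1 * Re z - 1))"
proof -
  have "Re (of_real (ln 2 * real_of_int k) * (of_real p * (1 - z) + of_real (p / p1) * z - 1))
      = ln 2 * real_of_int k * (p * (1 - Re z) + p / p1 * Re z - 1)"
    by (simp only: Re_complex_of_real Im_complex_of_real times_complex.sel plus_complex.sel
        minus_complex.sel one_complex.sel) simp
  then show ?thesis unfolding interp_exp_def norm_exp_eq_Re
    by (simp add: powr_def ac_simps)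
qed

text \<open>Since \<open>p / p1 < p\<close>, the modulus decreases in \<open>Re z\<close> for
  \<open>k \<ge> 0\<close> and increases for \<open>k < 0\<close>. So in the interior each
  coefficient is dominated by its modulus on one of the edges, and the sign of \<open>k\<close>
  decides which.\<close>

lemma norm_interp_exp_le:
  assumes "z \<in> strip" "1 < p" "p < p1"
  shows "0 \<le> k \<or> Re z = 0 \<Longrightarrow> norm (interp_exp p p1 k z) \<le> 2 powr (real_of_int k * (p - 1))"
    and "k < 0 \<or> Re z = 1 \<Longrightarrow> norm (interp_exp p p1 k z) \<le> 2 powr (real_of_int k * (p / p1 - 1))"
proof -
  have pp: "p / p1 \<le> p" using assms by (simp add: field_simps)
  have e: "p * (1 - Re z) + p / p1 * Re z \<le> p" "p / p1 \<le> p * (1 - Re z) + p / p1 * Re z"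
    using mult_right_mono[OF pp, of "Re z"] mult_right_mono[OF pp, of "1 - Re z"] assms(1)
    by (simp_all add: algebra_simps)
  show "norm (interp_exp p p1 k z) \<le> 2 powr (real_of_int k * (p - 1))" if "0 \<le> k \<or> Re z = 0"
  proof (cases "Re z = 0")
    case False
    then have "0 \<le> real_of_int k" using that by simp
    then show ?thesis unfolding norm_interp_exp using e by (intro powr_mono mult_left_mono) auto
  qed (simp add: norm_interp_exp)
  show "norm (interp_exp p p1 k z) \<le> 2 powr (real_of_int k * (p / p1 - 1))" if "k < 0 \<or> Re z = 1"
  proof (cases "Re z = 1")
    case False
    then have "real_of_int k \<le> 0" using that by simp
    then show ?thesis unfolding norm_interp_exp using e by (intro powr_mono mult_left_mono_neg) auto
  qed (simp add: norm_interp_exp)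
qed

lemma interp_exp_theta:
  assumes "1 < p" "1 / p = 1 - \<theta> + \<theta> / p1"
  shows "interp_exp p p1 k (of_real \<theta>) = 1"
proof -
  have "p * (1 - \<theta>) + p / p1 * \<theta> = p * (1 - \<theta> + \<theta> / p1)" by (simp add: algebra_simps)
  also have "\<dots> = 1" using assms by (simp flip: assms(2))
  finally have "complex_of_real (p * (1 - \<theta>) + p / p1 * \<theta>) = 1" by simp
  then have "of_real p * (1 - of_real \<theta>) + of_real (p / p1) * of_real \<theta> - 1 = (0::complex)" by simp
  then show ?thesis unfolding interp_exp_def by (simp only: mult_zero_right exp_zero)
qed

lemma interp_exp_bounded: "bounded (interp_exp p p1 k ` strip)"
proof -
  let ?e = "\<bar>real_of_int k\<bar> * (\<bar>p\<bar> + \<bar>p / p1\<bar> + 1)"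
  have "norm (interp_exp p p1 k z) \<le> 2 powr ?e" if z: "z \<in> strip" for z
  proof -
    have le: "\<bar>c * t\<bar> \<le> \<bar>c\<bar>" if "0 \<le> t" "t \<le> 1" for c t :: real
      using that by (simp add: abs_mult mult_left_le)
    have "\<bar>p * (1 - Re z)\<bar> \<le> \<bar>p\<bar>" "\<bar>p / p1 * Re z\<bar> \<le> \<bar>p / p1\<bar>"
      using z by (intro le; simp)+
    then have "\<bar>p * (1 - Re z) + p / p1 * Re z - 1\<bar> \<le> \<bar>p\<bar> + \<bar>p / p1\<bar> + 1" by linarith
    then have "\<bar>real_of_int k * (p * (1 - Re z) + p / p1 * Re z - 1)\<bar> \<le> ?e"
      unfolding abs_mult by (intro mult_left_mono) auto
    then have "real_of_int k * (p * (1 - Re z) + p / p1 * Re z - 1) \<le> ?e" by linarith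
    then show ?thesis unfolding norm_interp_exp by (intro powr_mono) auto
  qed
  then show ?thesis unfolding bounded_iff by blast
qed

text \<open>The phase of \<open>w\<close> times the power \<open>a\<close> of its modulus, written
  with \<open>exp\<close> so that it is entire in \<open>a\<close>.\<close>

definition sgn_powr :: "complex \<Rightarrow> complex \<Rightarrow> complex" where
  "sgn_powr w a = (if w = 0 then 0 else sgn w * exp (of_real (ln (norm w)) * a))"

lemma norm_sgn_powr: "norm (sgn_powr w a) = (if w = 0 then 0 else norm w powr Re a)"
  by (simp add: sgn_powr_def norm_mult norm_sgn powr_def mult.commute)

lemma sgn_powr_one: "sgn_powr w 1 = w"
proof (cases "w = 0")
  case False
  then have "exp (complex_of_real (ln (norm w))) = of_real (norm w)" by (simp add: exp_of_real)
  then show ?thesis using False by (simp add: sgn_powr_def sgn_eq)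
qed (simp add: sgn_powr_def)

lemma sgn_powr_holomorphic: "a holomorphic_on S \<Longrightarrow> (\<lambda>z. sgn_powr w (a z)) holomorphic_on S"
  unfolding sgn_powr_def by (cases "w = 0") (auto intro!: holomorphic_intros)

context vertex_weight
begin

text \<open>The triangle inequality for a series, obtained by testing against a dual function on
  each finite set. The 2 is the sum of the weights.\<close>

lemma Lp_series:
  assumes p: "1 < p" and C: "0 < C" and u: "\<And>n. Lp_sums_le p (u n) (C powr p)"
  shows "summable (\<lambda>n. (1 / 2) ^ n * u n x)"
    and "Lp_sums_le p (\<lambda>x. \<Sum>n. (1 / 2) ^ n * u n x) ((2 * C) powr p)"
proof -
  have sm: "summable (\<lambda>n. (1 / 2) ^ n * u n x)" for x
  proof (rule summable_comparison_test')
    show "summable (\<lambda>n. (1 / 2) ^ n * (C * m x powr (- (1 / p))))"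
      by (intro summable_mult2 summable_geometric) simp
    show "norm ((1 / 2) ^ n * u n x) \<le> (1 / 2) ^ n * (C * m x powr (- (1 / p)))" for n
      unfolding norm_mult norm_power using Lp_point_bound[OF _ _ u, of n x] p C
      by (intro mult_mono) auto
  qed
  then show "summable (\<lambda>n. (1 / 2) ^ n * u n x)" .
  obtain q where q: "1 < q" "1 / p + 1 / q = 1" using conjugate_exponent[OF p] .
  show "Lp_sums_le p (\<lambda>x. \<Sum>n. (1 / 2) ^ n * u n x) ((2 * C) powr p)"
    unfolding Lp_sums_le_def
  proof (intro allI impI, rule Lp_sums_le_dual[OF p q])
    fix K :: "'v set" and g :: "'v \<Rightarrow> complex"
    assume K: "finite K" and g: "(\<Sum>x\<in>K. norm (g x) powr q * m x) \<le> 1"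
    let ?w = "\<lambda>n. \<Sum>x\<in>K. u n x * g x * of_real (m x)"
    have w: "norm (?w n) \<le> C" for n
    proof -
      have "norm (?w n) \<le> (\<Sum>x\<in>K. norm (u n x) * norm (g x) * m x)"
        by (rule order_trans[OF norm_sum]) (simp add: norm_mult m_nonneg)
      also have "\<dots> \<le> C * 1"
        using g C Lp_sums_leD[OF u K] by (intro Holder_sum[OF p q K]) auto
      finally show ?thesis by simp
    qed
    have "(\<Sum>x\<in>K. (\<Sum>n. (1 / 2) ^ n * u n x) * g x * of_real (m x))
        = (\<Sum>x\<in>K. \<Sum>n. (1 / 2) ^ n * u n x * (g x * of_real (m x)))"
    proof (rule sum.cong[OF refl])
      fix x
      show "(\<Sum>n. (1 / 2) ^ n * u n x) * g x * of_real (m x) = (\<Sum>n. (1 / 2) ^ n * u n x * (g x *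
          of_real (m x)))"
        using suminf_mult2[OF sm[of x], of "g x * of_real (m x)"] by (simp add: mult.assoc)
    qed
    also have "\<dots> = (\<Sum>n. \<Sum>x\<in>K. (1 / 2) ^ n * u n x * (g x * of_real (m x)))"
      by (intro suminf_sum[symmetric] summable_mult2 sm)
    also have "\<dots> = (\<Sum>n. (1 / 2) ^ n * ?w n)" by (simp add: sum_distrib_left mult.assoc)
    finally have eq: "(\<Sum>x\<in>K. (\<Sum>n. (1 / 2) ^ n * u n x) * g x * of_real (m x)) = (\<Sum>n. (1 / 2) ^ n *
        ?w n)" .
    have le: "norm ((1 / 2) ^ n * ?w n) \<le> (1 / 2) ^ n * C" for n
      unfolding norm_mult norm_power using w by (intro mult_mono) auto
    have geo: "summable (\<lambda>n. (1 / 2) ^ n * C)" by (intro summable_mult2 summable_geometric) simp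
    have s: "summable (\<lambda>n. norm ((1 / 2) ^ n * ?w n))"
      by (rule summable_comparison_test'[OF geo, of 0]) (use le in simp)
    have "norm (\<Sum>n. (1 / 2) ^ n * ?w n) \<le> (\<Sum>n. (1 / 2) ^ n * C)"
      using summable_norm[OF s] suminf_le[OF le s geo] by linarith
    also have "\<dots> = 2 * C" by (simp add: suminf_mult2[OF summable_geometric, symmetric] suminf_geometric)
    finally show "norm (\<Sum>x\<in>K. (\<Sum>n. (1 / 2) ^ n * u n x) * g x * of_real (m x)) \<le> 2 * C"
      unfolding eq .
  qed (use C in auto)
qed

lemma nrm_nonneg_Lp: "nrm_nonneg (Lp m p)"
  by (simp add: nrm_nonneg_def nrm_Lp_nonneg)

end

context flow_space
begin

lemma nrm_nonneg_H1: "nrm_nonneg Hardy"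
  using nrm_H1_nonneg by (simp add: nrm_nonneg_def)

lemma H1_series:
  assumes "\<And>n. u n \<in> car Hardy \<and> nrm Hardy (u n) \<le> C" "0 < C"
  shows "summable (\<lambda>n. (1 / 2) ^ n * u n x)"
    and "(\<lambda>x. \<Sum>n. (1 / 2) ^ n * u n x) \<in> car Hardy \<and> nrm Hardy (\<lambda>x. \<Sum>n. (1 / 2) ^ n * u n x) \<le> 2 * C"
proof -
  have le: "norm (u n x) \<le> C / m x" for n x
    using H1_L1[of "u n" "{x}"] assms(1)[of n] m_pos[of x] by (simp add: field_simps)
  have sm: "summable (\<lambda>n. (1 / 2) ^ n * u n x)" for x
  proof (rule summable_comparison_test')
    show "summable (\<lambda>n. (1 / 2) ^ n * (C / m x))" by (intro summable_mult2 summable_geometric) simp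
    show "norm ((1 / 2) ^ n * u n x) \<le> (1 / 2) ^ n * (C / m x)" for n
      unfolding norm_mult norm_power using le by (intro mult_mono) auto
  qed
  then show "summable (\<lambda>n. (1 / 2) ^ n * u n x)" .
  have "(\<lambda>x. (1 / 2) ^ n * u n x) \<in> car Hardy \<and> nrm Hardy (\<lambda>x. (1 / 2) ^ n * u n x) \<le> (1 / 2) ^ n *
      C" for n
  proof -
    have "norm ((1 / 2 :: complex) ^ n) * nrm Hardy (u n) \<le> (1 / 2) ^ n * C"
      unfolding norm_power using assms(1)[of n] by (intro mult_mono nrm_H1_nonneg) auto
    then show ?thesis using H1_scale[of "u n" "(1 / 2) ^ n"] assms(1)[of n] by linarith
  qed
  then have "(\<lambda>x. \<Sum>n. (1 / 2) ^ n * u n x) \<in> car Hardy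
      \<and> nrm Hardy (\<lambda>x. \<Sum>n. (1 / 2) ^ n * u n x) \<le> (\<Sum>n. (1 / 2) ^ n * C)"
    by (intro H1_suminf[where u = "\<lambda>n x. (1 / 2) ^ n * u n x"] summable_sums[OF sm] summable_mult2
        summable_geometric) auto
  then show "(\<lambda>x. \<Sum>n. (1 / 2) ^ n * u n x) \<in> car Hardy \<and> nrm Hardy (\<lambda>x. \<Sum>n. (1 / 2) ^ n * u n x) \<le> 2 * C"
    by (simp add: suminf_mult2[OF summable_geometric, symmetric] suminf_geometric)
qed

lemma Lp_finite_support: "finite {x. f x \<noteq> 0} \<Longrightarrow> 0 < p \<Longrightarrow> f \<in> car (Lp m p)"
proof -
  assume fin: "finite {x. f x \<noteq> 0}" and p: "0 < p"
  let ?s = "\<Sum>x | f x \<noteq> 0. norm (f x) powr p * m x"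
  have "0 \<le> ?s" by (intro sum_nonneg) (auto simp: m_nonneg)
  then have "Lp_sums_le p f ((?s powr (1 / p)) powr p)"
    using fin p by (intro Lp_sums_le_finite_support[OF fin]) (auto simp: powr_powr)
  then show ?thesis using Lp_I(1) p by (metis powr_ge_zero)
qed

text \<open>No quotient is taken in this couple, so the map into the ambient space is the identity.
  The factor 2 is the sum of the weights.\<close>

lemma Hardy_Lp_sigma_couple:
  assumes "1 < p1" "0 < C"
  shows "sigma_couple scale_fun Hardy (Lp m p1) (\<lambda>f. f)
     {u. u \<in> car Hardy \<and> nrm Hardy u \<le> C} {v. Lp_sums_le p1 v (C powr p1)} (2 * C)"
proof
  show "(\<lambda>x. f x + g x) = f + g" for f g :: "'v \<Rightarrow> complex" by (simp add: fun_eq_iff)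
  show "(\<lambda>x. c * f x) = scale_fun c f" for c and f :: "'v \<Rightarrow> complex" by (simp add: scale_fun_def)
  show "h \<in> car (sum_space Hardy (Lp m p1))" if "finite {x. h x \<noteq> 0}" for h
    using sum_space_I(1)[OF nrm_nonneg_H1 nrm_nonneg_Lp H1_zero(1) Lp_finite_support[OF that], of
        p1] assms
    by (simp add: plus_fun_def)
  show "summable (\<lambda>n. (1 / 2) ^ n * u n x)"
    if "\<And>n. u n \<in> {u. u \<in> car Hardy \<and> nrm Hardy u \<le> C}" for u :: "nat \<Rightarrow> 'v \<Rightarrow> complex" and x
    using that assms by (intro H1_series(1)) auto
  show "summable (\<lambda>n. (1 / 2) ^ n * u n x)"
    if "\<And>n. u n \<in> {v. Lp_sums_le p1 v (C powr p1)}" for u :: "nat \<Rightarrow> 'v \<Rightarrow> complex" and x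
    using that assms by (intro Lp_series(1)) auto
  show "(\<lambda>x. of_real r * (\<Sum>n. (1 / 2) ^ n * u n x)) \<in> car Hardy \<and>
      nrm Hardy (\<lambda>x. of_real r * (\<Sum>n. (1 / 2) ^ n * u n x)) \<le> 2 * C * r"
    if u: "\<And>n. u n \<in> {u. u \<in> car Hardy \<and> nrm Hardy u \<le> C}" and r: "0 \<le> r" for u r
  proof -
    let ?s = "\<lambda>x. \<Sum>n. (1 / 2) ^ n * u n x"
    have s: "?s \<in> car Hardy \<and> nrm Hardy ?s \<le> 2 * C" using u assms by (intro H1_series(2)) auto
    then have "r * nrm Hardy ?s \<le> r * (2 * C)" using r by (intro mult_left_mono) auto
    then show ?thesis using H1_scale[of ?s "of_real r"] s r by (simp add: mult_ac)
  qed
  show "(\<lambda>x. of_real r * (\<Sum>n. (1 / 2) ^ n * u n x)) \<in> car (Lp m p1) \<and>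
      nrm (Lp m p1) (\<lambda>x. of_real r * (\<Sum>n. (1 / 2) ^ n * u n x)) \<le> 2 * C * r"
    if u: "\<And>n. u n \<in> {v. Lp_sums_le p1 v (C powr p1)}" and r: "0 \<le> r" for u r
  proof -
    have "Lp_sums_le p1 (\<lambda>x. of_real r * (\<Sum>n. (1 / 2) ^ n * u n x)) (r powr p1 * (2 * C) powr p1)"
      using u assms r by (intro Lp_sums_le_scale[OF Lp_series(2)]) (auto simp: norm_mult)
    then have "Lp_sums_le p1 (\<lambda>x. of_real r * (\<Sum>n. (1 / 2) ^ n * u n x)) ((2 * C * r) powr p1)"
      by (simp add: powr_mult mult_ac)
    then show ?thesis using Lp_I[of p1 _ "2 * C * r"] assms r by auto
  qed
qed (rule nrm_nonneg_H1 nrm_nonneg_Lp)+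

proposition Hardy_Lp_upper:
  assumes p: "1 < p" "p < p1" and \<theta>: "0 < \<theta>" "\<theta> < 1" and rel: "1 / p = 1 - \<theta> + \<theta> / p1"
  shows "\<exists>C>0. \<forall>f M. 0 < M \<longrightarrow> Lp_sums_le p f (M powr p) \<longrightarrow>
     f \<in> car (interp scale_fun Hardy (Lp m p1) \<theta>) \<and> nrm (interp scale_fun Hardy (Lp m p1) \<theta>) f \<le> C * M"
proof -
  obtain C where C: "0 < C" and layer: "\<And>g. mean_zero g \<Longrightarrow> Lp_sums_le p g 1 \<Longrightarrow>
      \<exists>K I b \<mu>. layered p p1 C g K I b \<mu>"
    using layered_exists[OF p] by blast
  have "1 < p1" using p by simp
  interpret sc: sigma_couple scale_fun Hardy "Lp m p1" "\<lambda>f. f"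
    "{u. u \<in> car Hardy \<and> nrm Hardy u \<le> C}" "{v. Lp_sums_le p1 v (C powr p1)}" "2 * C"
    by (rule Hardy_Lp_sigma_couple[OF \<open>1 < p1\<close> C])
  have family: "\<exists>H. sc.analytic_family H \<and> (\<forall>x. H (of_real \<theta>) x = g x)"
    if g: "mean_zero g" "Lp_sums_le p g 1" for g
  proof -
    obtain K I b \<mu> where L: "layered p p1 C g K I b \<mu>" using layer[OF g] by blast
    have K: "finite K" "\<And>k x. x \<notin> K \<Longrightarrow> b k x = 0" and I: "finite I"
      and sum_b: "\<And>x. g x = (\<Sum>k\<in>I. b k x)" and cb: "\<And>k. k \<in> I \<Longrightarrow> cell_bounded (b k) (\<mu> k) \<and> 0 \<le> \<mu> k"
      and mu: "(\<Sum>k\<in>I. 2 powr (real_of_int k * (p - 1)) * \<mu> k) \<le> C"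
      and Lb: "Lp_sums_le p1 (\<lambda>x. of_real (\<Sum>k\<in>I. 2 powr (real_of_int k * (p / p1 - 1)) * norm (b k
          x))) (C powr p1)"
      using L unfolding layered_def by auto
    define H where "H z x = (\<Sum>k\<in>I. interp_exp p p1 k z * b k x)" for z x
    \<comment> \<open>In the interior the nonnegative levels are measured in the Hardy space and the
      negative ones in the Lebesgue space, following \<open>norm_interp_exp_le\<close>. On an edge
      all levels go to the space of that edge.\<close>
    define S where "S z = {k \<in> I. Re z = 0 \<or> (Re z \<noteq> 1 \<and> 0 \<le> k)}" for z
    define u where "u z x = (\<Sum>k\<in>S z. interp_exp p p1 k z * b k x)" for z x
    define v where "v z x = (\<Sum>k\<in>I - S z. interp_exp p p1 k z * b k x)" for z x
    have SI: "S z \<subseteq> I" "finite (S z)" for z using I by (auto simp: S_def)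
    have u: "u z \<in> car Hardy \<and> nrm Hardy (u z) \<le> C" if z: "z \<in> strip" for z
    proof -
      have "(\<lambda>x. interp_exp p p1 k z * b k x) \<in> car Hardy \<and>
          nrm Hardy (\<lambda>x. interp_exp p p1 k z * b k x) \<le> 2 powr (real_of_int k * (p - 1)) * \<mu> k"
        if k: "k \<in> S z" for k
      proof -
        have h: "b k \<in> car Hardy \<and> nrm Hardy (b k) \<le> \<mu> k"
          using cell_bounded_H1 cb k SI by blast
        have "norm (interp_exp p p1 k z) * nrm Hardy (b k) \<le> 2 powr (real_of_int k * (p - 1)) * \<mu> k"
          using h norm_interp_exp_le(1)[OF z p, of k] k nrm_H1_nonneg by (intro mult_mono) (auto
              simp: S_def)
        then show ?thesis using H1_scale[OF conjunct1[OF h], of "interp_exp p p1 k z"] by linarith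
      qed
      from H1_sum[OF SI(2) this] have "u z \<in> car Hardy \<and> nrm Hardy (u z) \<le> (\<Sum>k\<in>S z. 2 powr
          (real_of_int k * (p - 1)) * \<mu> k)"
        unfolding u_def .
      moreover have "(\<Sum>k\<in>S z. 2 powr (real_of_int k * (p - 1)) * \<mu> k) \<le> (\<Sum>k\<in>I. 2 powr (real_of_int k
          * (p - 1)) * \<mu> k)"
        using cb I SI by (intro sum_mono2) auto
      ultimately show ?thesis using mu by linarith
    qed
    have v: "Lp_sums_le p1 (v z) (C powr p1)" if z: "z \<in> strip" for z
    proof -
      have "norm (v z x) \<le> 1 * norm (complex_of_real (\<Sum>k\<in>I. 2 powr (real_of_int k * (p / p1 - 1)) *
          norm (b k x)))" for x
      proof -
        have "norm (v z x) \<le> (\<Sum>k\<in>I - S z. 2 powr (real_of_int k * (p / p1 - 1)) * norm (b k x))"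
          unfolding v_def
        proof (rule sum_norm_le)
          fix k assume "k \<in> I - S z"
          then have "k < 0 \<or> Re z = 1" by (auto simp: S_def)
          then show "norm (interp_exp p p1 k z * b k x) \<le> 2 powr (real_of_int k * (p / p1 - 1)) *
              norm (b k x)"
            unfolding norm_mult using norm_interp_exp_le(2)[OF z p] by (intro mult_right_mono) auto
        qed
        also have "\<dots> \<le> (\<Sum>k\<in>I. 2 powr (real_of_int k * (p / p1 - 1)) * norm (b k x))"
          using I by (intro sum_mono2) auto
        finally show ?thesis by (simp add: sum_nonneg del: of_real_sum)
      qed
      from Lp_sums_le_scale[OF Lb _ this] show ?thesis using p by simp
    qed
    have uv: "H z x = u z x + v z x" for z x
      unfolding H_def u_def v_def using sum.subset_diff[OF SI(1) I] by (simp add: add.commute)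
    have v0: "v z = (\<lambda>_. 0)" if "Re z = 0" for z using that by (simp add: v_def S_def fun_eq_iff)
    have u0: "u z = (\<lambda>_. 0)" if "Re z = 1" for z using that by (simp add: u_def S_def fun_eq_iff)
    have hol: "(\<lambda>z. H z x) holomorphic_on UNIV" for x
      unfolding H_def by (intro holomorphic_intros interp_exp_holomorphic)
    have H0: "H z x = 0" if "x \<notin> K" for z x using K(2)[OF that] by (simp add: H_def)
    have "sc.analytic_family H"
      by (rule sc.analytic_familyI[OF K(1) H0 hol _ _ uv v0 u0]) (use u v in auto)
    moreover have "H (of_real \<theta>) x = g x" for x
      unfolding H_def sum_b interp_exp_theta[OF p(1) rel] by simp
    ultimately show ?thesis by blast
  qed
  have "f \<in> car (interp scale_fun Hardy (Lp m p1) \<theta>) \<and> nrm (interp scale_fun Hardy (Lp m p1) \<theta>) f \<le>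
      8 * C * M"
    if M: "0 < M" and f: "Lp_sums_le p f (M powr p)" for f M
  proof -
    obtain g where g: "\<And>n. mean_zero (g n)" "\<And>n. Lp_sums_le p (g n) 1"
      "\<And>x. (\<lambda>n. (1 / 2) ^ n * g n x) sums (f x / of_real (4 * M))"
      using Lp_split[OF p(1) M f] by blast
    have "\<forall>n. \<exists>H. sc.analytic_family H \<and> (\<forall>x. H (of_real \<theta>) x = g n x)"
      by (intro allI family g)
    from choice[OF this] obtain H where
      H: "\<forall>n. sc.analytic_family (H n) \<and> (\<forall>x. H n (of_real \<theta>) x = g n x)" ..
    \<comment> \<open>The normalisation 4 of \<open>Lp_split\<close> and the constant
      \<open>2 * C\<close> of the couple give \<open>8 * C\<close>.\<close>
    have "(\<lambda>x. of_real (4 * M) * (f x / of_real (4 * M))) = f" using M by (simp add: fun_eq_iff)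
    then show ?thesis using sc.interp_upper[where H = H and M = "4 * M" and \<theta> = \<theta> and f = "\<lambda>x. f x /
        of_real (4 * M)"] H g(3) M \<theta>
      by (simp add: mult_ac)
  qed
  then show ?thesis using C by (intro exI[of _ "8 * C"]) auto
qed

text \<open>Since the Hardy norm dominates the norm of integrable functions, Stein's classical
  argument applies: pair with complex powers of a dual function, bounded on the left edge and of
  conjugate exponent \<open>r\<close> on the right edge.\<close>

proposition Hardy_Lp_lower:
  assumes p: "1 < p" "p < p1" and \<theta>: "0 < \<theta>" "\<theta> < 1" and rel: "1 / p = 1 - \<theta> + \<theta> / p1"
    and F: "F \<in> calderon_class scale_fun Hardy (Lp m p1)" "calderon_norm Hardy (Lp m p1) F \<le> B" and
        B: "0 < B"
  shows "Lp_sums_le p (F (of_real \<theta>)) (B powr p)"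
proof -
  have p1: "1 < p1" using p by simp
  obtain q where q: "1 < q" "1 / p + 1 / q = 1" using conjugate_exponent[OF p(1)] .
  obtain r where r: "1 < r" "1 / p1 + 1 / r = 1" using conjugate_exponent[OF p1] .
  have "1 / q = \<theta> / r" using rel q(2) r(2) by (simp add: divide_inverse algebra_simps) algebra
  then have qr: "r / \<theta> = q" using q(1) r(1) \<theta> by (simp add: field_simps)
  have left: "F (Complex 0 t) \<in> car Hardy" "nrm Hardy (F (Complex 0 t)) \<le> B" for t
    using F calderon_norm_bounds(1)[OF F(1) nrm_nonneg_H1, of t] unfolding calderon_class_def by auto
  have right: "F (Complex 1 t) \<in> car (Lp m p1)" "nrm (Lp m p1) (F (Complex 1 t)) \<le> B" for t
    using F calderon_norm_bounds(2)[OF F(1) nrm_nonneg_H1, of t] unfolding calderon_class_def by auto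
  have eval: "in_dual scale_fun (sum_space Hardy (Lp m p1)) (\<lambda>u. u x)" for x
  proof -
    \<comment> \<open>The two entries bound the evaluation at \<open>x\<close> on the Hardy space
      and on the Lebesgue space; their maximum bounds it on the sum.\<close>
    define D where "D = max (inverse (m x)) (m x powr (- (1 / p1)))"
    have D0: "0 \<le> D" unfolding D_def using m_pos[of x] by (simp add: le_max_iff_disj)
    have "norm (u x) \<le> D * nrm (sum_space Hardy (Lp m p1)) u" if "u \<in> car (sum_space Hardy (Lp m
        p1))" for u
    proof (rule le_sum_space_nrm[OF that D0])
      fix a b assume ab: "a \<in> car Hardy" "b \<in> car (Lp m p1)" "u = a + b"
      have "norm (a x) \<le> inverse (m x) * nrm Hardy a"
        using H1_L1[OF ab(1), of "{x}"] m_pos[of x] by (simp add: field_simps)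
      also have "\<dots> \<le> D * nrm Hardy a" using nrm_H1_nonneg[OF ab(1)] by (intro mult_right_mono) (auto
          simp: D_def)
      finally have 1: "norm (a x) \<le> D * nrm Hardy a" .
      have "norm (b x) \<le> m x powr (- (1 / p1)) * nrm (Lp m p1) b"
        using Lp_point_bound[of p1 "nrm (Lp m p1) b" b x] Lp_D[OF ab(2)] p1 nrm_Lp_nonneg by (simp
            add: mult.commute)
      also have "\<dots> \<le> D * nrm (Lp m p1) b" using nrm_Lp_nonneg by (intro mult_right_mono) (auto simp:
          D_def)
      finally show "norm (u x) \<le> D * (nrm Hardy a + nrm (Lp m p1) b)"
        using 1 norm_triangle_ineq[of "a x" "b x"] by (simp add: ab(3) distrib_left)
    qed
    then show ?thesis unfolding in_dual_def by (auto simp: scale_fun_def)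
  qed
  show ?thesis unfolding Lp_sums_le_def
  proof (intro allI impI, rule Lp_sums_le_dual[OF p(1) q])
    fix K :: "'v set" and g :: "'v \<Rightarrow> complex"
    assume K: "finite K" and g: "(\<Sum>x\<in>K. norm (g x) powr q * m x) \<le> 1"
    \<comment> \<open>The power has modulus at most one on the left edge, equals \<open>g x\<close>
      at \<open>\<theta>\<close>, and on the right edge its \<open>r\<close>-th power is the
      \<open>q\<close>-th power of \<open>norm (g x)\<close>, because
      \<open>r / \<theta> = q\<close>.\<close>
    define \<phi> where "\<phi> x z = sgn_powr (g x) (of_real (1 / \<theta>) * z) * of_real (m x)" for x z
    have nphi: "norm (\<phi> x z) = (if g x = 0 then 0 else norm (g x) powr (Re z / \<theta>)) * m x" for x z
      unfolding \<phi>_def norm_mult norm_sgn_powr using m_nonneg[of x] \<theta> by simp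
    have "norm (\<Sum>x\<in>K. \<phi> x (of_real \<theta>) * F (of_real \<theta>) x) \<le> B"
    proof (rule calderon_class_three_lines[OF F(1) K eval])
      show "\<phi> x holomorphic_on UNIV" for x
        unfolding \<phi>_def by (intro holomorphic_intros sgn_powr_holomorphic)
      show "bounded (\<phi> x ` strip)" for x
      proof -
        have "norm (\<phi> x z) \<le> max 1 (norm (g x)) powr (1 / \<theta>) * m x" if z: "z \<in> strip" for z
        proof -
          have "norm (g x) powr (Re z / \<theta>) \<le> max 1 (norm (g x)) powr (Re z / \<theta>)"
            using z \<theta> by (intro powr_mono2) auto
          also have "\<dots> \<le> max 1 (norm (g x)) powr (1 / \<theta>)"
            using z \<theta> by (intro powr_mono divide_right_mono) auto
          finally show ?thesis unfolding nphi using m_nonneg by (intro mult_right_mono) auto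
        qed
        then show ?thesis unfolding bounded_iff by blast
      qed
      show "norm (\<Sum>x\<in>K. \<phi> x (Complex 0 t) * F (Complex 0 t) x) \<le> B" for t
      proof -
        have "norm (\<Sum>x\<in>K. \<phi> x (Complex 0 t) * F (Complex 0 t) x) \<le> (\<Sum>x\<in>K. norm (F (Complex 0 t) x) *
            m x)"
          by (rule sum_norm_le) (simp add: norm_mult nphi m_nonneg mult.commute)
        then show ?thesis using H1_L1[OF left(1) K, of t] left(2)[of t] by linarith
      qed
      show "norm (\<Sum>x\<in>K. \<phi> x (Complex 1 t) * F (Complex 1 t) x) \<le> B" for t
      proof -
        define G where "G x = sgn_powr (g x) (of_real (1 / \<theta>) * Complex 1 t)" for x
        have nG: "norm (G x) powr r = norm (g x) powr q" for x
          unfolding G_def norm_sgn_powr using qr by (simp add: powr_powr)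
        have "norm (\<Sum>x\<in>K. \<phi> x (Complex 1 t) * F (Complex 1 t) x) \<le> (\<Sum>x\<in>K. norm (F (Complex 1 t) x) *
            norm (G x) * m x)"
          by (rule sum_norm_le) (simp add: norm_mult \<phi>_def G_def m_nonneg mult_ac)
        also have "\<dots> \<le> B * 1"
        proof (rule Holder_sum[OF p1 r K])
          have "nrm (Lp m p1) (F (Complex 1 t)) powr p1 \<le> B powr p1"
            using right(2)[of t] nrm_Lp_nonneg p1 by (intro powr_mono2) auto
          then show "(\<Sum>x\<in>K. norm (F (Complex 1 t) x) powr p1 * m x) \<le> B powr p1"
            using Lp_sums_leD[OF Lp_D[OF right(1)[of t]] K] p1 by linarith
        qed (use g B nG in auto)
        finally show ?thesis by simp
      qed
    qed (use \<theta> in auto)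
    moreover have "\<phi> x (of_real \<theta>) = g x * of_real (m x)" for x
      using \<theta> sgn_powr_one[of "g x"] unfolding \<phi>_def by (simp flip: of_real_mult)
    ultimately show "norm (\<Sum>x\<in>K. F (of_real \<theta>) x * g x * of_real (m x)) \<le> B"
      by (simp add: mult_ac)
  qed (use B in auto)
qed

end

section \<open>Interpolation between Lebesgue spaces and BMO\<close>

lemma to_modc_add: "to_modc (\<lambda>x. f x + g x) = to_modc f + to_modc g"
  by (simp add: plus_modc.abs_eq plus_fun_def)

lemma to_modc_scale: "to_modc (\<lambda>x. c * f x) = scale_modc c (to_modc f)"
  by (simp add: scale_modc.abs_eq scale_fun_def)

lemma to_modc_eq_iff: "to_modc f = to_modc g \<longleftrightarrow> (\<exists>c. \<forall>x. f x = g x + c)"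
  unfolding modc.abs_eq_iff eq_mod_const_def ..

lemma rep_modc_const: "\<exists>c. \<forall>x. rep_modc (to_modc f) x = f x + c"
  using to_modc_eq_iff[of "rep_modc (to_modc f)" f] Quotient3_abs_rep[OF Quotient3_modc, of "to_modc
      f"] by simp

lemma mod_const_I:
  assumes "nrm_nonneg A" "f \<in> car A"
  shows "to_modc f \<in> car (mod_const A)" "nrm (mod_const A) (to_modc f) \<le> nrm A f"
proof -
  show "to_modc f \<in> car (mod_const A)" using assms by (simp add: mod_const_def)
  have "bdd_below {nrm A g |g. g \<in> car A \<and> to_modc g = to_modc f}"
    using assms(1) unfolding nrm_nonneg_def bdd_below_def by blast
  then show "nrm (mod_const A) (to_modc f) \<le> nrm A f"
    unfolding mod_const_def using assms(2) by (auto intro!: cInf_lower)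
qed

lemma mod_const_nonempty: "u \<in> car (mod_const A) \<Longrightarrow> {nrm A f |f. f \<in> car A \<and> to_modc f = u} \<noteq> {}"
  unfolding mod_const_def by auto

lemma nrm_nonneg_mod_const: "nrm_nonneg A \<Longrightarrow> nrm_nonneg (mod_const A)"
  unfolding nrm_nonneg_def using mod_const_nonempty[of _ A]
  by (auto simp: mod_const_def intro!: cInf_greatest)

lemma le_mod_const_nrm:
  assumes "u \<in> car (mod_const A)" "0 \<le> K"
    "\<And>f. f \<in> car A \<Longrightarrow> to_modc f = u \<Longrightarrow> B \<le> K * nrm A f"
  shows "B \<le> K * nrm (mod_const A) u"
proof -
  let ?S = "{nrm A f |f. f \<in> car A \<and> to_modc f = u}"
  note ne = mod_const_nonempty[OF assms(1)]
  show ?thesis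
  proof (cases "K = 0")
    case True
    then show ?thesis using ne assms(3) by auto
  next
    case False
    then have K: "0 < K" using assms(2) by simp
    have "B / K \<le> Inf ?S" using assms(3) K by (intro cInf_greatest[OF ne]) (auto simp: field_simps)
    then show ?thesis using K unfolding mod_const_def by (simp add: field_simps)
  qed
qed

lemma mod_const_obtain:
  assumes "u \<in> car (mod_const A)" "nrm (mod_const A) u < M"
  obtains f where "f \<in> car A" "nrm A f < M" "to_modc f = u"
proof -
  have "Inf {nrm A f |f. f \<in> car A \<and> to_modc f = u} < M" using assms(2) by (simp add: mod_const_def)
  from cInf_lessD[OF mod_const_nonempty[OF assms(1)] this] show thesis using that by blast
qed

context flow_space
begin

abbreviation "Bmo \<equiv> BMO adj \<omega> \<beta> m"

lemma osc_eq:
  assumes "R \<in> cells"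
  shows "osc m f R = (\<Sum>x\<in>R. norm (f x - avg m R f) * m x) / sum m R"
  using cells_finite[OF assms] unfolding osc_def
  by (simp add: measure_vmeas set_integral_vmeas mult.commute)

lemma avg_eq:
  assumes "R \<in> cells"
  shows "avg m R f = (\<Sum>x\<in>R. f x * of_real (m x)) / of_real (sum m R)"
  using cells_finite[OF assms] unfolding avg_def
  by (simp add: measure_vmeas set_integral_vmeas scaleR_conv_of_real mult.commute)

lemma osc_nonneg: "R \<in> cells \<Longrightarrow> 0 \<le> osc m f R"
  using sum_m_cell_pos[of R] by (simp add: osc_eq sum_nonneg m_nonneg)

lemma cells_nonempty: "cells \<noteq> {}"
  using exhaustion[of "{}"] by blast

lemma osc_le_nrm_BMO: "f \<in> car Bmo \<Longrightarrow> R \<in> cells \<Longrightarrow> osc m f R \<le> nrm Bmo f"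
  unfolding BMO_def by (auto intro: cSUP_upper)

lemma nrm_nonneg_BMO: "nrm_nonneg Bmo"
  unfolding nrm_nonneg_def
  using cells_nonempty osc_nonneg osc_le_nrm_BMO by (meson ex_in_conv order_trans)

text \<open>The inclusion of the Lebesgue space in (i) reaches BMO only through bounded functions,
  by this embedding.\<close>

lemma bounded_BMO:
  assumes "\<And>x. norm (f x) \<le> c"
  shows "f \<in> car Bmo" "nrm Bmo f \<le> 2 * c"
proof -
  have "osc m f R \<le> 2 * c" if R: "R \<in> cells" for R
  proof -
    note mR = sum_m_cell_pos[OF R]
    have "norm (avg m R f) \<le> (\<Sum>x\<in>R. norm (f x) * m x) / sum m R"
      unfolding avg_eq[OF R] norm_divide using mR
      by (auto intro!: divide_right_mono order_trans[OF norm_sum] sum_mono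
          simp: norm_mult m_nonneg simp del: of_real_sum)
    also have "\<dots> \<le> (\<Sum>x\<in>R. c * m x) / sum m R"
      using mR assms m_nonneg by (intro divide_right_mono sum_mono mult_right_mono) auto
    also have "\<dots> = c" using mR by (simp add: sum_distrib_left[symmetric])
    finally have avg: "norm (avg m R f) \<le> c" .
    have "norm (f x - avg m R f) \<le> 2 * c" for x
      using norm_triangle_ineq4[of "f x" "avg m R f"] assms[of x] avg by linarith
    then have "osc m f R \<le> (\<Sum>x\<in>R. 2 * c * m x) / sum m R"
      unfolding osc_eq[OF R] using mR m_nonneg by (intro divide_right_mono sum_mono mult_right_mono) auto
    also have "\<dots> = 2 * c" using mR by (simp add: sum_distrib_left[symmetric])
    finally show ?thesis .
  qed
  note osc_le = this
  have "bdd_above (osc m f ` cells)" by (rule bdd_aboveI2[OF osc_le])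
  then show "f \<in> car Bmo" by (simp add: BMO_def)
  show "nrm Bmo f \<le> 2 * c" unfolding BMO_def using osc_le cells_nonempty by (auto intro: cSUP_least)
qed

text \<open>Makes the pairing with a layer insensitive to constants, hence well defined on the
  quotient.\<close>

lemma cell_bounded_mean_zero:
  assumes "cell_bounded b \<mu>" "finite K" "\<And>x. x \<notin> K \<Longrightarrow> b x = 0"
  shows "(\<Sum>x\<in>K. b x * of_real (m x)) = 0"
proof -
  obtain \<S> where S: "finite \<S>" "\<S> \<subseteq> cells" "disjoint \<S>" "\<And>x. x \<notin> \<Union> \<S> \<Longrightarrow> b x = 0"
    "\<And>Q. Q \<in> \<S> \<Longrightarrow> (\<Sum>x\<in>Q. b x * of_real (m x)) = 0"
    using assms(1) unfolding cell_bounded_def by auto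
  have fin: "finite (\<Union> \<S>)" using S(1,2) cells_finite by auto
  have "(\<Sum>x\<in>\<Union> \<S>. b x * of_real (m x)) = (\<Sum>Q\<in>\<S>. \<Sum>x\<in>Q. b x * of_real (m x))"
    using S(1-3) cells_finite by (subst sum.Union_disjoint) (auto simp: disjoint_def)
  also have "\<dots> = 0" using S(5) by simp
  finally have "mean_zero b" using mean_zero_iff[OF fin S(4)] by simp
  then show ?thesis using mean_zero_sum assms(2,3) by blast
qed

text \<open>On each cell \<open>b\<close> has mean zero, so the average of \<open>f\<close> may be
  subtracted there; what remains is the oscillation of \<open>f\<close> times the bound of
  \<open>b\<close>.\<close>

lemma BMO_pairing:
  assumes b: "cell_bounded b \<mu>" and K: "finite K" "\<And>x. x \<notin> K \<Longrightarrow> b x = 0" and f: "f \<in> car Bmo"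
  shows "norm (\<Sum>x\<in>K. f x * b x * of_real (m x)) \<le> \<mu> * nrm Bmo f"
proof -
  obtain \<S> c where S: "finite \<S>" "\<S> \<subseteq> cells" "disjoint \<S>" "\<And>x. x \<notin> \<Union> \<S> \<Longrightarrow> b x = 0"
    "0 < c" "\<And>x. norm (b x) \<le> c" "\<And>Q. Q \<in> \<S> \<Longrightarrow> (\<Sum>x\<in>Q. b x * of_real (m x)) = 0"
    "c * (\<Sum>Q\<in>\<S>. sum m Q) \<le> \<mu>"
    using b unfolding cell_bounded_def by blast
  have fin: "finite (\<Union> \<S>)" using S(1,2) cells_finite by auto
  have nn: "0 \<le> nrm Bmo f" using nrm_nonneg_BMO f by (simp add: nrm_nonneg_def)
  have "(\<Sum>x\<in>K. f x * b x * of_real (m x)) = (\<Sum>x\<in>K \<inter> \<Union> \<S>. f x * b x * of_real (m x))"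
    using S(4) K(1) by (intro sum.mono_neutral_right) auto
  also have "\<dots> = (\<Sum>x\<in>\<Union> \<S>. f x * b x * of_real (m x))"
    using K(2) fin by (intro sum.mono_neutral_left) auto
  also have "\<dots> = (\<Sum>Q\<in>\<S>. \<Sum>x\<in>Q. f x * b x * of_real (m x))"
    using S(1-3) cells_finite by (subst sum.Union_disjoint) (auto simp: disjoint_def)
  finally have eq: "(\<Sum>x\<in>K. f x * b x * of_real (m x)) = (\<Sum>Q\<in>\<S>. \<Sum>x\<in>Q. f x * b x * of_real (m x))" .
  have "norm (\<Sum>x\<in>Q. f x * b x * of_real (m x)) \<le> c * sum m Q * nrm Bmo f" if Q: "Q \<in> \<S>" for Q
  proof -
    have Qc: "Q \<in> cells" using Q S(2) by blast
    note mQ = sum_m_cell_pos[OF Qc]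
    have "(\<Sum>x\<in>Q. f x * b x * of_real (m x))
        = (\<Sum>x\<in>Q. (f x - avg m Q f) * b x * of_real (m x)) + avg m Q f * (\<Sum>x\<in>Q. b x * of_real (m x))"
      by (simp add: sum_distrib_left sum.distrib[symmetric] algebra_simps)
    also have "\<dots> = (\<Sum>x\<in>Q. (f x - avg m Q f) * b x * of_real (m x))" using S(7)[OF Q] by simp
    also have "norm \<dots> \<le> (\<Sum>x\<in>Q. c * (norm (f x - avg m Q f) * m x))"
    proof (rule sum_norm_le)
      fix x
      have "norm (b x) * (norm (f x - avg m Q f) * m x) \<le> c * (norm (f x - avg m Q f) * m x)"
        using S(6) m_nonneg by (intro mult_right_mono) auto
      then show "norm ((f x - avg m Q f) * b x * of_real (m x)) \<le> c * (norm (f x - avg m Q f) * m x)"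
        by (simp add: norm_mult m_nonneg mult_ac)
    qed
    also have "\<dots> = c * sum m Q * osc m f Q"
      using mQ by (simp add: osc_eq[OF Qc] sum_distrib_left[symmetric])
    also have "\<dots> \<le> c * sum m Q * nrm Bmo f"
      using mQ S(5) osc_le_nrm_BMO[OF f Qc] by (intro mult_left_mono) auto
    finally show ?thesis .
  qed
  then have "norm (\<Sum>x\<in>K. f x * b x * of_real (m x)) \<le> (\<Sum>Q\<in>\<S>. c * sum m Q * nrm Bmo f)"
    unfolding eq by (rule sum_norm_le)
  also have "\<dots> = c * (\<Sum>Q\<in>\<S>. sum m Q) * nrm Bmo f"
    by (simp only: sum_distrib_left sum_distrib_right)
  also have "\<dots> \<le> \<mu> * nrm Bmo f" using S(8) nn by (rule mult_right_mono)
  finally show ?thesis .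
qed

text \<open>The weights sum to 2 and \<open>bounded_BMO\<close> costs another 2, hence the constant
  4.\<close>

lemma Lp_BMO_sigma_couple:
  assumes "1 < q1"
  shows "sigma_couple scale_modc (mod_const (Lp m q1)) (mod_const Bmo) to_modc
     {u. Lp_sums_le q1 u 1} {v. \<forall>x. norm (v x) \<le> 1} 4"
proof
  let ?L = "mod_const (Lp m q1)" and ?B = "mod_const Bmo"
  show nn: "nrm_nonneg ?L" "nrm_nonneg ?B"
    using nrm_nonneg_mod_const nrm_nonneg_Lp nrm_nonneg_BMO by blast+
  show "to_modc (\<lambda>x. f x + g x) = to_modc f + to_modc g" for f g :: "'v \<Rightarrow> complex" by (rule to_modc_add)
  show "to_modc (\<lambda>x. c * f x) = scale_modc c (to_modc f)" for c and f :: "'v \<Rightarrow> complex" by (rule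
      to_modc_scale)
  show "to_modc h \<in> car (sum_space ?L ?B)" if "finite {x. h x \<noteq> 0}" for h
  proof -
    have "to_modc h \<in> car ?L" using that assms by (intro mod_const_I nrm_nonneg_Lp
        Lp_finite_support) auto
    moreover have "to_modc (\<lambda>_. 0) \<in> car ?B" using bounded_BMO[of "\<lambda>_. 0" 0] nrm_nonneg_BMO by
        (intro mod_const_I) auto
    ultimately have "to_modc h + to_modc (\<lambda>_. 0) \<in> car (sum_space ?L ?B)" by (rule sum_space_I(1)[OF nn])
    then show ?thesis by (simp flip: to_modc_add)
  qed
  show "summable (\<lambda>n. (1 / 2) ^ n * u n x)" if "\<And>n. u n \<in> {u. Lp_sums_le q1 u 1}" for u :: "nat \<Rightarrow> 'v
      \<Rightarrow> complex" and x
    using that assms by (intro Lp_series(1)[of q1 1]) auto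
  have geo: "summable (\<lambda>n. (1 / 2 :: real) ^ n)" by (rule summable_geometric) simp
  have bd: "summable (\<lambda>n. norm ((1 / 2) ^ n * v n x))" "norm (\<Sum>n. (1 / 2) ^ n * v n x) \<le> 2"
    if v: "\<And>n. v n \<in> {v. \<forall>x. norm (v x) \<le> 1}" for v :: "nat \<Rightarrow> 'v \<Rightarrow> complex" and x
  proof -
    have le: "norm ((1 / 2) ^ n * v n x) \<le> (1 / 2) ^ n" for n
      using mult_left_mono[of "norm (v n x)" 1 "(1 / 2) ^ n"] v by (simp add: norm_mult norm_power)
    show s: "summable (\<lambda>n. norm ((1 / 2) ^ n * v n x))"
      by (rule summable_comparison_test'[OF geo, of 0]) (use le in simp)
    show "norm (\<Sum>n. (1 / 2) ^ n * v n x) \<le> 2"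
      using summable_norm[OF s] suminf_le[OF le s geo] by (simp add: suminf_geometric)
  qed
  show "summable (\<lambda>n. (1 / 2) ^ n * v n x)"
    if "\<And>n. v n \<in> {v. \<forall>x. norm (v x) \<le> 1}" for v :: "nat \<Rightarrow> 'v \<Rightarrow> complex" and x
    using bd(1)[OF that] by (rule summable_norm_cancel)
  show "to_modc (\<lambda>x. of_real r * (\<Sum>n. (1 / 2) ^ n * u n x)) \<in> car ?L \<and>
      nrm ?L (to_modc (\<lambda>x. of_real r * (\<Sum>n. (1 / 2) ^ n * u n x))) \<le> 4 * r"
    if u: "\<And>n. u n \<in> {u. Lp_sums_le q1 u 1}" and r: "0 \<le> r" for u r
  proof -
    have "Lp_sums_le q1 (\<lambda>x. \<Sum>n. (1 / 2) ^ n * u n x) ((2 * 1) powr q1)"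
      using u assms by (intro Lp_series(2)) auto
    then have "Lp_sums_le q1 (\<lambda>x. of_real r * (\<Sum>n. (1 / 2) ^ n * u n x)) (r powr q1 * (2 * 1) powr q1)"
      by (rule Lp_sums_le_scale) (use r assms in \<open>auto simp: norm_mult\<close>)
    then have "Lp_sums_le q1 (\<lambda>x. of_real r * (\<Sum>n. (1 / 2) ^ n * u n x)) ((2 * r) powr q1)"
      by (simp add: powr_mult mult_ac)
    then have L: "(\<lambda>x. of_real r * (\<Sum>n. (1 / 2) ^ n * u n x)) \<in> car (Lp m q1)"
      "nrm (Lp m q1) (\<lambda>x. of_real r * (\<Sum>n. (1 / 2) ^ n * u n x)) \<le> 2 * r"
      using Lp_I[of q1 _ "2 * r"] assms r by auto
    then show ?thesis using mod_const_I[OF nrm_nonneg_Lp L(1)] r by linarith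
  qed
  show "to_modc (\<lambda>x. of_real r * (\<Sum>n. (1 / 2) ^ n * u n x)) \<in> car ?B \<and>
      nrm ?B (to_modc (\<lambda>x. of_real r * (\<Sum>n. (1 / 2) ^ n * u n x))) \<le> 4 * r"
    if u: "\<And>n. u n \<in> {v. \<forall>x. norm (v x) \<le> 1}" and r: "0 \<le> r" for u :: "nat \<Rightarrow> 'v \<Rightarrow> complex" and r
  proof -
    have "norm (of_real r * (\<Sum>n. (1 / 2) ^ n * u n x)) \<le> r * 2" for x
      unfolding norm_mult using bd(2)[OF u] r by (intro mult_mono) auto
    from bounded_BMO[of "\<lambda>x. of_real r * (\<Sum>n. (1 / 2) ^ n * u n x)", OF this]
    show ?thesis using mod_const_I[OF nrm_nonneg_BMO] by (auto intro: order_trans)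
  qed
qed

proposition Lp_BMO_upper:
  assumes q: "1 < q1" "q1 < q" and \<theta>: "0 < \<theta>" "\<theta> < 1" and rel: "1 / q = (1 - \<theta>) / q1"
    and M: "0 < M" and f: "Lp_sums_le q f (M powr q)"
  shows "to_modc f \<in> car (interp scale_modc (mod_const (Lp m q1)) (mod_const Bmo) \<theta>) \<and>
     nrm (interp scale_modc (mod_const (Lp m q1)) (mod_const Bmo) \<theta>) (to_modc f) \<le> 16 * M"
proof -
  interpret sc: sigma_couple scale_modc "mod_const (Lp m q1)" "mod_const Bmo" to_modc
    "{u. Lp_sums_le q1 u 1}" "{v. \<forall>x. norm (v x) \<le> 1}" 4
    by (rule Lp_BMO_sigma_couple[OF q(1)])
  define s where "s = 1 / (1 - \<theta>)"
  have s: "s * q1 = q" "0 < s" "s * (1 - \<theta>) = 1"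
    using rel \<theta> q by (auto simp: s_def field_simps)
  \<comment> \<open>The modulus is the power \<open>s * (1 - Re z)\<close> of
    \<open>norm (g x)\<close>. Where \<open>norm (g x) > 1\<close> it is at most the power
    \<open>s\<close>, whose \<open>q1\<close>-th power is summable as \<open>s * q1 = q\<close>;
    elsewhere it is at most 1. Hence the splitting at height 1 inside the strip.\<close>
  have family: "sc.analytic_family (\<lambda>z x. sgn_powr (g x) (of_real s * (1 - z)))"
    if g: "mean_zero g" "Lp_sums_le q g 1" for g
  proof (rule sc.analytic_familyI[where K = "{x. g x \<noteq> 0}"
        and u = "\<lambda>z x. if Re z = 0 \<or> (Re z \<noteq> 1 \<and> 1 < norm (g x)) then sgn_powr (g x) (of_real s * (1
            - z)) else 0"
        and v = "\<lambda>z x. if Re z = 0 \<or> (Re z \<noteq> 1 \<and> 1 < norm (g x)) then 0 else sgn_powr (g x) (of_real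
            s * (1 - z))"])
    show "finite {x. g x \<noteq> 0}" using g(1) by (simp add: mean_zero_def)
    show "sgn_powr (g x) (of_real s * (1 - z)) = 0" if "x \<notin> {x. g x \<noteq> 0}" for z x
      using that by (simp add: sgn_powr_def)
    show "(\<lambda>z. sgn_powr (g x) (of_real s * (1 - z))) holomorphic_on UNIV" for x
      by (intro sgn_powr_holomorphic holomorphic_intros)
    show "(\<lambda>x. if Re z = 0 \<or> (Re z \<noteq> 1 \<and> 1 < norm (g x)) then sgn_powr (g x) (of_real s * (1 - z))
        else 0)
        \<in> {u. Lp_sums_le q1 u 1}" if z: "z \<in> strip" for z
    proof -
      let ?u = "\<lambda>x. if Re z = 0 \<or> (Re z \<noteq> 1 \<and> 1 < norm (g x)) then sgn_powr (g x) (of_real s * (1 -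
          z)) else 0"
      have "norm (?u x) powr q1 \<le> norm (g x) powr q" for x
      proof -
        have "norm (?u x) \<le> norm (g x) powr s"
        proof (cases "Re z = 0 \<or> (Re z \<noteq> 1 \<and> 1 < norm (g x))")
          case True
          then have "norm (g x) powr (s * (1 - Re z)) \<le> norm (g x) powr s"
            using z s(2) by (cases "Re z = 0") (auto intro!: powr_mono simp: mult_left_le)
          then show ?thesis using True by (simp add: norm_sgn_powr)
        qed auto
        then have "norm (?u x) powr q1 \<le> (norm (g x) powr s) powr q1" using q by (intro powr_mono2) auto
        then show ?thesis using s(1) by (simp only: powr_powr)
      qed
      then have "(\<Sum>x\<in>K. norm (?u x) powr q1 * m x) \<le> (\<Sum>x\<in>K. norm (g x) powr q * m x)" for K
        using m_nonneg by (intro sum_mono mult_right_mono) auto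
      then show ?thesis using g(2) unfolding Lp_sums_le_def by (blast intro: order_trans)
    qed
    show "(\<lambda>x. if Re z = 0 \<or> (Re z \<noteq> 1 \<and> 1 < norm (g x)) then 0 else sgn_powr (g x) (of_real s * (1
        - z)))
        \<in> {v. \<forall>x. norm (v x) \<le> 1}" if z: "z \<in> strip" for z
    proof -
      have "norm (g x) powr (s * (1 - Re z)) \<le> 1" if "\<not> (Re z = 0 \<or> (Re z \<noteq> 1 \<and> 1 < norm (g x)))" "g
          x \<noteq> 0" for x
        using that z s(2) by (cases "Re z = 1") (auto intro!: powr_le1)
      then show ?thesis by (auto simp: norm_sgn_powr)
    qed
  qed auto
  obtain g where g: "\<And>n. mean_zero (g n)" "\<And>n. Lp_sums_le q (g n) 1"
    "\<And>x. (\<lambda>n. (1 / 2) ^ n * g n x) sums (f x / of_real (4 * M))"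
    using Lp_split[OF _ M f] q by auto
  have "complex_of_real s * (1 - of_real \<theta>) = of_real (s * (1 - \<theta>))" by simp
  then have "sgn_powr (g n x) (of_real s * (1 - of_real \<theta>)) = g n x" for n x
    using s(3) sgn_powr_one[of "g n x"] by simp
  moreover have "(\<lambda>x. of_real (4 * M) * (f x / of_real (4 * M))) = f" using M by (simp add: fun_eq_iff)
  ultimately show ?thesis
    using sc.interp_upper[where H = "\<lambda>n z x. sgn_powr (g n x) (of_real s * (1 - z))" and M = "4 * M"
        and \<theta> = \<theta> and f = "\<lambda>x. f x / of_real (4 * M)"] family[OF g(1,2)] g(3) M \<theta> by simp
qed

section \<open>From pairings with functions of mean zero to a function modulo constants\<close>

lemma mean_zero_dual_cell:
  assumes p: "1 < p" "1 < q" "1 / p + 1 / q = 1" and D: "0 \<le> D" and R: "R \<in> cells"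
    and dual: "\<And>g. mean_zero g \<Longrightarrow> (\<And>x. x \<notin> R \<Longrightarrow> g x = 0) \<Longrightarrow> Lp_sums_le q g 1 \<Longrightarrow>
              norm (\<Sum>x\<in>R. f x * g x * of_real (m x)) \<le> D"
  shows "(\<Sum>x\<in>R. norm (f x - avg m R f) powr p * m x) \<le> (4 * D) powr p"
proof (rule Lp_sums_le_dual[OF p])
  note finR = conjunct1[OF cells_finite[OF R]] and mR = sum_m_cell_pos[OF R]
  show "finite R" by (rule finR)
  fix h :: "'v \<Rightarrow> complex"
  assume h: "\<And>x. x \<notin> R \<Longrightarrow> h x = 0" "(\<Sum>x\<in>R. norm (h x) powr q * m x) \<le> 1"
  define hR where "hR = avg m R h"
  \<comment> \<open>An arbitrary test function is projected to mean zero. By Hoelder the average is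
    no larger in norm than \<open>h\<close>, and the crude triangle inequality then gives at most
    \<open>2 powr q * 2\<close>, which division by 4 brings back below 1.\<close>
  define g where "g x = (if x \<in> R then (h x - hR) / 4 else 0)" for x
  have sum_avg: "(\<Sum>x\<in>R. (k x - avg m R k) * of_real (m x)) = 0" for k :: "'v \<Rightarrow> complex"
  proof -
    have "(\<Sum>x\<in>R. (k x - avg m R k) * of_real (m x)) = (\<Sum>x\<in>R. k x * of_real (m x)) - avg m R k *
        of_real (sum m R)"
      by (simp add: left_diff_distrib sum_subtractf sum_distrib_left)
    then show ?thesis unfolding avg_eq[OF R] using mR by (simp del: of_real_sum)
  qed
  have g4: "(\<Sum>x\<in>R. k x * g x * of_real (m x)) = (\<Sum>x\<in>R. k x * (h x - hR) * of_real (m x)) / 4" for k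
      :: "'v \<Rightarrow> complex"
    unfolding sum_divide_distrib by (intro sum.cong) (auto simp: g_def)
  have g0: "g x = 0" if "x \<notin> R" for x using that by (simp add: g_def)
  have mz: "mean_zero g"
    using finR g4[of "\<lambda>_. 1"] sum_avg[of h] by (subst mean_zero_iff[of R]) (auto simp: g_def hR_def)
  have "Lp_sums_le q g 1"
  proof -
    have "(\<Sum>x\<in>R. norm (h x) * norm (1::complex) * m x) \<le> 1 * sum m R powr (1 / p)"
    proof (rule Holder_sum[OF p(2,1) _ finR])
      show "1 / q + 1 / p = 1" using p by simp
      show "(\<Sum>x\<in>R. norm (1::complex) powr p * m x) \<le> (sum m R powr (1 / p)) powr p"
        using p mR by (simp add: powr_powr)
    qed (use h mR in auto)
    then have "norm (\<Sum>x\<in>R. h x * of_real (m x)) \<le> sum m R powr (1 / p)"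
      by (intro order_trans[OF norm_sum]) (simp add: norm_mult m_nonneg)
    then have "norm hR \<le> sum m R powr (1 / p) / sum m R"
      unfolding hR_def avg_eq[OF R] norm_divide using mR by (simp add: divide_right_mono del:
          of_real_sum)
    also have "\<dots> = sum m R powr (1 / p - 1)" using mR by (simp add: powr_diff)
    also have "1 / p - 1 = - (1 / q)" using p(3) by simp
    finally have "norm hR powr q \<le> (sum m R powr (- (1 / q))) powr q" using p by (intro powr_mono2) auto
    also have "\<dots> = sum m R powr (- (1 / q) * q)" by (rule powr_powr)
    also have "- (1 / q) * q = - 1" using p by simp
    finally have "norm hR powr q * sum m R \<le> 1" using mR by (simp add: powr_minus field_simps)
    then have "(\<Sum>x\<in>R. norm (if x \<in> R then hR else 0) powr q * m x) \<le> 1" by (simp add: sum_distrib_left)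
    then have hR1: "Lp_sums_le q (\<lambda>x. if x \<in> R then hR else 0) 1"
      using p by (intro Lp_sums_le_finite_support[OF finR]) auto
    have "Lp_sums_le q h 1" using h p by (intro Lp_sums_le_finite_support[OF finR]) auto
    then have "Lp_sums_le q (\<lambda>x. if x \<in> R then h x - hR else 0) (2 powr q * (1 + 1))"
      using p by (intro Lp_sums_le_add[OF _ hR1]) (auto simp: norm_triangle_ineq4)
    then have "Lp_sums_le q g ((1 / 4) powr q * (2 powr q * (1 + 1)))"
      by (rule Lp_sums_le_scale) (use p in \<open>auto simp: g_def norm_divide\<close>)
    moreover have "(1 / 4) powr q * (2 powr q * (1 + 1)) \<le> 1"
    proof -
      have "2 powr 1 \<le> 2 powr q" using p by (intro powr_mono) auto
      then have "(1 / 4) powr q * (2 powr q * (1 + 1)) \<le> (1 / 4) powr q * (2 powr q * 2 powr q)"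
        by (intro mult_left_mono) auto
      also have "\<dots> = (1 / 4 * (2 * 2)) powr q" by (simp only: powr_mult)
      finally show ?thesis by simp
    qed
    ultimately show ?thesis by (rule Lp_sums_le_mono)
  qed
  from dual[OF mz _ this] g0 have "norm (\<Sum>x\<in>R. f x * g x * of_real (m x)) \<le> D" by blast
  then have le: "norm (\<Sum>x\<in>R. f x * (h x - hR) * of_real (m x)) \<le> 4 * D" unfolding g4 by simp
  \<comment> \<open>Subtracting the average is a self-adjoint projection, so it can be moved from
    the test function to \<open>f\<close>.\<close>
  have "(\<Sum>x\<in>R. f x * (h x - hR) * of_real (m x)) = (\<Sum>x\<in>R. (f x - avg m R f) * h x * of_real (m x))"
  proof -
    have "(\<Sum>x\<in>R. f x * (h x - hR) * of_real (m x)) - (\<Sum>x\<in>R. (f x - avg m R f) * h x * of_real (m x))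
        = avg m R f * (\<Sum>x\<in>R. (h x - hR) * of_real (m x)) - hR * (\<Sum>x\<in>R. (f x - avg m R f) * of_real
            (m x))"
      by (simp add: sum_distrib_left sum_subtractf[symmetric] algebra_simps)
    also have "\<dots> = 0" using sum_avg[of h] sum_avg[of f] by (simp add: hR_def)
    finally show ?thesis by simp
  qed
  then show "norm (\<Sum>x\<in>R. (f x - avg m R f) * h x * of_real (m x)) \<le> 4 * D" using le by simp
qed (use D in auto)

text \<open>The constants admissible for a finite set of vertices form a compact set that decreases as
  the finite set grows.\<close>

lemma Lp_mod_const_of_cells:
  assumes p: "1 < p" and D: "0 \<le> D"
    and cell: "\<And>R. R \<in> cells \<Longrightarrow> \<exists>c. (\<Sum>x\<in>R. norm (f x - c) powr p * m x) \<le> D powr p"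
  shows "\<exists>c. Lp_sums_le p (\<lambda>x. f x - c) (D powr p)"
proof -
  define Z where "Z L = {c. (\<Sum>x\<in>L. norm (f x - c) powr p * m x) \<le> D powr p}" for L
  have closed: "closed (Z L)" for L
    unfolding Z_def using p
    by (intro closed_Collect_le continuous_on_sum continuous_on_mult continuous_on_powr'
        continuous_intros) auto
  have anti: "Z L \<subseteq> Z L'" if "L' \<subseteq> L" "finite L" for L L'
    unfolding Z_def using that m_nonneg
    by (auto intro!: order_trans[OF sum_mono2[of L L' "\<lambda>x. norm (f x - _) powr p * m x"]])
  have ne: "Z L \<noteq> {}" if L: "finite L" for L
  proof -
    obtain R where R: "R \<in> cells" "L \<subseteq> R" using exhaustion[OF L] by blast
    then have "Z R \<noteq> {}" using cell[OF R(1)] by (auto simp: Z_def)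
    then show ?thesis using anti[OF R(2)] cells_finite[OF R(1)] by blast
  qed
  \<comment> \<open>A single vertex already confines the constant to a disc, which supplies the
    compactness.\<close>
  fix x0 :: 'v
  have "Z {x0} \<subseteq> cball (f x0) (D * m x0 powr (- (1 / p)))"
  proof
    fix c assume "c \<in> Z {x0}"
    then have "Lp_sums_le p (\<lambda>x. if x = x0 then f x - c else 0) (D powr p)"
      using p by (intro Lp_sums_le_finite_support[of "{x0}"]) (auto simp: Z_def)
    then have "norm (if x0 = x0 then f x0 - c else 0) \<le> D * m x0 powr (- (1 / p))"
      using p D by (intro Lp_point_bound) auto
    then show "c \<in> cball (f x0) (D * m x0 powr (- (1 / p)))" by (simp add: dist_norm)
  qed
  then have compact: "compact (Z {x0})"
    using closed[of "{x0}"] bounded_subset[OF bounded_cball] by (simp add: compact_eq_bounded_closed)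
  have "Z {x0} \<inter> \<Inter> (Z ` Collect finite) \<noteq> {}"
  proof (rule compact_imp_fip[OF compact])
    show "closed T" if "T \<in> Z ` Collect finite" for T using that closed by blast
    fix \<F> assume F: "finite \<F>" "\<F> \<subseteq> Z ` Collect finite"
    then obtain \<L> where L: "\<L> \<subseteq> Collect finite" "finite \<L>" "\<F> = Z ` \<L>"
      using finite_subset_image by metis
    \<comment> \<open>Finitely many conditions are implied by the one for the union of their vertex
      sets, and that one can be met since the union lies in some cell.\<close>
    have fin: "finite (insert x0 (\<Union> \<L>))" using L(1,2) by auto
    have "Z (insert x0 (\<Union> \<L>)) \<subseteq> Z L'" if "L' \<in> insert {x0} \<L>" for L'
      using that fin by (intro anti) auto
    then show "Z {x0} \<inter> \<Inter> \<F> \<noteq> {}" using ne[OF fin] L(3) by blast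
  qed
  then obtain c where "\<And>L. finite L \<Longrightarrow> c \<in> Z L" by blast
  then have "Lp_sums_le p (\<lambda>x. f x - c) (D powr p)" by (auto simp: Lp_sums_le_def Z_def)
  then show ?thesis ..
qed

text \<open>Duality by hand: the conjugate exponents \<open>r < r1\<close> play the part of
  \<open>p < p1\<close>, and the layered families for the Hardy space serve as test families for a
  Calderon function of the couple with BMO.\<close>

proposition Lp_BMO_lower:
  assumes q: "1 < q1" "q1 < q" and \<theta>: "0 < \<theta>" "\<theta> < 1" and rel: "1 / q = (1 - \<theta>) / q1"
  shows "\<exists>C>0. \<forall>F B. F \<in> calderon_class scale_modc (mod_const (Lp m q1)) (mod_const Bmo) \<longrightarrow> 0 < B \<longrightarrow>
      calderon_norm (mod_const (Lp m q1)) (mod_const Bmo) F \<le> B \<longrightarrow>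
      (\<exists>f. to_modc f = F (of_real \<theta>) \<and> Lp_sums_le q f ((C * B) powr q))"
proof -
  let ?L = "mod_const (Lp m q1)" and ?B = "mod_const Bmo"
  have nnL: "nrm_nonneg ?L" and nnB: "nrm_nonneg ?B"
    using nrm_nonneg_mod_const nrm_nonneg_Lp nrm_nonneg_BMO by blast+
  have "1 < q" using q by simp
  obtain r where r: "1 < r" "1 / q + 1 / r = 1" using conjugate_exponent[OF \<open>1 < q\<close>] .
  obtain r1 where r1: "1 < r1" "1 / q1 + 1 / r1 = 1" using conjugate_exponent[OF q(1)] .
  \<comment> \<open>In the dual couple \<open>r\<close> belongs to the parameter
    \<open>1 - \<theta>\<close>; this is the relation that \<open>interp_exp_theta\<close>
    requires.\<close>
  have rr: "1 / r = 1 - (1 - \<theta>) + (1 - \<theta>) / r1"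
  proof -
    have "1 / r = 1 - (1 - \<theta>) * (1 / q1)" using r(2) rel by simp
    also have "1 / q1 = 1 - 1 / r1" using r1(2) by simp
    finally show ?thesis by (simp add: algebra_simps diff_divide_distrib)
  qed
  have "1 / q < 1 / q1" using q by (intro divide_strict_left_mono) auto
  then have "1 / r1 < 1 / r" using r(2) r1(2) by linarith
  then have r_less: "r < r1" using r(1) r1(1) by (simp add: field_simps)
  obtain C where C: "0 < C" and layer: "\<And>g. mean_zero g \<Longrightarrow> Lp_sums_le r g 1 \<Longrightarrow>
      \<exists>K I b \<mu>. layered r r1 C g K I b \<mu>"
    using layered_exists[OF r(1) r_less] by blast
  have "\<exists>f. to_modc f = F (of_real \<theta>) \<and> Lp_sums_le q f ((4 * C * B) powr q)"
    if F: "F \<in> calderon_class scale_modc ?L ?B" and B: "0 < B" and FB: "calderon_norm ?L ?B F \<le> B"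
        for F B
  proof -
    have left: "F (Complex 0 t) \<in> car ?L" "nrm ?L (F (Complex 0 t)) \<le> B" for t
      using F FB calderon_norm_bounds(1)[OF F nnL, of t] unfolding calderon_class_def by auto
    have right: "F (Complex 1 t) \<in> car ?B" "nrm ?B (F (Complex 1 t)) \<le> B" for t
      using F FB calderon_norm_bounds(2)[OF F nnL, of t] unfolding calderon_class_def by auto
    define f where "f = rep_modc (F (of_real \<theta>))"
    have f: "to_modc f = F (of_real \<theta>)" unfolding f_def by (rule Quotient3_abs_rep[OF Quotient3_modc])
    have pairing: "norm (\<Sum>x\<in>R. f x * g x * of_real (m x)) \<le> C * B"
      if g: "mean_zero g" "Lp_sums_le r g 1" and R: "finite R" "\<And>x. x \<notin> R \<Longrightarrow> g x = 0" for g R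
    proof -
      obtain K I b \<mu> where L: "layered r r1 C g K I b \<mu>" using layer[OF g] by blast
      have K: "finite K" "\<And>k x. x \<notin> K \<Longrightarrow> b k x = 0" and I: "finite I"
        and sum_b: "\<And>x. g x = (\<Sum>k\<in>I. b k x)" and cb: "\<And>k. k \<in> I \<Longrightarrow> cell_bounded (b k) (\<mu> k) \<and> 0 \<le> \<mu> k"
        and mu: "(\<Sum>k\<in>I. 2 powr (real_of_int k * (r - 1)) * \<mu> k) \<le> C"
        and Lb: "Lp_sums_le r1 (\<lambda>x. of_real (\<Sum>k\<in>I. 2 powr (real_of_int k * (r / r1 - 1)) * norm (b k
            x))) (C powr r1)"
        using L unfolding layered_def by auto
      \<comment> \<open>Each layer is a fixed functional, and only its scalar coefficient will
        depend on \<open>z\<close>. The choice of representative is immaterial because layers have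
        mean zero.\<close>
      define l where "l k u = (\<Sum>x\<in>K. rep_modc u x * b k x * of_real (m x))" for k u
      have l_modc: "l k (to_modc h) = (\<Sum>x\<in>K. h x * b k x * of_real (m x))" if k: "k \<in> I" for k h
      proof -
        obtain c where c: "\<And>x. rep_modc (to_modc h) x = h x + c" using rep_modc_const by blast
        have "l k (to_modc h) = (\<Sum>x\<in>K. h x * b k x * of_real (m x)) + c * (\<Sum>x\<in>K. b k x * of_real (m x))"
          unfolding l_def c by (simp add: sum_distrib_left sum.distrib[symmetric] algebra_simps)
        then show ?thesis using cell_bounded_mean_zero[OF conjunct1[OF cb[OF k]] K(1)] K(2) by simp
      qed
      have l_dual: "in_dual scale_modc (sum_space ?L ?B) (l k)" if k: "k \<in> I" for k
      proof -
        \<comment> \<open>The added 1 keeps the bound positive when the layer vanishes, as Hoelder's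
          inequality is stated for a positive second bound.\<close>
        define E where "E = (\<Sum>x\<in>K. norm (b k x) powr r1 * m x) + 1"
        have E: "0 < E" unfolding E_def by (intro add_nonneg_pos sum_nonneg) (auto simp: m_nonneg)
        define D where "D = max (E powr (1 / r1)) (\<mu> k)"
        have D0: "0 \<le> D" unfolding D_def by (simp add: le_max_iff_disj)
        have "norm (l k u) \<le> D * nrm (sum_space ?L ?B) u" if "u \<in> car (sum_space ?L ?B)" for u
        proof (rule le_sum_space_nrm[OF that D0])
          fix v w assume vw: "v \<in> car ?L" "w \<in> car ?B" "u = v + w"
          obtain v' w' where v': "v = to_modc v'" and w': "w = to_modc w'"
            using vw unfolding mod_const_def by auto
          have "l k u = l k v + l k w"
            unfolding vw(3) v' w' to_modc_add[symmetric] l_modc[OF k]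
            by (simp add: sum.distrib[symmetric] algebra_simps)
          moreover have "norm (l k v) \<le> D * nrm ?L v"
          proof (rule le_mod_const_nrm[OF vw(1) D0])
            fix h assume h: "h \<in> car (Lp m q1)" "to_modc h = v"
            have "norm (l k v) \<le> (\<Sum>x\<in>K. norm (h x) * norm (b k x) * m x)"
              unfolding h(2)[symmetric] l_modc[OF k]
              by (rule sum_norm_le) (simp add: norm_mult m_nonneg)
            also have "\<dots> \<le> nrm (Lp m q1) h * E powr (1 / r1)"
              using Lp_sums_leD[OF Lp_D[OF h(1)] K(1)] q nrm_Lp_nonneg E r1
              by (intro Holder_sum_nonneg[OF q(1) r1 K(1)]) (auto simp: powr_powr E_def)
            also have "\<dots> \<le> nrm (Lp m q1) h * D" using nrm_Lp_nonneg by (intro mult_left_mono) (auto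
                simp: D_def)
            finally show "norm (l k v) \<le> D * nrm (Lp m q1) h" by (simp add: mult.commute)
          qed
          moreover have "norm (l k w) \<le> D * nrm ?B w"
          proof (rule le_mod_const_nrm[OF vw(2) D0])
            fix h assume h: "h \<in> car Bmo" "to_modc h = w"
            have "norm (l k w) \<le> \<mu> k * nrm Bmo h"
              unfolding h(2)[symmetric] l_modc[OF k]
              using BMO_pairing[OF conjunct1[OF cb[OF k]] K(1) _ h(1)] K(2) by blast
            also have "\<dots> \<le> D * nrm Bmo h"
              using nrm_nonneg_BMO h(1) by (intro mult_right_mono) (auto simp: D_def nrm_nonneg_def)
            finally show "norm (l k w) \<le> D * nrm Bmo h" .
          qed
          ultimately show "norm (l k u) \<le> D * (nrm ?L v + nrm ?B w)"
            using norm_triangle_ineq[of "l k v" "l k w"] by (simp add: distrib_left)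
        qed
        moreover have "l k (u + v) = l k u + l k v" for u v
        proof -
          obtain u' v' where "u = to_modc u'" "v = to_modc v'"
            using Quotient3_abs_rep[OF Quotient3_modc] by metis
          then show ?thesis unfolding \<open>u = to_modc u'\<close> \<open>v = to_modc v'\<close> to_modc_add[symmetric]
              l_modc[OF k]
            by (simp add: sum.distrib[symmetric] algebra_simps)
        qed
        moreover have "l k (scale_modc c u) = c * l k u" for c u
        proof -
          obtain u' where "u = to_modc u'" using Quotient3_abs_rep[OF Quotient3_modc] by metis
          then show ?thesis unfolding \<open>u = to_modc u'\<close> to_modc_scale[symmetric] l_modc[OF k]
            by (simp add: sum_distrib_left mult_ac)
        qed
        ultimately show ?thesis unfolding in_dual_def by blast
      qed
      \<comment> \<open>The reflection to \<open>1 - z\<close> exchanges the edges of the test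
        family: its side of exponent \<open>r1\<close> meets exponent \<open>q1\<close> at
        \<open>Re z = 0\<close>, and its atomic side meets BMO at \<open>Re z = 1\<close>.\<close>
      have "norm (\<Sum>k\<in>I. interp_exp r r1 k (1 - of_real \<theta>) * l k (F (of_real \<theta>))) \<le> C * B"
      proof (rule calderon_class_three_lines[OF F I l_dual, where \<phi> = "\<lambda>k z. interp_exp r r1 k (1 - z)"])
        show "(\<lambda>z. interp_exp r r1 k (1 - z)) holomorphic_on UNIV" for k
          unfolding interp_exp_def by (intro holomorphic_intros)
        show "bounded ((\<lambda>z. interp_exp r r1 k (1 - z)) ` strip)" for k
        proof -
          have "(\<lambda>z. interp_exp r r1 k (1 - z)) ` strip \<subseteq> interp_exp r r1 k ` strip"
          proof
            fix w assume "w \<in> (\<lambda>z. interp_exp r r1 k (1 - z)) ` strip"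
            then obtain z where "z \<in> strip" "w = interp_exp r r1 k (1 - z)" by blast
            then show "w \<in> interp_exp r r1 k ` strip" by (intro image_eqI[of _ _ "1 - z"]) auto
          qed
          then show ?thesis using interp_exp_bounded bounded_subset by blast
        qed
        show "norm (\<Sum>k\<in>I. interp_exp r r1 k (1 - Complex 0 t) * l k (F (Complex 0 t))) \<le> C * B" for t
        proof -
          let ?z = "1 - Complex 0 t"
          have z: "?z \<in> strip" by simp
          define G where "G x = (\<Sum>k\<in>I. interp_exp r r1 k ?z * b k x)" for x
          have nG: "norm (G x) \<le> norm (complex_of_real (\<Sum>k\<in>I. 2 powr (real_of_int k * (r / r1 - 1))
              * norm (b k x)))" for x
          proof -
            have "norm (G x) \<le> (\<Sum>k\<in>I. 2 powr (real_of_int k * (r / r1 - 1)) * norm (b k x))"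
              unfolding G_def using norm_interp_exp_le(2)[OF z r(1) r_less]
              by (intro sum_norm_le) (auto simp: norm_mult intro!: mult_right_mono)
            then show ?thesis by (simp add: sum_nonneg del: of_real_sum)
          qed
          have LG: "Lp_sums_le r1 G (C powr r1)"
            using Lp_sums_le_scale[OF Lb, of 1 G] nG r1 by simp
          have "norm (\<Sum>k\<in>I. interp_exp r r1 k ?z * l k (F (Complex 0 t))) \<le> C * nrm ?L (F (Complex 0 t))"
          proof (rule le_mod_const_nrm[OF left(1)])
            fix h assume h: "h \<in> car (Lp m q1)" "to_modc h = F (Complex 0 t)"
            have "(\<Sum>k\<in>I. interp_exp r r1 k ?z * l k (F (Complex 0 t)))
                = (\<Sum>k\<in>I. \<Sum>x\<in>K. h x * (interp_exp r r1 k ?z * b k x) * of_real (m x))"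
              unfolding h(2)[symmetric] by (intro sum.cong refl) (simp add: l_modc sum_distrib_left
                  mult_ac)
            also have "\<dots> = (\<Sum>x\<in>K. h x * G x * of_real (m x))"
              unfolding G_def by (subst sum.swap) (simp add: sum_distrib_left sum_distrib_right)
            also have "norm \<dots> \<le> (\<Sum>x\<in>K. norm (h x) * norm (G x) * m x)"
              by (rule sum_norm_le) (simp add: norm_mult m_nonneg)
            also have "\<dots> \<le> nrm (Lp m q1) h * C"
              using Lp_sums_leD[OF Lp_D[OF h(1)] K(1)] q nrm_Lp_nonneg C Lp_sums_leD[OF LG K(1)]
              by (intro Holder_sum_nonneg[OF q(1) r1 K(1)]) auto
            finally show "norm (\<Sum>k\<in>I. interp_exp r r1 k ?z * l k (F (Complex 0 t))) \<le> C * nrm (Lp m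
                q1) h"
              by (simp add: mult.commute)
          qed (use C in simp)
          also have "\<dots> \<le> C * B" using left(2) C by (intro mult_left_mono) auto
          finally show ?thesis .
        qed
        show "norm (\<Sum>k\<in>I. interp_exp r r1 k (1 - Complex 1 t) * l k (F (Complex 1 t))) \<le> C * B" for t
        proof -
          let ?z = "1 - Complex 1 t"
          have z: "?z \<in> strip" by simp
          have "norm (\<Sum>k\<in>I. interp_exp r r1 k ?z * l k (F (Complex 1 t))) \<le> C * nrm ?B (F (Complex 1 t))"
          proof (rule le_mod_const_nrm[OF right(1)])
            fix h assume h: "h \<in> car Bmo" "to_modc h = F (Complex 1 t)"
            have nn: "0 \<le> nrm Bmo h" using nrm_nonneg_BMO h(1) by (simp add: nrm_nonneg_def)
            have "norm (\<Sum>k\<in>I. interp_exp r r1 k ?z * l k (F (Complex 1 t)))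
                \<le> (\<Sum>k\<in>I. 2 powr (real_of_int k * (r - 1)) * (\<mu> k * nrm Bmo h))"
            proof (rule sum_norm_le)
              fix k assume k: "k \<in> I"
              have "norm (l k (F (Complex 1 t))) \<le> \<mu> k * nrm Bmo h"
                unfolding h(2)[symmetric] l_modc[OF k]
                using BMO_pairing[OF conjunct1[OF cb[OF k]] K(1) _ h(1)] K(2) by blast
              then show "norm (interp_exp r r1 k ?z * l k (F (Complex 1 t)))
                  \<le> 2 powr (real_of_int k * (r - 1)) * (\<mu> k * nrm Bmo h)"
                unfolding norm_mult using norm_interp_exp_le(1)[OF z r(1) r_less, of k]
                by (intro mult_mono) auto
            qed
            also have "\<dots> = (\<Sum>k\<in>I. 2 powr (real_of_int k * (r - 1)) * \<mu> k) * nrm Bmo h"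
              by (simp only: sum_distrib_right mult.assoc)
            also have "\<dots> \<le> C * nrm Bmo h" using mu nn by (rule mult_right_mono)
            finally show "norm (\<Sum>k\<in>I. interp_exp r r1 k ?z * l k (F (Complex 1 t))) \<le> C * nrm Bmo h" .
          qed (use C in simp)
          also have "\<dots> \<le> C * B" using right(2) C by (intro mult_left_mono) auto
          finally show ?thesis .
        qed
      qed (use \<theta> in auto)
      moreover have "interp_exp r r1 k (1 - of_real \<theta>) = 1" for k
        using interp_exp_theta[OF r(1) rr, of k] by simp
      ultimately have "norm (\<Sum>k\<in>I. l k (F (of_real \<theta>))) \<le> C * B" by simp
      moreover have "(\<Sum>k\<in>I. l k (F (of_real \<theta>))) = (\<Sum>x\<in>K. f x * g x * of_real (m x))"
      proof -
        have "(\<Sum>k\<in>I. l k (F (of_real \<theta>))) = (\<Sum>k\<in>I. \<Sum>x\<in>K. f x * b k x * of_real (m x))"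
          unfolding f[symmetric] by (intro sum.cong refl) (simp add: l_modc)
        then show ?thesis
          by (subst (asm) sum.swap) (simp add: sum_b sum_distrib_left sum_distrib_right)
      qed
      moreover have "(\<Sum>x\<in>K. f x * g x * of_real (m x)) = (\<Sum>x\<in>R. f x * g x * of_real (m x))"
      proof -
        have gK: "g x = 0" if "x \<notin> K" for x using K(2)[OF that] sum_b by simp
        have "(\<Sum>x\<in>K. f x * g x * of_real (m x)) = (\<Sum>x\<in>K \<inter> R. f x * g x * of_real (m x))"
          using K(1) R(2) by (intro sum.mono_neutral_right) auto
        also have "\<dots> = (\<Sum>x\<in>R. f x * g x * of_real (m x))"
          using R(1) gK by (intro sum.mono_neutral_left) auto
        finally show ?thesis .
      qed
      ultimately show ?thesis by simp
    qed
    have CB: "0 \<le> C * B" using C B by simp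
    \<comment> \<open>On a single cell the average serves as the constant. It varies with the cell,
      so one constant for all cells still has to be found by compactness.\<close>
    have "\<exists>c. (\<Sum>x\<in>R. norm (f x - c) powr q * m x) \<le> (4 * (C * B)) powr q" if R: "R \<in> cells" for R
      using mean_zero_dual_cell[OF \<open>1 < q\<close> r CB R, of f] pairing cells_finite[OF R] by blast
    then obtain c where c: "Lp_sums_le q (\<lambda>x. f x - c) ((4 * (C * B)) powr q)"
      using Lp_mod_const_of_cells[OF \<open>1 < q\<close>, of "4 * (C * B)" f] CB by auto
    have "to_modc (\<lambda>x. f x - c) = F (of_real \<theta>)"
      unfolding f[symmetric] to_modc_eq_iff by (intro exI[of _ "- c"]) simp
    then show ?thesis using c by (auto simp: mult.assoc)
  qed
  then show ?thesis using C by (intro exI[of _ "4 * C"]) auto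
qed

proposition interp_spaces:
  assumes "0 < \<theta>" "\<theta> < 1" "1 < q1" "q1 < q" "1 < p" "p < p1"
    and "1 / q = (1 - \<theta>) / q1" and "1 / p = 1 - \<theta> + \<theta> / p1"
  shows "same_space (interp scale_modc (mod_const (Lp m q1)) (mod_const Bmo) \<theta>) (mod_const (Lp m q))"
    and "same_space (interp scale_fun Hardy (Lp m p1) \<theta>) (Lp m p)"
proof -
  obtain C where C: "0 < C" and low: "\<And>F B. F \<in> calderon_class scale_modc (mod_const (Lp m q1))
      (mod_const Bmo) \<Longrightarrow>
      0 < B \<Longrightarrow> calderon_norm (mod_const (Lp m q1)) (mod_const Bmo) F \<le> B \<Longrightarrow>
      \<exists>f. to_modc f = F (of_real \<theta>) \<and> Lp_sums_le q f ((C * B) powr q)"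
    using Lp_BMO_lower[of q1 q \<theta>] assms by blast
  show "same_space (interp scale_modc (mod_const (Lp m q1)) (mod_const Bmo) \<theta>) (mod_const (Lp m q))"
  proof (rule same_space_interp_I[where C = "max 16 C"])
    show "nrm_nonneg (mod_const (Lp m q1))" "nrm_nonneg (mod_const (Lp m q))"
      by (intro nrm_nonneg_mod_const nrm_nonneg_Lp)+
    fix u :: "'v modc" and M :: real
    assume u: "u \<in> car (mod_const (Lp m q))" "nrm (mod_const (Lp m q)) u < M" and M: "0 < M"
    obtain f where f: "f \<in> car (Lp m q)" "nrm (Lp m q) f < M" "to_modc f = u"
      using mod_const_obtain[OF u] .
    have "Lp_sums_le q f (M powr q)" using Lp_iff[of q M f] f assms M by simp
    from Lp_BMO_upper[OF assms(3,4,1,2,7) M this] f(3)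
    have "u \<in> car (interp scale_modc (mod_const (Lp m q1)) (mod_const Bmo) \<theta>)"
      "nrm (interp scale_modc (mod_const (Lp m q1)) (mod_const Bmo) \<theta>) u \<le> 16 * M" by auto
    moreover have "16 * M \<le> max 16 C * M" using M by (intro mult_right_mono) auto
    ultimately show "u \<in> car (interp scale_modc (mod_const (Lp m q1)) (mod_const Bmo) \<theta>) \<and>
      nrm (interp scale_modc (mod_const (Lp m q1)) (mod_const Bmo) \<theta>) u \<le> max 16 C * M" by simp
  next
    fix F and B :: real
    assume F: "F \<in> calderon_class scale_modc (mod_const (Lp m q1)) (mod_const Bmo)" and B: "0 < B"
      and FB: "calderon_norm (mod_const (Lp m q1)) (mod_const Bmo) F \<le> B"
    obtain f where f: "to_modc f = F (of_real \<theta>)" "Lp_sums_le q f ((C * B) powr q)"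
      using low[OF F B FB] by blast
    have L: "f \<in> car (Lp m q)" "nrm (Lp m q) f \<le> C * B" using Lp_I[OF f(2)] assms C B by auto
    note mod_const_I[OF nrm_nonneg_Lp L(1)]
    moreover have "C * B \<le> max 16 C * B" using B by (intro mult_right_mono) auto
    ultimately show "F (of_real \<theta>) \<in> car (mod_const (Lp m q)) \<and>
        nrm (mod_const (Lp m q)) (F (of_real \<theta>)) \<le> max 16 C * B"
      using L(2) f(1) by auto
  qed simp
next
  obtain C where C: "0 < C" and up: "\<And>f M. 0 < M \<Longrightarrow> Lp_sums_le p f (M powr p) \<Longrightarrow>
     f \<in> car (interp scale_fun Hardy (Lp m p1) \<theta>) \<and> nrm (interp scale_fun Hardy (Lp m p1) \<theta>) f \<le> C * M"
    using Hardy_Lp_upper[of p p1 \<theta>] assms by blast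
  show "same_space (interp scale_fun Hardy (Lp m p1) \<theta>) (Lp m p)"
  proof (rule same_space_interp_I[where C = "max 1 C"])
    show "nrm_nonneg Hardy" by (rule nrm_nonneg_H1)
    show "nrm_nonneg (Lp m p)" by (rule nrm_nonneg_Lp)
    fix u :: "'v \<Rightarrow> complex" and M :: real
    assume u: "u \<in> car (Lp m p)" "nrm (Lp m p) u < M" and M: "0 < M"
    have "Lp_sums_le p u (M powr p)" using Lp_iff[of p M u] u assms M by simp
    note up[OF M this]
    moreover have "C * M \<le> max 1 C * M" using M by (intro mult_right_mono) auto
    ultimately show "u \<in> car (interp scale_fun Hardy (Lp m p1) \<theta>) \<and>
        nrm (interp scale_fun Hardy (Lp m p1) \<theta>) u \<le> max 1 C * M" by linarith
  next
    fix F and B :: real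
    assume F: "F \<in> calderon_class scale_fun Hardy (Lp m p1)" and B: "0 < B"
      and FB: "calderon_norm Hardy (Lp m p1) F \<le> B"
    have "Lp_sums_le p (F (of_real \<theta>)) (B powr p)"
      by (rule Hardy_Lp_lower[OF assms(5,6,1,2,8) F FB B])
    then have "F (of_real \<theta>) \<in> car (Lp m p)" "nrm (Lp m p) (F (of_real \<theta>)) \<le> B"
      using Lp_I[of p "F (of_real \<theta>)" B] assms B by auto
    moreover have "1 * B \<le> max 1 C * B" using B by (intro mult_right_mono) auto
    ultimately show "F (of_real \<theta>) \<in> car (Lp m p) \<and> nrm (Lp m p) (F (of_real \<theta>)) \<le> max 1 C * B" by simp
  qed simp
qed

end

section \<open>From the doubling tree to the abstract setting\<close>

lemma flow_space_of_tree:
  assumes tree: "is_tree adj" and ray: "geodesic_ray adj \<omega>"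
    and flow: "flow_measure adj \<omega> m" and doubling: "locally_doubling adj m" and \<beta>: "12 \<le> \<beta>"
  shows "\<exists>A. flow_space m adj \<omega> \<beta> A"
proof -
  interpret rt: rooted_tree adj \<omega> by unfold_locales (fact tree ray)+
  interpret vw: vertex_weight m by unfold_locales (use flow in \<open>simp add: flow_measure_def\<close>)
  have sums: "(m has_sum m x) {y. rt.par y = x}" for x
    using flow unfolding flow_measure_def rt.sons_eq by blast
  \<comment> \<open>Radius \<open>1 / 2\<close> is chosen because the ball of that radius is a
    point, while the doubled ball contains the parent. Doubling thus compares the mass of a vertex
    with that of its parent.\<close>
  obtain D where D: "1 < D" and db: "\<And>x. emeasure (vmeas m) (gball adj x (2 * (1 / 2)))
      \<le> ennreal D * emeasure (vmeas m) (gball adj x (1 / 2))"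
    using doubling unfolding locally_doubling_def by (metis half_gt_zero_iff zero_less_one)
  have point: "emeasure (vmeas m) {x} = ennreal (m x)" for x
    unfolding vmeas_def by (subst emeasure_point_measure_finite2) auto
  have m_par_le: "m (rt.par x) \<le> D * m x" for x
  proof -
    have "y = x" if "real (gdist adj x y) \<le> 1 / 2" for y
    proof -
      have "gdist adj x y = 0" using that by linarith
      then show ?thesis using rt.d_eq_0[of x y] by simp
    qed
    then have "gball adj x (1 / 2) = {x}" unfolding gball_def by (auto simp: rt.d_refl)
    moreover have "{rt.par x} \<subseteq> gball adj x (2 * (1 / 2))"
      unfolding gball_def using rt.d_adj[OF rt.par(1)[of x]] by simp
    then have "emeasure (vmeas m) {rt.par x} \<le> emeasure (vmeas m) (gball adj x (2 * (1 / 2)))"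
      by (rule emeasure_mono) (simp add: vmeas_def sets_point_measure)
    ultimately have "ennreal (m (rt.par x)) \<le> ennreal D * ennreal (m x)"
      using db[of x] point by simp
    then show ?thesis using D vw.m_nonneg by (simp flip: ennreal_mult)
  qed
  \<comment> \<open>Every son has at least the mass \<open>m x / D\<close>, and together the sons
    have mass \<open>m x\<close>, so there are at most \<open>D\<close> of them.\<close>
  have fin: "finite {y. rt.par y = x}" for x
  proof (rule ccontr)
    assume inf: "infinite {y. rt.par y = x}"
    obtain N :: nat where N: "D < real N" using reals_Archimedean2 by blast
    obtain F where F: "F \<subseteq> {y. rt.par y = x}" "finite F" "card F = N"
      using infinite_arbitrarily_large[OF inf] by blast
    have "sum m F \<le> m x"
      using F has_sum_infsum sums[of x] vw.m_nonneg finite_sum_le_has_sum[OF sums[of x], of F] by auto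
    moreover have "real N * (m x / D) \<le> sum m F"
    proof -
      have "m x / D \<le> m y" if "y \<in> F" for y
        using m_par_le[of y] that F(1) D by (auto simp: field_simps)
      then show ?thesis using sum_bounded_below[of F "m x / D" m] F(3) by simp
    qed
    ultimately have "real N * (m x / D) \<le> m x" by linarith
    then show False using D N vw.m_pos[of x] by (simp add: field_simps)
  qed
  interpret ft: flow_tree rt.par rt.lev m D
  proof
    show "rt.lev (rt.par x) = rt.lev x + 1" for x by (rule rt.par)
    show "0 < m x" for x by (rule vw.m_pos)
    show "finite {y. rt.par y = x}" for x by (rule fin)
    show "(\<Sum>y | rt.par y = x. m y) = m x" for x
      using sums[of x] fin[of x] by (simp add: has_sum_finite_iff)
    show "m (rt.par x) \<le> D * m x" for x by (rule m_par_le)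
    show "\<exists>i j. (rt.par ^^ i) x = (rt.par ^^ j) y" for x y by (rule rt.ancestors_meet)
  qed
  have cells: "admissible adj \<omega> \<beta> = ft.cells \<beta>"
  proof -
    have "{trapezoid adj \<omega> h' h'' x0 |h' h'' x0. 1 \<le> h' \<and> h' < h'' \<and> 2 \<le> real_of_int h'' / real_of_int h'
            \<and> real_of_int h'' / real_of_int h' \<le> \<beta>}
        = {ft.trap h k x0 |h k x0. 1 \<le> h \<and> 2 * h \<le> k \<and> real k \<le> \<beta> * real h}" (is "?A = ?B")
    proof
      show "?A \<subseteq> ?B"
      proof
        fix R assume "R \<in> ?A"
        then obtain h' h'' x0 where R: "R = trapezoid adj \<omega> h' h'' x0" and h: "1 \<le> h'" "h' < h''"
          "2 \<le> real_of_int h'' / real_of_int h'" "real_of_int h'' / real_of_int h' \<le> \<beta>" by blast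
        have "R = ft.trap (nat h') (nat h'') x0"
          using rt.trapezoid_eq[of "nat h'" "nat h''" x0] h(1,2) unfolding R ft.trap_def by simp
        moreover have "2 * real_of_int h' \<le> real_of_int h''" "real_of_int h'' \<le> \<beta> * real_of_int h'"
          using h by (auto simp: field_simps)
        then have "1 \<le> nat h'" "2 * nat h' \<le> nat h''" "real (nat h'') \<le> \<beta> * real (nat h')"
          using h(1,2) by auto
        ultimately show "R \<in> ?B" by blast
      qed
      show "?B \<subseteq> ?A"
      proof
        fix R assume "R \<in> ?B"
        then obtain h k x0 where R: "R = ft.trap h k x0" and h: "1 \<le> h" "2 * h \<le> k" "real k \<le> \<beta> * real h"
          by blast
        have "R = trapezoid adj \<omega> (int h) (int k) x0" unfolding R ft.trap_def rt.trapezoid_eq ..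
        moreover have "1 \<le> int h" "int h < int k" "2 \<le> real_of_int (int k) / real_of_int (int h)"
          "real_of_int (int k) / real_of_int (int h) \<le> \<beta>"
          using h by (auto simp: field_simps)
        ultimately show "R \<in> ?A" by blast
      qed
    qed
    then show ?thesis unfolding admissible_def ft.cells_def by simp
  qed
  have "flow_space m adj \<omega> \<beta> (\<beta> + 2 * D ^ 2)"
  proof
    show "1 \<le> \<beta> + 2 * D ^ 2" using \<beta> by (simp add: add_increasing2)
    show "finite R \<and> R \<noteq> {}" if "R \<in> admissible adj \<omega> \<beta>" for R
      using that ft.cells_finite unfolding cells by blast
    show "\<exists>R\<in>admissible adj \<omega> \<beta>. K \<subseteq> R \<and> t \<le> sum m R \<and>
        (\<exists>\<D>. laminar_refinement (\<beta> + 2 * D ^ 2) m (admissible adj \<omega> \<beta>) R \<D>)" if "finite K" for K t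
      using ft.exhaustion[OF \<beta> that] unfolding cells .
  qed
  then show ?thesis ..
qed

theorem theorem5p6:
  fixes adj :: "'v \<Rightarrow> 'v \<Rightarrow> bool" and \<omega> :: "nat \<Rightarrow> 'v" and m :: "'v \<Rightarrow> real"
    and \<beta> \<theta> q1 q p p1 :: real
  assumes "is_tree adj" and "geodesic_ray adj \<omega>"
    and "flow_measure adj \<omega> m" and "locally_doubling adj m"
    and "12 \<le> \<beta>"
    and "0 < \<theta>" and "\<theta> < 1"
    and "1 < q1" and "q1 < q" and "1 < p" and "p < p1"
    and "1 / q = (1 - \<theta>) / q1" and "1 / p = 1 - \<theta> + \<theta> / p1"
  shows "same_space (interp scale_modc (mod_const (Lp m q1)) (mod_const (BMO adj \<omega> \<beta> m)) \<theta>)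
                    (mod_const (Lp m q)) \<and>
         same_space (interp scale_fun (H1 adj \<omega> \<beta> m) (Lp m p1) \<theta>) (Lp m p)"
proof -
  obtain A where "flow_space m adj \<omega> \<beta> A" using flow_space_of_tree[OF assms(1-5)] by blast
  then interpret flow_space m adj \<omega> \<beta> A .
  show ?thesis using interp_spaces[OF assms(6-13)] by blast
qed

end
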